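(* Let $d\ge2$, $I=[0,1]$, $0<\alpha\le d$, and let $1\le p,q\le\infty$ satisfy $\frac dq\le 1-\frac1p$, $q\ge 2d$, $\frac{\beta(\alpha)}{q}+\frac1p<1$, and $q>\beta(\alpha)+1$. If $\epsilon>0$ is sufficiently small, then there is a constant $C$, independent of $\gamma$ and $\mu$, such that \[ \|T_\lambda^\gamma f\|_{L^q(d\mu)}\le C\lambda^{-\frac\alpha q}\|f\|_{L^p(I)} \] for all $\gamma\in\mathfrak G(\epsilon)$, all $\mu\in\mathfrak B(\alpha,1)$, all $\lambda\ge1$ and all $f\in L^p(I)$.
   Context: $T_\lambda^\gamma f(x)=\int_I e^{i\lambda x\cdot\gamma(t)}f(t)\,dt$, $x\in\mathbb R^d$. For $0<\alpha\le d$, $\beta(\alpha)=(j+1)\alpha+\frac{(d-j-1)(d-j)}{2}$ if $d-j-1<\alpha\le d-j$, $j=0,\dots,d-1$. Put $\gamma_\circ(t)=\big(t,\frac{t^2}{2!},\dots,\frac{t^d}{d!}\big)$; $\mathfrak G(\epsilon)$ is the set of $C^{d+1}$ curves $\gamma:I\to\mathbb R^d$ with $\|\gamma-\gamma_\circ\|_{C^{d+1}(I)}\le\epsilon$. For $M>0$, $\mathfrak B(\alpha,M)$ is the set of positive Borel measures $\mu$ on $\mathbb R^d$ with $\mu(B(x,\rho))\le M\rho^\alpha$ for all $x\in\mathbb R^d$, $\rho>0$. *)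

theory Defs
  imports "HOL-Analysis.Analysis" "HOL-Probability.Essential_Supremum"
begin

(* Euclidean d-space is real ^ 'n with d = CARD('n); the linear order on the index type
   enumerates the coordinates as 1, ..., d. *)
definition coord_index :: "'n::{finite,linorder} \<Rightarrow> nat" where
  "coord_index i = card {j. j \<le> i}"

definition moment_curve :: "real \<Rightarrow> real ^ ('n::{finite,linorder})" where
  "moment_curve t = (\<chi> i. t ^ coord_index i / fact (coord_index i))"

(* Derivatives are taken within S, so they are one-sided at the end points of an interval and
   do not depend on the values of g outside S. *)
primrec iter_deriv :: "real set \<Rightarrow> nat \<Rightarrow> (real \<Rightarrow> 'a::real_normed_vector) \<Rightarrow> real \<Rightarrow> 'a" where
  "iter_deriv S 0 g = g"
| "iter_deriv S (Suc k) g = (\<lambda>t. vector_derivative (iter_deriv S k g) (at t within S))"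

definition Ck_on :: "nat \<Rightarrow> real set \<Rightarrow> (real \<Rightarrow> 'a::real_normed_vector) \<Rightarrow> bool" where
  "Ck_on k S g \<longleftrightarrow>
     (\<forall>j<k. \<forall>t\<in>S. iter_deriv S j g differentiable (at t within S)) \<and>
     (\<forall>j\<le>k. continuous_on S (iter_deriv S j g))"

(* Meaningful for functions that are C^k on a nonempty compact S, where the suprema are finite. *)
definition Ck_norm :: "nat \<Rightarrow> real set \<Rightarrow> (real \<Rightarrow> 'a::real_normed_vector) \<Rightarrow> real" where
  "Ck_norm k S g = (MAX j\<in>{..k}. SUP t\<in>S. norm (iter_deriv S j g t))"

definition curves_near_moment :: "real \<Rightarrow> (real \<Rightarrow> real ^ ('n::{finite,linorder})) set" where
  "curves_near_moment \<epsilon> =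
     {\<gamma>. Ck_on (CARD('n) + 1) {0..1} \<gamma> \<and>
          Ck_norm (CARD('n) + 1) {0..1} (\<lambda>t. \<gamma> t - moment_curve t) \<le> \<epsilon>}"

definition frostman_measures :: "real \<Rightarrow> real \<Rightarrow> (real ^ 'n) measure set" where
  "frostman_measures \<alpha> M =
     {\<mu>. sets \<mu> = sets borel \<and>
          (\<forall>x \<rho>. 0 < \<rho> \<longrightarrow> emeasure \<mu> (ball x \<rho>) \<le> ennreal (M * \<rho> powr \<alpha>))}"

definition beta_exponent :: "nat \<Rightarrow> real \<Rightarrow> real" where
  "beta_exponent d \<alpha> =
     (let j = real (THE j. j < d \<and> real d - real j - 1 < \<alpha> \<and> \<alpha> \<le> real d - real j)
      in (j + 1) * \<alpha> + (real d - j - 1) * (real d - j) / 2)"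

definition osc_op ::
    "real \<Rightarrow> (real \<Rightarrow> real ^ 'n) \<Rightarrow> (real \<Rightarrow> complex) \<Rightarrow> real ^ 'n \<Rightarrow> complex" where
  "osc_op lam \<gamma> f x =
     (LINT t|lebesgue_on {0..1}. exp (\<i> * complex_of_real (lam * (x \<bullet> \<gamma> t))) * f t)"

definition Lp_norm :: "ennreal \<Rightarrow> 'a measure \<Rightarrow> ('a \<Rightarrow> 'b::real_normed_vector) \<Rightarrow> ennreal" where
  "Lp_norm p M f =
     (if p = \<infinity> then esssup M (\<lambda>x. ennreal (norm (f x)))
      else let J = (\<integral>\<^sup>+x. ennreal (norm (f x) powr enn2real p) \<partial>M)
           in if J = \<infinity> then \<infinity> else ennreal (enn2real J powr (1 / enn2real p)))"

definition Lp_space :: "ennreal \<Rightarrow> 'a measure \<Rightarrow> ('a \<Rightarrow> 'b::real_normed_vector) set" where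
  "Lp_space p M = {f \<in> borel_measurable M. Lp_norm p M f < \<infinity>}"

end

theory Submission
  imports Defs "HOL-Probability.Probability"
begin

text \<open>Rescaling the measure reduces to frequency 1. Split the unit interval into N pieces of length 1/N.
  At each point either one piece carries a fixed fraction of the integral, or d pairwise separated
  pieces do, up to a factor depending on N.

  A short piece of the curve is affinely equivalent to another curve of the class, and the affine map
  turns the measure into a multiple, of order N to the power \<beta>(\<alpha>), of a measure of the same class.
  For N large the conditions on the exponents therefore make the short pieces contribute at most half
  of any bound already known. A bound depending on the total mass is trivial; iterating removes this dependence.

  For separated pieces the product of the d integrals is an oscillatory integral over a
  d-dimensional box with phase \<gamma>(t_1) + ... + \<gamma>(t_d), an expanding map. Its L2 bound follows by
  duality from a Gaussian weight and the Schur test, its L-infinity bound is trivial, and real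
  interpolation, which here gives strong type, yields the exponent q/d. Since the closeness of \<gamma> to
  the moment curve may depend on N, transversality follows from compactness.\<close>


section \<open>Product integrals and the Gaussian\<close>

text \<open>Put \<open>s = q / d\<close>. The condition \<open>q \<ge> 2 d\<close> says
  \<open>s \<ge> 2\<close>, so that L2 is an endpoint of the interpolation, and
  \<open>d / q \<le> 1 - 1 / p\<close> says that \<open>p\<close> is at least the conjugate exponent
  of \<open>s\<close>, which is what the interpolated multilinear bound asks of each factor.
  Rescaling a piece of length 1/N multiplies the q-th power of the bound by a constant times N to
  the power \<open>\<beta> + q / p - q\<close>, and \<open>\<beta> / q + 1 / p < 1\<close> makes
  that power negative. Adding the pieces up needs \<open>p \<le> q\<close>; for larger
  \<open>p\<close> the estimate is proved with \<open>q\<close> in place of \<open>p\<close>, where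
  the same gain is the condition \<open>q > \<beta> + 1\<close>. Two circularities shape the
  statements. Halving a bound is useful only if some finite bound is known, so the total mass is
  capped by a number \<open>V\<close> that rescaling does not increase and on which the final
  constant does not depend. And \<open>\<epsilon>\<close> is chosen after N, so the rescaled curve
  must be as close to the moment curve as the original one, with no loss at all.\<close>

lemma ennreal_leI_add: "a \<le> b + c \<Longrightarrow> 0 \<le> b \<Longrightarrow> 0 \<le> c \<Longrightarrow> ennreal a \<le> ennreal b + ennreal c"
  by (metis ennreal_leI ennreal_plus)

lemma ennreal_leD_add: "ennreal a \<le> ennreal b + ennreal c \<Longrightarrow> 0 \<le> b \<Longrightarrow> 0 \<le> c \<Longrightarrow> a \<le> b + c"
  by (metis ennreal_le_iff ennreal_plus add_nonneg_nonneg)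

lemma ennreal_mult_assoc: "0 \<le> a \<Longrightarrow> ennreal a * (ennreal b * X) = ennreal (a * b) * X"
  by (simp add: ennreal_mult' mult.assoc)

lemma borel_measurable_cis [measurable]: "cis \<in> borel_measurable borel"
  by (intro borel_measurable_continuous_onI continuous_intros)

lemma borel_measurable_cnj [measurable]: "cnj \<in> borel_measurable borel"
  by (intro borel_measurable_continuous_onI continuous_intros)

lemma sum_Basis_nth:
  "(\<Sum>b\<in>Basis. y b *\<^sub>R b :: real^'n::finite) $ i = y (axis i 1)"
proof -
  have "(\<Sum>b\<in>Basis. y b *\<^sub>R b :: real^'n) $ i = (\<Sum>b\<in>Basis. y b *\<^sub>R b) \<bullet> axis i 1"
    by (simp add: inner_axis)
  also have "\<dots> = y (axis i 1)"
    by (subst inner_sum_left_Basis) auto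
  finally show ?thesis .
qed

lemma bij_betw_axis_Basis: "bij_betw (\<lambda>i. axis i 1 :: real^'n::finite) UNIV Basis"
  by (auto simp: bij_betw_def inj_on_def axis_eq_axis Basis_vec_def)

text \<open>\<open>lborel_eq\<close> presents Lebesgue measure as the image of a product indexed by
  \<open>Basis\<close>, while the integrands are indexed by the coordinate type; inverting the axis
  map carries one index set to the other.\<close>

lemma prod_axis_eq_prod_Basis:
  fixes f :: "'n::finite \<Rightarrow> real \<Rightarrow> 'b::comm_monoid_mult"
  shows "(\<Prod>i\<in>UNIV. f i (y (axis i 1 :: real^'n)))
           = (\<Prod>b\<in>Basis. f (inv_into UNIV (\<lambda>i. axis i 1 :: real^'n) b) (y b))"
proof -
  have inj: "inj (\<lambda>i. axis i 1 :: real^'n)"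
    using bij_betw_axis_Basis by (auto simp: bij_betw_def)
  show ?thesis
    by (subst prod.reindex_bij_betw[OF bij_betw_axis_Basis, symmetric])
      (simp add: inv_into_f_f[OF inj])
qed

lemma lborel_vec_prod:
  fixes f :: "'n::finite \<Rightarrow> real \<Rightarrow> complex"
  assumes int: "\<And>i. integrable lborel (f i)"
  shows "integrable lborel (\<lambda>x::real^'n. \<Prod>i\<in>UNIV. f i (x $ i))" (is ?A)
    and "(\<integral>x. (\<Prod>i\<in>UNIV. f i (x $ i)) \<partial>(lborel :: (real^'n) measure)) = (\<Prod>i\<in>UNIV. \<integral>t. f i t \<partial>lborel)" (is ?B)
proof -
  interpret product_sigma_finite "\<lambda>b::real^'n. lborel :: real measure" by standard
  let ?ix = "inv_into UNIV (\<lambda>i. axis i 1 :: real^'n)"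
  have [measurable]: "f i \<in> borel_measurable borel" for i
    using borel_measurable_integrable[OF int[of i]] by simp
  have m: "(\<lambda>x::real^'n. \<Prod>i\<in>UNIV. f i (x $ i)) \<in> borel_measurable borel"
    by measurable
  have s: "(\<lambda>y. \<Sum>b\<in>Basis. y b *\<^sub>R b :: real^'n) \<in> (\<Pi>\<^sub>M b\<in>Basis. lborel) \<rightarrow>\<^sub>M borel"
    by measurable
  show ?A
    by (subst lborel_eq, subst integrable_distr_eq[OF s m])
      (simp del: sum_component add: sum_Basis_nth prod_axis_eq_prod_Basis
        product_integrable_prod[where f="\<lambda>b. f (?ix b)"] int)
  \<comment> \<open>The last instance, with factors that ignore their argument, brings the product
    of the one-dimensional integrals to the index set \<open>Basis\<close> as well.\<close>
  show ?B
    by (subst lborel_eq, subst integral_distr[OF s m])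
      (simp del: sum_component add: sum_Basis_nth prod_axis_eq_prod_Basis product_integral_prod[where f="\<lambda>b. f (?ix b)"] int
        
        prod_axis_eq_prod_Basis[where f="\<lambda>i _. integral\<^sup>L lborel (f i)" and y="\<lambda>_. 0"])
qed

lemma nn_integral_lborel_vec_prod:
  fixes f :: "'n::finite \<Rightarrow> real \<Rightarrow> ennreal"
  assumes [measurable]: "\<And>i. f i \<in> borel_measurable borel"
  shows "(\<integral>\<^sup>+x. (\<Prod>i\<in>UNIV. f i (x $ i)) \<partial>(lborel :: (real^'n) measure)) = (\<Prod>i\<in>UNIV. \<integral>\<^sup>+t. f i t \<partial>lborel)"
proof -
  interpret product_sigma_finite "\<lambda>b::real^'n. lborel :: real measure" by standard
  have s: "(\<lambda>y. \<Sum>b\<in>Basis. y b *\<^sub>R b :: real^'n) \<in> (\<Pi>\<^sub>M b\<in>Basis. lborel) \<rightarrow>\<^sub>M borel"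
    by measurable
  show ?thesis
    by (subst lborel_eq, subst nn_integral_distr[OF s])
      (simp_all del: sum_component add: sum_Basis_nth prod_axis_eq_prod_Basis
        product_nn_integral_prod[where f="\<lambda>b. f (inv_into UNIV (\<lambda>i. axis i 1 :: real^'n) b)"]
        
        prod_axis_eq_prod_Basis[where f="\<lambda>i _. integral\<^sup>N lborel (f i)" and y="\<lambda>_. 0"])
qed

section \<open>The Fourier transform of the Gaussian in several variables\<close>

lemma cis_sum: "finite S \<Longrightarrow> cis (sum g S) = (\<Prod>i\<in>S. cis (g i))"
  by (induction S rule: finite_induct) (auto simp: cis_mult[symmetric])

text \<open>Each factor is the characteristic function of the standard normal distribution. With
  \<open>v = x - y\<close> the right-hand side becomes the kernel to which the Schur test is
  applied.\<close>

lemma gaussian_fourier: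
  fixes v :: "real^'n::finite"
  shows "integrable lborel (\<lambda>y::real^'n. (\<Prod>i\<in>UNIV. std_normal_density (y $ i)))"
    and "(\<integral>y. of_real (\<Prod>i\<in>UNIV. std_normal_density (y $ i)) * cis (v \<bullet> y) \<partial>(lborel :: (real^'n) measure))
           = of_real (exp (- (norm v)\<^sup>2 / 2))"
proof -
  have i1: "integrable lborel (\<lambda>y. complex_of_real (std_normal_density y) * cis (a * y))" for a
    by (rule Bochner_Integration.integrable_bound[where f=std_normal_density])
      (auto simp: norm_mult)
  have I1: "(\<integral>y. complex_of_real (std_normal_density y) * cis (a * y) \<partial>lborel) = of_real (exp (- a\<^sup>2 / 2))" for a
  proof -
    have "of_real (exp (- a\<^sup>2 / 2)) = char std_normal_distribution a"
      by (simp add: char_std_normal_distribution)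
    also have "\<dots> = (\<integral>y. std_normal_density y *\<^sub>R iexp (a * y) \<partial>lborel)"
      unfolding char_def by (subst integral_density) auto
    finally show ?thesis by (simp add: scaleR_conv_of_real cis_conv_exp)
  qed
  have i0: "integrable lborel (\<lambda>y. complex_of_real (std_normal_density y))"
    using i1[of 0] by simp
  have "integrable lborel (\<lambda>y::real^'n. \<Prod>i\<in>UNIV. complex_of_real (std_normal_density (y $ i)))"
    by (rule lborel_vec_prod) (rule i0)
  then have "integrable lborel (\<lambda>y::real^'n. Re (\<Prod>i\<in>UNIV. complex_of_real (std_normal_density (y $ i))))"
    by (rule integrable_Re)
  moreover have "Re (\<Prod>i\<in>UNIV. complex_of_real (std_normal_density (y $ i))) = (\<Prod>i\<in>UNIV. std_normal_density (y $ i))" for y :: "real^'n"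
    by (metis Re_complex_of_real of_real_prod)
  ultimately show "integrable lborel (\<lambda>y::real^'n. (\<Prod>i\<in>UNIV. std_normal_density (y $ i)))"
    by simp
  have "(\<integral>y. of_real (\<Prod>i\<in>UNIV. std_normal_density (y $ i)) * cis (v \<bullet> y) \<partial>(lborel :: (real^'n) measure))
      = (\<integral>y. (\<Prod>i\<in>UNIV. complex_of_real (std_normal_density (y $ i)) * cis (v $ i * y $ i)) \<partial>(lborel :: (real^'n) measure))"
    by (simp add: inner_vec_def cis_sum prod.distrib)
  also have "\<dots> = (\<Prod>i\<in>UNIV. of_real (exp (- (v $ i)\<^sup>2 / 2)))"
    by (subst lborel_vec_prod(2)[OF i1]) (simp add: I1)
  also have "\<dots> = of_real (exp (\<Sum>i\<in>UNIV. - (v $ i)\<^sup>2 / 2))"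
    by (simp add: exp_sum)
  also have "(\<Sum>i\<in>UNIV. - (v $ i)\<^sup>2 / 2) = - (norm v)\<^sup>2 / 2"
    by (simp add: norm_vec_def L2_set_def sum_negf sum_divide_distrib sum_nonneg)
  finally show "(\<integral>y. of_real (\<Prod>i\<in>UNIV. std_normal_density (y $ i)) * cis (v \<bullet> y) \<partial>(lborel :: (real^'n) measure))
           = of_real (exp (- (norm v)\<^sup>2 / 2))" .
qed

section \<open>Interpolation between L2 and L-infinity\<close>

lemma nn_integral_powr_Icc:
  fixes k z :: real
  assumes "-1 < k" "0 \<le> z"
  shows "(\<integral>\<^sup>+\<tau>. ennreal (\<tau> powr k) * indicator {0<..z} \<tau> \<partial>lborel) = ennreal (z powr (k + 1) / (k + 1))"
proof -
  \<comment> \<open>Including the end point 0 changes nothing, since \<open>0 powr k = 0\<close>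
    even for negative \<open>k\<close>.\<close>
  have "(\<integral>\<^sup>+\<tau>. ennreal (\<tau> powr k) * indicator {0<..z} \<tau> \<partial>lborel)
      = (\<integral>\<^sup>+\<tau>. ennreal ((\<lambda>t. t powr k) \<tau>) * indicator {0..z} \<tau> \<partial>lborel)"
    by (intro nn_integral_cong) (auto simp: indicator_def)
  also have "\<dots> = ennreal (z powr (k + 1) / (k + 1))"
    using has_integral_powr_from_0[OF assms]
    by (intro nn_integral_has_integral_lebesgue') (auto simp: set_borel_measurable_def)
  finally show ?thesis .
qed

text \<open>The 4 comes from Chebyshev's inequality at half the level, \<open>s\<close> from the
  layer-cake formula, and the remaining quotient from integrating \<open>\<tau> powr (s - 3)\<close>
  up to the cut-off. That integral diverges for \<open>s = 2\<close>, where the L2 hypothesis is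
  already the claim.\<close>

definition interpolation_const :: "real \<Rightarrow> real" where
  "interpolation_const s = (if s = 2 then 1 else 4 * s * 2 powr (s - 2) / (s - 2))"

text \<open>Marcinkiewicz's argument with a cut-off tied to the level: at level
  \<open>\<tau>\<close> the values of \<open>G\<close> above the height \<open>u \<tau>\<close>
  contribute at most \<open>\<tau> / 2\<close>, because \<open>K\<close> is bounded by 1, so the
  level set is controlled by the L2 bound for the rest of \<open>G\<close> alone. Integrating over
  all levels then costs only a constant. The exponent on \<open>G\<close> is conjugate to
  \<open>s\<close>, and \<open>a\<close> bounds the corresponding power of its norm.\<close>

lemma interpolation_L2_Linf:
  fixes K :: "'x \<Rightarrow> 't \<Rightarrow> complex"
  assumes "sigma_finite_measure \<mu>" "sigma_finite_measure M"
    and K[measurable]: "(\<lambda>(x, t). K x t) \<in> borel_measurable (\<mu> \<Otimes>\<^sub>M M)"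
    and K1: "\<And>x t. norm (K x t) \<le> 1"
    and C: "0 \<le> C"
    and L2: "\<And>G. G \<in> borel_measurable M \<Longrightarrow> integrable M G \<Longrightarrow>
      (\<integral>\<^sup>+x. ennreal ((norm (\<integral>t. K x t * G t \<partial>M))\<^sup>2) \<partial>\<mu>) \<le> ennreal C * (\<integral>\<^sup>+t. ennreal ((norm (G t))\<^sup>2) \<partial>M)"
    and s: "2 \<le> s"
    and G[measurable]: "G \<in> borel_measurable M" and intG: "integrable M G"
    and a: "0 < a" and Ga: "(\<integral>\<^sup>+t. ennreal (norm (G t) powr (s / (s - 1))) \<partial>M) \<le> ennreal a"
  shows "(\<integral>\<^sup>+x. ennreal (norm (\<integral>t. K x t * G t \<partial>M) powr s) \<partial>\<mu>)
           \<le> ennreal (C * interpolation_const s * a powr (s - 1))"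
proof (cases "s = 2")
  case True
  have "(\<integral>\<^sup>+x. ennreal (norm (\<integral>t. K x t * G t \<partial>M) powr s) \<partial>\<mu>)
      = (\<integral>\<^sup>+x. ennreal ((norm (\<integral>t. K x t * G t \<partial>M))\<^sup>2) \<partial>\<mu>)"
    using True by (simp add: powr_numeral)
  also have "\<dots> \<le> ennreal C * (\<integral>\<^sup>+t. ennreal ((norm (G t))\<^sup>2) \<partial>M)"
    by (rule L2[OF G intG])
  also have "(\<integral>\<^sup>+t. ennreal ((norm (G t))\<^sup>2) \<partial>M) \<le> ennreal a"
    using Ga True by (simp add: powr_numeral)
  finally show ?thesis
    using True C a by (simp add: interpolation_const_def ennreal_mult'[symmetric] mult_left_mono)
next
  case False
  with s have s: "2 < s" by simp
  interpret sfm: sigma_finite_measure "\<mu>" by fact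
  interpret M: sigma_finite_measure M by fact
  interpret P: pair_sigma_finite "\<mu>" M ..
  interpret PL: pair_sigma_finite "\<mu>" "lborel :: real measure" ..
  interpret TL: pair_sigma_finite M "lborel :: real measure" ..
  define r where "r = s / (s - 1)"
  have r1: "1 - r = - 1 / (s - 1)" "1 < r" using s by (auto simp: r_def field_simps)
  have e1: "- (s - 1) * (- 1 / (s - 1)) = 1" using s by (simp add: field_simps)
  \<comment> \<open>Where \<open>norm (G t)\<close> exceeds \<open>u \<tau>\<close>, it is at most
    \<open>u \<tau> powr (1 - r) * norm (G t) powr r\<close>. This height makes the first factor
    equal to \<open>\<tau> / (2 * a)\<close>, and \<open>Ga\<close> then leaves
    \<open>\<tau> / 2\<close>.\<close>
  define u where "u \<tau> = (\<tau> / (2 * a)) powr (- (s - 1))" for \<tau>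
  have [measurable]: "u \<in> borel_measurable borel" unfolding u_def by measurable
  define Glo where "Glo \<tau> t = (if norm (G t) \<le> u \<tau> then G t else 0)" for \<tau> t
  define Ghi where "Ghi \<tau> t = (if norm (G t) \<le> u \<tau> then 0 else G t)" for \<tau> t
  have [measurable]: "Glo \<tau> \<in> borel_measurable M" "Ghi \<tau> \<in> borel_measurable M" for \<tau>
    unfolding Glo_def Ghi_def by measurable
  have int_lo: "integrable M (Glo \<tau>)" and int_hi: "integrable M (Ghi \<tau>)" for \<tau>
    by (rule Bochner_Integration.integrable_bound[OF intG]; simp add: Glo_def Ghi_def)+
  have Glo_Ghi: "k * G t = k * Glo \<tau> t + k * Ghi \<tau> t" for k \<tau> t
    by (simp add: Glo_def Ghi_def)
  have int_K: "integrable M (\<lambda>t. K x t * F t)" if "x \<in> space \<mu>" "integrable M F" for x and F :: "'t \<Rightarrow> complex"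
  proof (rule Bochner_Integration.integrable_bound[OF that(2)])
    have [measurable]: "(\<lambda>t. K x t) \<in> borel_measurable M"
      using measurable_compose[OF measurable_Pair1'[OF that(1)] K] by simp
    note borel_measurable_integrable[OF that(2), measurable]
    show "(\<lambda>t. K x t * F t) \<in> borel_measurable M" by measurable
  qed (auto simp: norm_mult intro!: mult_left_le_one_le K1)
  define S where "S F x = (\<integral>t. K x t * F t \<partial>M)" for F :: "'t \<Rightarrow> complex" and x
  have S_meas[measurable]: "S F \<in> borel_measurable \<mu>" if [measurable]: "F \<in> borel_measurable M" for F
    unfolding S_def by (intro M.borel_measurable_lebesgue_integral) measurable
  have hi: "norm (S (Ghi \<tau>) x) \<le> \<tau> / 2" if "0 < \<tau>" "x \<in> space \<mu>" for \<tau> x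
  proof -
    have u0: "0 < u \<tau>" using that a by (simp add: u_def)
    have upow: "u \<tau> powr (1 - r) = \<tau> / (2 * a)"
      unfolding u_def r1 powr_powr e1 using that a by simp
    have "ennreal (norm (S (Ghi \<tau>) x)) \<le> (\<integral>\<^sup>+t. ennreal (norm (K x t * Ghi \<tau> t)) \<partial>M)"
      unfolding S_def by (rule integral_norm_bound_ennreal[OF int_K[OF that(2) int_hi]])
    also have "\<dots> \<le> (\<integral>\<^sup>+t. ennreal (\<tau> / (2 * a)) * ennreal (norm (G t) powr r) \<partial>M)"
    proof (rule nn_integral_mono)
      fix t
      have "norm (K x t * Ghi \<tau> t) \<le> norm (Ghi \<tau> t)"
        by (auto simp: norm_mult intro!: mult_left_le_one_le K1)
      also have "\<dots> \<le> \<tau> / (2 * a) * norm (G t) powr r"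
      proof (cases "norm (G t) \<le> u \<tau>")
        case True then show ?thesis using that a by (simp add: Ghi_def)
      next
        case False
        then have g: "u \<tau> < norm (G t)" by simp
        have "norm (G t) = norm (G t) powr (1 - r) * norm (G t) powr r"
          using g u0 by (simp add: powr_add[symmetric])
        also have "\<dots> \<le> u \<tau> powr (1 - r) * norm (G t) powr r"
          using g u0 r1(2) by (intro mult_right_mono powr_mono2') auto
        finally show ?thesis using False by (simp add: Ghi_def upow)
      qed
      finally show "ennreal (norm (K x t * Ghi \<tau> t)) \<le> ennreal (\<tau> / (2 * a)) * ennreal (norm (G t) powr r)"
        using that a by (simp add: ennreal_mult'[symmetric] ennreal_leI)
    qed
    also have "\<dots> = ennreal (\<tau> / (2 * a)) * (\<integral>\<^sup>+t. ennreal (norm (G t) powr r) \<partial>M)"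
      by (rule nn_integral_cmult) measurable
    also have "\<dots> \<le> ennreal (\<tau> / (2 * a)) * ennreal a"
      using Ga by (intro mult_left_mono) (auto simp: r_def)
    also have "\<dots> = ennreal (\<tau> / 2)"
      using that a by (simp add: ennreal_mult'[symmetric])
    finally show ?thesis using that by (simp add: ennreal_le_iff)
  qed
  \<comment> \<open>Chebyshev's inequality: where the whole is at least \<open>\<tau>\<close>, the
    low part is at least \<open>\<tau> / 2\<close>, whence the 4.\<close>
  have dist: "(\<integral>\<^sup>+x. indicator {0<..norm (S G x)} \<tau> \<partial>\<mu>)
      \<le> ennreal (4 * C * \<tau> powr -2) * (\<integral>\<^sup>+t. ennreal ((norm (Glo \<tau> t))\<^sup>2) \<partial>M)" if "0 < \<tau>" for \<tau>
  proof -
    have "(\<integral>\<^sup>+x. indicator {0<..norm (S G x)} \<tau> \<partial>\<mu>)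
      \<le> (\<integral>\<^sup>+x. ennreal (4 * \<tau> powr -2) * ennreal ((norm (S (Glo \<tau>) x))\<^sup>2) \<partial>\<mu>)"
    proof (rule nn_integral_mono)
      fix x assume x: "x \<in> space \<mu>"
      have "S G x = S (Glo \<tau>) x + S (Ghi \<tau>) x"
        unfolding S_def Glo_Ghi[where \<tau>=\<tau>]
        by (rule Bochner_Integration.integral_add[OF int_K[OF x int_lo] int_K[OF x int_hi]])
      then have "norm (S G x) \<le> norm (S (Glo \<tau>) x) + \<tau> / 2"
        using norm_triangle_ineq[of "S (Glo \<tau>) x" "S (Ghi \<tau>) x"] hi[OF that x] by simp
      then have "1 \<le> 4 * \<tau> powr -2 * (norm (S (Glo \<tau>) x))\<^sup>2" if "\<tau> \<le> norm (S G x)"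
      proof -
        have "\<tau> / 2 \<le> norm (S (Glo \<tau>) x)" using that \<open>norm (S G x) \<le> _\<close> by simp
        then have "(\<tau> / 2)\<^sup>2 \<le> (norm (S (Glo \<tau>) x))\<^sup>2"
          using \<open>0 < \<tau>\<close> by (intro power_mono) auto
        then show ?thesis
          using \<open>0 < \<tau>\<close> by (simp add: powr_minus powr_numeral field_simps power2_eq_square)
      qed
      then show "indicator {0<..norm (S G x)} \<tau> \<le> ennreal (4 * \<tau> powr -2) * ennreal ((norm (S (Glo \<tau>) x))\<^sup>2)"
        by (auto simp: indicator_def ennreal_mult'[symmetric] ennreal_1[symmetric] simp del: ennreal_1 intro!: ennreal_leI)
    qed
    also have "\<dots> = ennreal (4 * \<tau> powr -2) * (\<integral>\<^sup>+x. ennreal ((norm (S (Glo \<tau>) x))\<^sup>2) \<partial>\<mu>)"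
      by (rule nn_integral_cmult) measurable
    also have "\<dots> \<le> ennreal (4 * \<tau> powr -2) * (ennreal C * (\<integral>\<^sup>+t. ennreal ((norm (Glo \<tau> t))\<^sup>2) \<partial>M))"
      unfolding S_def by (intro mult_left_mono L2 int_lo) auto
    also have "\<dots> = ennreal (4 * C * \<tau> powr -2) * (\<integral>\<^sup>+t. ennreal ((norm (Glo \<tau> t))\<^sup>2) \<partial>M)"
      using C by (simp add: ennreal_mult mult_ac)
    finally show ?thesis .
  qed
  have pow_s: "ennreal (z powr s) = (\<integral>\<^sup>+\<tau>. ennreal (s * \<tau> powr (s - 1)) * indicator {0<..z} \<tau> \<partial>lborel)"
    if "0 \<le> z" for z
  proof -
    have "(\<integral>\<^sup>+\<tau>. ennreal (s * \<tau> powr (s - 1)) * indicator {0<..z} \<tau> \<partial>lborel)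
      = (\<integral>\<^sup>+\<tau>. ennreal s * (ennreal (\<tau> powr (s - 1)) * indicator {0<..z} \<tau>) \<partial>lborel)"
      using s by (simp add: ennreal_mult' mult.assoc)
    also have "\<dots> = ennreal s * (\<integral>\<^sup>+\<tau>. ennreal (\<tau> powr (s - 1)) * indicator {0<..z} \<tau> \<partial>lborel)"
      by (rule nn_integral_cmult) measurable
    also have "\<dots> = ennreal s * ennreal (z powr s / s)"
      using that s by (subst nn_integral_powr_Icc) auto
    also have "\<dots> = ennreal (z powr s)"
      using that s by (simp add: ennreal_mult'[symmetric])
    finally show ?thesis ..
  qed
  define c where "c = 4 * s * C"
  have c0: "0 \<le> c" using C s by (simp add: c_def)
  have inner: "(\<integral>\<^sup>+\<tau>. ennreal (c * \<tau> powr (s - 3)) * indicator {0<..} \<tau> * ennreal ((norm (Glo \<tau> t))\<^sup>2) \<partial>lborel)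
      \<le> ennreal (c * (2 * a) powr (s - 2) / (s - 2)) * ennreal (norm (G t) powr r)" for t
  proof (cases "G t = 0")
    case True
    then have "Glo \<tau> t = 0" for \<tau> by (simp add: Glo_def)
    then show ?thesis by simp
  next
    case False
    define g where "g = norm (G t)"
    have g: "0 < g" using False by (simp add: g_def)
    \<comment> \<open>The solution of \<open>u b = g\<close>. As \<open>u\<close> decreases, the low
      part at \<open>t\<close> survives only for \<open>\<tau> \<le> b\<close>, and
      \<open>s > 2\<close> makes \<open>\<tau> powr (s - 3)\<close> integrable near 0.\<close>
    define b where "b = 2 * a * g powr (- 1 / (s - 1))"
    have b: "0 < b" using g a by (simp add: b_def)
    have imp: "\<tau> \<le> b" if "0 < \<tau>" "g \<le> u \<tau>" for \<tau>
    proof -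
      have "u \<tau> powr (- 1 / (s - 1)) \<le> g powr (- 1 / (s - 1))"
        using that g s by (intro powr_mono2') auto
      moreover have "u \<tau> powr (- 1 / (s - 1)) = \<tau> / (2 * a)"
        unfolding u_def powr_powr e1 using that a by simp
      ultimately have "\<tau> / (2 * a) \<le> g powr (- 1 / (s - 1))" by simp
      then show ?thesis using a by (simp add: b_def pos_divide_le_eq mult.commute)
    qed
    have "(\<integral>\<^sup>+\<tau>. ennreal (c * \<tau> powr (s - 3)) * indicator {0<..} \<tau> * ennreal ((norm (Glo \<tau> t))\<^sup>2) \<partial>lborel)
      \<le> (\<integral>\<^sup>+\<tau>. ennreal (c * g\<^sup>2) * (ennreal (\<tau> powr (s - 3)) * indicator {0<..b} \<tau>) \<partial>lborel)"
      using c0 imp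
      by (intro nn_integral_mono) (auto simp: indicator_def Glo_def g_def[symmetric] ennreal_mult'[symmetric] mult_ac)
    also have "\<dots> = ennreal (c * g\<^sup>2) * (\<integral>\<^sup>+\<tau>. ennreal (\<tau> powr (s - 3)) * indicator {0<..b} \<tau> \<partial>lborel)"
      by (rule nn_integral_cmult) measurable
    also have "\<dots> = ennreal (c * g\<^sup>2) * ennreal (b powr (s - 2) / (s - 2))"
      using s b by (subst nn_integral_powr_Icc) (auto simp: algebra_simps)
    also have "\<dots> = ennreal (c * g\<^sup>2 * (b powr (s - 2) / (s - 2)))"
      using c0 by (simp add: ennreal_mult'[symmetric])
    also have "c * g\<^sup>2 * (b powr (s - 2) / (s - 2)) = c * (2 * a) powr (s - 2) / (s - 2) * g powr r"
    proof -
      have "b powr (s - 2) = (2 * a) powr (s - 2) * g powr (- 1 / (s - 1) * (s - 2))"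
        unfolding b_def using a g by (simp add: powr_mult powr_powr)
      moreover have "g\<^sup>2 * g powr (- 1 / (s - 1) * (s - 2)) = g powr r"
      proof -
        have "g\<^sup>2 = g powr 2" using g by (simp add: powr_numeral)
        moreover have "2 + (- 1 / (s - 1) * (s - 2)) = r" using s by (simp add: r_def field_simps)
        ultimately show ?thesis by (metis powr_add)
      qed
      ultimately show ?thesis by (simp add: field_simps)
    qed
    finally show ?thesis using c0 s a by (simp add: g_def ennreal_mult'[symmetric])
  qed
  have "(\<integral>\<^sup>+x. ennreal (norm (S G x) powr s) \<partial>\<mu>)
      = (\<integral>\<^sup>+x. (\<integral>\<^sup>+\<tau>. ennreal (s * \<tau> powr (s - 1)) * indicator {0<..norm (S G x)} \<tau> \<partial>lborel) \<partial>\<mu>)"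
    by (simp add: pow_s)
  also have "\<dots> = (\<integral>\<^sup>+\<tau>. (\<integral>\<^sup>+x. ennreal (s * \<tau> powr (s - 1)) * indicator {0<..norm (S G x)} \<tau> \<partial>\<mu>) \<partial>lborel)"
    unfolding greaterThanAtMost_iff indicator_def[abs_def] by (intro PL.Fubini'[symmetric]) measurable
  also have "\<dots> \<le> (\<integral>\<^sup>+\<tau>. (\<integral>\<^sup>+t. ennreal (c * \<tau> powr (s - 3)) * indicator {0<..} \<tau> * ennreal ((norm (Glo \<tau> t))\<^sup>2) \<partial>M) \<partial>lborel)"
  proof (rule nn_integral_mono)
    fix \<tau> :: real
    show "(\<integral>\<^sup>+x. ennreal (s * \<tau> powr (s - 1)) * indicator {0<..norm (S G x)} \<tau> \<partial>\<mu>)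
      \<le> (\<integral>\<^sup>+t. ennreal (c * \<tau> powr (s - 3)) * indicator {0<..} \<tau> * ennreal ((norm (Glo \<tau> t))\<^sup>2) \<partial>M)"
    proof (cases "0 < \<tau>")
      case False then show ?thesis by simp
    next
      case True
      have "(\<integral>\<^sup>+x. ennreal (s * \<tau> powr (s - 1)) * indicator {0<..norm (S G x)} \<tau> \<partial>\<mu>)
        = ennreal (s * \<tau> powr (s - 1)) * (\<integral>\<^sup>+x. indicator {0<..norm (S G x)} \<tau> \<partial>\<mu>)"
        unfolding greaterThanAtMost_iff indicator_def[abs_def] by (intro nn_integral_cmult) measurable
      also have "\<dots> \<le> ennreal (s * \<tau> powr (s - 1)) * (ennreal (4 * C * \<tau> powr -2) * (\<integral>\<^sup>+t. ennreal ((norm (Glo \<tau> t))\<^sup>2) \<partial>M))"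
        by (intro mult_left_mono dist True) auto
      also have "\<dots> = ennreal (c * \<tau> powr (s - 3)) * (\<integral>\<^sup>+t. ennreal ((norm (Glo \<tau> t))\<^sup>2) \<partial>M)"
      proof -
        have "\<tau> powr (s - 1) * \<tau> powr -2 = \<tau> powr (s - 3)"
          by (simp add: powr_add[symmetric])
        then have "s * \<tau> powr (s - 1) * (4 * C * \<tau> powr -2) = c * \<tau> powr (s - 3)"
          by (simp add: c_def)
        then show ?thesis
          using s C by (simp add: ennreal_mult'[symmetric] mult.assoc[symmetric])
      qed
      also have "\<dots> = (\<integral>\<^sup>+t. ennreal (c * \<tau> powr (s - 3)) * indicator {0<..} \<tau> * ennreal ((norm (Glo \<tau> t))\<^sup>2) \<partial>M)"
        using True by (subst nn_integral_cmult) auto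
      finally show ?thesis .
    qed
  qed
  \<comment> \<open>With \<open>\<tau>\<close> innermost, the truncation of \<open>G\<close> at a
    fixed \<open>t\<close> becomes an upper limit for \<open>\<tau>\<close>; this is what gives a
    strong-type and not a weak-type bound.\<close>
  also have "\<dots> = (\<integral>\<^sup>+t. (\<integral>\<^sup>+\<tau>. ennreal (c * \<tau> powr (s - 3)) * indicator {0<..} \<tau> * ennreal ((norm (Glo \<tau> t))\<^sup>2) \<partial>lborel) \<partial>M)"
    unfolding Glo_def by (intro TL.Fubini') measurable
  also have "\<dots> \<le> (\<integral>\<^sup>+t. ennreal (c * (2 * a) powr (s - 2) / (s - 2)) * ennreal (norm (G t) powr r) \<partial>M)"
    by (intro nn_integral_mono inner)
  also have "\<dots> = ennreal (c * (2 * a) powr (s - 2) / (s - 2)) * (\<integral>\<^sup>+t. ennreal (norm (G t) powr r) \<partial>M)"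
    by (rule nn_integral_cmult) measurable
  also have "\<dots> \<le> ennreal (c * (2 * a) powr (s - 2) / (s - 2)) * ennreal a"
    using Ga by (intro mult_left_mono) (auto simp: r_def)
  also have "\<dots> = ennreal (c * (2 * a) powr (s - 2) / (s - 2) * a)"
    using c0 s a by (simp add: ennreal_mult'[symmetric])
  also have "c * (2 * a) powr (s - 2) / (s - 2) * a = C * interpolation_const s * a powr (s - 1)"
  proof -
    have "a powr (s - 2) * a = a powr (s - 1)"
      using a powr_add[of a "s - 2" 1] by simp
    then show ?thesis
      using False a by (simp add: interpolation_const_def c_def powr_mult field_simps)
  qed
  finally show ?thesis by (simp add: S_def)
qed

section \<open>L2 estimates for fractal measures\<close>

lemma summable_gaussian_shells:
  "summable (\<lambda>k. exp (- (real k)\<^sup>2 / 2) * (real k + 1) powr \<alpha>)"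
proof -
  obtain m :: nat where m: "\<alpha> \<le> real m" using real_arch_simple by blast
  show ?thesis
  proof (rule summable_comparison_test')
    show "summable (\<lambda>k. fact m * exp 6 * exp (- 1 :: real) ^ k)"
      by (intro summable_mult summable_geometric) auto
    fix k :: nat
    have "(real k + 1) powr \<alpha> \<le> (real k + 1) ^ m"
      using powr_mono[OF m, of "real k + 1"] by (simp add: powr_realpow)
    also have "\<dots> \<le> fact m * exp (real k + 1)"
    proof -
      have "(real k + 1) ^ m /\<^sub>R fact m \<le> (\<Sum>n. (real k + 1) ^ n /\<^sub>R fact n)"
        using sum_le_suminf[OF summable_exp_generic, of "{m}" "real k + 1"] by simp
      then show ?thesis by (simp add: exp_def field_simps)
    qed
    finally have "exp (- (real k)\<^sup>2 / 2) * (real k + 1) powr \<alpha> \<le> exp (- (real k)\<^sup>2 / 2) * (fact m * exp (real k + 1))"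
      by (intro mult_left_mono) auto
    also have "\<dots> = fact m * exp (real k + 1 - (real k)\<^sup>2 / 2)"
      by (simp add: exp_add[symmetric] exp_diff exp_minus field_simps)
    \<comment> \<open>Rearranged, this is \<open>(k - 2)^2 / 2 + 3 \<ge> 0\<close>; the 6 is the
      source of the factor \<open>exp 6\<close> in the geometric majorant.\<close>
    also have "real k + 1 - (real k)\<^sup>2 / 2 \<le> 6 - real k"
      using zero_le_power2[of "real k - 2"] zero_le_power2[of "real k - 3"] by (simp add: power2_eq_square algebra_simps)
    also have "exp (6 - real k) = exp 6 * exp (- 1) ^ k"
      by (simp add: exp_diff exp_minus exp_of_nat_mult[symmetric] field_simps)
    finally show "norm (exp (- (real k)\<^sup>2 / 2) * (real k + 1) powr \<alpha>) \<le> fact m * exp 6 * exp (- 1) ^ k"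
      by (simp add: mult.assoc)
  qed
qed

definition frostman_gaussian_const :: "real \<Rightarrow> real" where
  "frostman_gaussian_const \<alpha> = (\<Sum>k. exp (- (real k)\<^sup>2 / 2) * (real k + 1) powr \<alpha>)"

lemma frostman_gaussian_const_pos: "0 < frostman_gaussian_const \<alpha>"
  unfolding frostman_gaussian_const_def
  by (rule suminf_pos[OF summable_gaussian_shells]) (auto intro!: mult_pos_pos)

text \<open>Unit shells around \<open>x\<close>: where the distance has integer part k, the Gaussian
  is at most \<open>exp (- k^2 / 2)\<close>, and the shell lies in the ball of radius k + 1. The
  bound is uniform in \<open>x\<close> and does not involve the total mass.\<close>

lemma frostman_gaussian:
  fixes x :: "real^'n::finite"
  assumes "\<mu> \<in> frostman_measures \<alpha> 1"
  shows "(\<integral>\<^sup>+y. ennreal (exp (- (norm (x - y))\<^sup>2 / 2)) \<partial>\<mu>) \<le> ennreal (frostman_gaussian_const \<alpha>)"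
proof -
  have sets[measurable_cong]: "sets \<mu> = sets borel"
    and fr: "\<And>x \<rho>. 0 < \<rho> \<Longrightarrow> emeasure \<mu> (ball x \<rho>) \<le> ennreal (\<rho> powr \<alpha>)"
    using assms by (auto simp: frostman_measures_def)
  have [measurable]: "ball y r \<in> sets \<mu>" for y r by (simp add: sets)
  have "(\<integral>\<^sup>+y. ennreal (exp (- (norm (x - y))\<^sup>2 / 2)) \<partial>\<mu>)
      \<le> (\<integral>\<^sup>+y. (\<Sum>k. ennreal (exp (- (real k)\<^sup>2 / 2)) * indicator (ball x (real k + 1)) y) \<partial>\<mu>)"
  proof (rule nn_integral_mono)
    fix y
    define k where "k = nat \<lfloor>norm (x - y)\<rfloor>"
    have k: "real k \<le> norm (x - y)" "norm (x - y) < real k + 1"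
      unfolding k_def using norm_ge_zero[of "x - y"] by linarith+
    have "ennreal (exp (- (norm (x - y))\<^sup>2 / 2)) \<le> ennreal (exp (- (real k)\<^sup>2 / 2)) * indicator (ball x (real k + 1)) y"
      using k by (auto simp: indicator_def dist_norm intro!: ennreal_leI power_mono)
    also have "\<dots> = (\<Sum>j\<in>{k}. ennreal (exp (- (real j)\<^sup>2 / 2)) * indicator (ball x (real j + 1)) y)"
      by (simp only: sum.insert finite.emptyI empty_iff not_False_eq_True sum.empty add_0_right)
    also have "\<dots> \<le> (\<Sum>k. ennreal (exp (- (real k)\<^sup>2 / 2)) * indicator (ball x (real k + 1)) y)"
      by (rule sum_le_suminf) auto
    finally show "ennreal (exp (- (norm (x - y))\<^sup>2 / 2)) \<le> (\<Sum>k. ennreal (exp (- (real k)\<^sup>2 / 2)) * indicator (ball x (real k + 1)) y)" .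
  qed
  also have "\<dots> = (\<Sum>k. ennreal (exp (- (real k)\<^sup>2 / 2)) * emeasure \<mu> (ball x (real k + 1)))"
    by (subst nn_integral_suminf) (auto simp: nn_integral_cmult_indicator sets)
  also have "\<dots> \<le> (\<Sum>k. ennreal (exp (- (real k)\<^sup>2 / 2) * (real k + 1) powr \<alpha>))"
    by (intro suminf_le) (auto simp: ennreal_mult' intro!: mult_left_mono fr)
  also have "\<dots> = ennreal (frostman_gaussian_const \<alpha>)"
    unfolding frostman_gaussian_const_def by (rule suminf_ennreal2[OF _ summable_gaussian_shells]) auto
  finally show ?thesis .
qed

text \<open>The standard Gaussian density serves as the frequency weight because it is positive,
  hence bounded below on every ball, and because its Fourier transform is an explicit positive
  kernel whose Schur bound is \<open>frostman_gaussian\<close>.\<close>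

definition gauss_weight :: "real^'n::finite \<Rightarrow> real" where
  "gauss_weight y = (\<Prod>i\<in>UNIV. std_normal_density (y $ i))"

lemma gauss_weight_pos: "0 < gauss_weight y"
  unfolding gauss_weight_def by (intro prod_pos) (auto simp: normal_density_pos)

lemma continuous_on_gauss_weight: "continuous_on A gauss_weight"
  unfolding gauss_weight_def[abs_def] std_normal_density_def by (intro continuous_intros) auto

lemma borel_measurable_gauss_weight [measurable]: "gauss_weight \<in> borel_measurable borel"
  by (intro borel_measurable_continuous_onI continuous_on_gauss_weight)

text \<open>Expanding the square and integrating over \<open>y\<close> first replaces the
  oscillation by the positive kernel \<open>exp (- (norm (x - x'))^2 / 2)\<close>, to which
  \<open>schur\<close> applies. The finite mass and the bound \<open>B\<close> make the exchanges of
  integrals legitimate; neither enters the constant.\<close>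

lemma gaussian_weighted_L2:
  fixes \<mu> :: "(real^'n::finite) measure" and g :: "real^'n \<Rightarrow> complex"
  assumes "finite_measure \<mu>" and sets: "sets \<mu> = sets borel"
    and schur: "\<And>x. (\<integral>\<^sup>+y. ennreal (exp (- (norm (x - y))\<^sup>2 / 2)) \<partial>\<mu>) \<le> ennreal C"
    and g[measurable]: "g \<in> borel_measurable borel" and B: "\<And>x. norm (g x) \<le> B"
  shows "(\<integral>\<^sup>+y. ennreal (gauss_weight y * (norm (\<integral>x. cis (x \<bullet> y) * g x \<partial>\<mu>))\<^sup>2) \<partial>lborel)
           \<le> ennreal C * (\<integral>\<^sup>+x. ennreal ((norm (g x))\<^sup>2) \<partial>\<mu>)"
proof -
  note [measurable_cong] = sets
  interpret mu: finite_measure "\<mu>" by fact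
  define W where "W = density lborel (\<lambda>y::real^'n. ennreal (gauss_weight y))"
  have [measurable_cong]: "sets W = sets borel" by (simp add: W_def)
  interpret W: finite_measure W
  proof
    have "emeasure W (space W) = (\<integral>\<^sup>+y. ennreal (gauss_weight (y::real^'n)) \<partial>lborel)"
      unfolding W_def by (subst emeasure_density) auto
    also have "\<dots> < \<infinity>"
      using gaussian_fourier(1)[where 'n='n] unfolding gauss_weight_def[symmetric] integrable_iff_bounded
      by (simp add: gauss_weight_pos less_imp_le)
    finally show "emeasure W (space W) \<noteq> \<infinity>" by simp
  qed
  interpret MM: pair_sigma_finite "\<mu>" "\<mu>" ..
  interpret MMf: finite_measure "\<mu> \<Otimes>\<^sub>M \<mu>"
    by (rule finite_measure_pair_measure) unfold_locales
  interpret WM: pair_sigma_finite "\<mu> \<Otimes>\<^sub>M \<mu>" W ..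
  interpret WMf: finite_measure "(\<mu> \<Otimes>\<^sub>M \<mu>) \<Otimes>\<^sub>M W"
    by (rule finite_measure_pair_measure) unfold_locales
  have [measurable_cong]: "sets (\<mu> \<Otimes>\<^sub>M \<mu>) = sets (borel \<Otimes>\<^sub>M borel)"
    "sets ((\<mu> \<Otimes>\<^sub>M \<mu>) \<Otimes>\<^sub>M W) = sets ((borel \<Otimes>\<^sub>M borel) \<Otimes>\<^sub>M borel)"
    by (intro sets_pair_measure_cong sets; simp add: W_def)+
  have B0: "0 \<le> B" using B[of 0] norm_ge_zero order_trans by blast
  define H where "H y = (\<integral>x. cis (x \<bullet> y) * g x \<partial>\<mu>)" for y
  have [measurable]: "H \<in> borel_measurable borel"
    unfolding H_def by (rule mu.borel_measurable_lebesgue_integral) measurable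
  define e where "e x y = exp (- (norm (x - y))\<^sup>2 / 2)" for x y :: "real^'n"
  have [measurable]: "(\<lambda>z. e (fst z) (snd z)) \<in> borel_measurable (borel \<Otimes>\<^sub>M borel)"
    unfolding e_def by measurable
  have e_comm: "e x y = e y x" for x y by (simp add: e_def norm_minus_commute)
  have e0: "0 \<le> e x y" for x y by (simp add: e_def)
  have int_g: "integrable \<mu> (\<lambda>x. cis (x \<bullet> y) * g x)" for y
    by (rule mu.integrable_const_bound[where B=B]) (auto simp: norm_mult B)
  have H_bound: "norm (H y) \<le> B * measure \<mu> (space \<mu>)" for y
  proof -
    have "norm (H y) \<le> (\<integral>x. norm (cis (x \<bullet> y) * g x) \<partial>\<mu>)"
      unfolding H_def by (rule integral_norm_bound)
    also have "\<dots> \<le> (\<integral>x. B \<partial>\<mu>)"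
      by (intro integral_mono integrable_norm int_g) (auto simp: norm_mult B)
    finally show ?thesis by (simp add: mult.commute)
  qed
  define k where "k z y = g (fst z) * cnj (g (snd z)) * cis ((fst z - snd z) \<bullet> y)" for z y
  have [measurable]: "(\<lambda>z. k z y) \<in> borel_measurable (\<mu> \<Otimes>\<^sub>M \<mu>)" for y
    unfolding k_def by measurable
  have [measurable]: "(\<lambda>z. k (fst z) (snd z)) \<in> borel_measurable ((\<mu> \<Otimes>\<^sub>M \<mu>) \<Otimes>\<^sub>M W)"
    unfolding k_def by measurable
  have k_bound: "norm (k z y) \<le> B * B" for z y
    by (simp add: k_def norm_mult B B0 mult_mono)
  have int_k: "integrable (\<mu> \<Otimes>\<^sub>M \<mu>) (\<lambda>z. k z y)" for y
    by (rule MMf.integrable_const_bound[where B="B * B"]) (auto simp: k_bound)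
  have int_kW: "integrable ((\<mu> \<Otimes>\<^sub>M \<mu>) \<Otimes>\<^sub>M W) (case_prod k)"
    by (rule WMf.integrable_const_bound[where B="B * B"]) (auto simp: k_bound split_beta')
  have cis_diff: "cis (a - b) = cis a * cnj (cis b)" for a b
    by (simp add: cis_cnj cis_mult)
  have HH: "complex_of_real ((norm (H y))\<^sup>2) = (\<integral>z. k z y \<partial>(\<mu> \<Otimes>\<^sub>M \<mu>))" for y
  proof -
    have "(\<integral>z. k z y \<partial>(\<mu> \<Otimes>\<^sub>M \<mu>)) = (\<integral>x. (\<integral>x'. k (x, x') y \<partial>\<mu>) \<partial>\<mu>)"
      by (rule MM.integral_fst'[symmetric]) (rule int_k)
    also have "\<dots> = (\<integral>x. (\<integral>x'. (cis (x \<bullet> y) * g x) * cnj (cis (x' \<bullet> y) * g x') \<partial>\<mu>) \<partial>\<mu>)"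
      by (intro Bochner_Integration.integral_cong refl)
        (simp add: k_def inner_diff_left cis_diff mult_ac)
    also have "\<dots> = H y * cnj (H y)"
      by (simp add: H_def del: complex_cnj_mult)
    also have "\<dots> = complex_of_real ((norm (H y))\<^sup>2)"
      by (rule complex_norm_square[symmetric])
    finally show ?thesis ..
  qed
  have kW: "(\<integral>y. k z y \<partial>W) = g (fst z) * cnj (g (snd z)) * of_real (e (fst z) (snd z))" for z
  proof -
    have "(\<integral>y. k z y \<partial>W) = (\<integral>y. gauss_weight y *\<^sub>R k z y \<partial>lborel)"
      unfolding W_def by (rule integral_density) (auto simp: k_def gauss_weight_pos less_imp_le)
    also have "\<dots> = (\<integral>y. (g (fst z) * cnj (g (snd z))) * (of_real (gauss_weight y) * cis ((fst z - snd z) \<bullet> y)) \<partial>lborel)"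
      by (simp add: k_def scaleR_conv_of_real mult_ac)
    also have "\<dots> = (g (fst z) * cnj (g (snd z))) * (\<integral>y. of_real (gauss_weight y) * cis ((fst z - snd z) \<bullet> y) \<partial>lborel)"
      by (rule integral_mult_right_zero)
    finally show ?thesis
      by (simp only: gauss_weight_def gaussian_fourier(2) e_def)
  qed
  have ge_bound: "norm (g (fst z) * cnj (g (snd z)) * of_real (e (fst z) (snd z))) \<le> B * B" for z
  proof -
    have "norm (g (fst z)) * norm (g (snd z)) * e (fst z) (snd z) \<le> (B * B) * 1"
      by (intro mult_mono B) (auto simp: e_def B0)
    then show ?thesis by (simp add: norm_mult e0)
  qed
  have int_H: "integrable W (\<lambda>y. (norm (H y))\<^sup>2)"
    by (rule W.integrable_const_bound[where B="(B * measure \<mu> (space \<mu>))\<^sup>2"])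
      (auto intro!: power_mono H_bound)
  have "(\<integral>\<^sup>+y. ennreal (gauss_weight y * (norm (H y))\<^sup>2) \<partial>lborel) = (\<integral>\<^sup>+y. ennreal ((norm (H y))\<^sup>2) \<partial>W)"
    unfolding W_def by (subst nn_integral_density) (auto simp: ennreal_mult gauss_weight_pos less_imp_le)
  also have "\<dots> = ennreal (\<integral>y. (norm (H y))\<^sup>2 \<partial>W)"
    by (rule nn_integral_eq_integral[OF int_H]) auto
  also have "(\<integral>y. (norm (H y))\<^sup>2 \<partial>W) = norm (complex_of_real (\<integral>y. (norm (H y))\<^sup>2 \<partial>W))"
    by (simp add: integral_nonneg_AE)
  also have "complex_of_real (\<integral>y. (norm (H y))\<^sup>2 \<partial>W) = (\<integral>y. (\<integral>z. k z y \<partial>(\<mu> \<Otimes>\<^sub>M \<mu>)) \<partial>W)"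
    unfolding HH[symmetric] by (rule integral_complex_of_real[symmetric])
  also have "\<dots> = (\<integral>z. (\<integral>y. k z y \<partial>W) \<partial>(\<mu> \<Otimes>\<^sub>M \<mu>))"
    by (rule WM.Fubini_integral[OF int_kW])
  also have "\<dots> = (\<integral>z. g (fst z) * cnj (g (snd z)) * of_real (e (fst z) (snd z)) \<partial>(\<mu> \<Otimes>\<^sub>M \<mu>))"
    by (simp add: kW)
  also have "ennreal (norm \<dots>) \<le> (\<integral>\<^sup>+z. ennreal (norm (g (fst z) * cnj (g (snd z)) * of_real (e (fst z) (snd z)))) \<partial>(\<mu> \<Otimes>\<^sub>M \<mu>))"
    by (rule integral_norm_bound_ennreal, rule MMf.integrable_const_bound[where B="B * B"])
      (intro AE_I2 ge_bound, measurable)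
  \<comment> \<open>The Schur test in its symmetric form: a product is at most half the sum of the
    squares, and \<open>e_comm\<close> makes the two halves equal.\<close>
  also have "\<dots> \<le> (\<integral>\<^sup>+z. ennreal (1/2) * ennreal ((norm (g (fst z)))\<^sup>2 * e (fst z) (snd z))
      + ennreal (1/2) * ennreal ((norm (g (snd z)))\<^sup>2 * e (fst z) (snd z)) \<partial>(\<mu> \<Otimes>\<^sub>M \<mu>))"
  proof (rule nn_integral_mono)
    fix z
    have hm: "ennreal (1/2) * ennreal X = ennreal (1/2 * X)" for X
      by (rule ennreal_mult'[symmetric]) simp
    have "norm (g (fst z)) * norm (g (snd z)) \<le> 1/2 * (norm (g (fst z)))\<^sup>2 + 1/2 * (norm (g (snd z)))\<^sup>2"
      using zero_le_power2[of "norm (g (fst z)) - norm (g (snd z))"]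
      by (simp add: power2_eq_square algebra_simps)
    from mult_right_mono[OF this e0[of "fst z" "snd z"]]
    show "ennreal (norm (g (fst z) * cnj (g (snd z)) * of_real (e (fst z) (snd z))))
      \<le> ennreal (1/2) * ennreal ((norm (g (fst z)))\<^sup>2 * e (fst z) (snd z))
      + ennreal (1/2) * ennreal ((norm (g (snd z)))\<^sup>2 * e (fst z) (snd z))"
      unfolding hm
      by (intro ennreal_leI_add) (auto simp: norm_mult e0 algebra_simps)
  qed
  also have "\<dots> = ennreal (1/2) * (\<integral>\<^sup>+z. ennreal ((norm (g (fst z)))\<^sup>2 * e (fst z) (snd z)) \<partial>(\<mu> \<Otimes>\<^sub>M \<mu>))
      + ennreal (1/2) * (\<integral>\<^sup>+z. ennreal ((norm (g (snd z)))\<^sup>2 * e (fst z) (snd z)) \<partial>(\<mu> \<Otimes>\<^sub>M \<mu>))"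
    by (subst nn_integral_add, measurable, subst (1 2) nn_integral_cmult, auto)
  also have "(\<integral>\<^sup>+z. ennreal ((norm (g (snd z)))\<^sup>2 * e (fst z) (snd z)) \<partial>(\<mu> \<Otimes>\<^sub>M \<mu>))
      = (\<integral>\<^sup>+x'. (\<integral>\<^sup>+x. ennreal ((norm (g x'))\<^sup>2 * e x x') \<partial>\<mu>) \<partial>\<mu>)"
    by (subst MM.nn_integral_snd[symmetric]) (auto simp: split_beta')
  also have "\<dots> = (\<integral>\<^sup>+x'. (\<integral>\<^sup>+x. ennreal ((norm (g x'))\<^sup>2 * e x' x) \<partial>\<mu>) \<partial>\<mu>)"
    by (simp add: e_comm)
  also have "(\<integral>\<^sup>+z. ennreal ((norm (g (fst z)))\<^sup>2 * e (fst z) (snd z)) \<partial>(\<mu> \<Otimes>\<^sub>M \<mu>))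
      = (\<integral>\<^sup>+x'. (\<integral>\<^sup>+x. ennreal ((norm (g x'))\<^sup>2 * e x' x) \<partial>\<mu>) \<partial>\<mu>)"
    by (subst mu.nn_integral_fst[symmetric]) auto
  also have "(\<integral>\<^sup>+x'. (\<integral>\<^sup>+x. ennreal ((norm (g x'))\<^sup>2 * e x' x) \<partial>\<mu>) \<partial>\<mu>) \<le> (\<integral>\<^sup>+x'. ennreal ((norm (g x'))\<^sup>2) * ennreal C \<partial>\<mu>)"
  proof (rule nn_integral_mono)
    fix x'
    have "(\<integral>\<^sup>+x. ennreal ((norm (g x'))\<^sup>2 * e x' x) \<partial>\<mu>) = (\<integral>\<^sup>+x. ennreal ((norm (g x'))\<^sup>2) * ennreal (e x' x) \<partial>\<mu>)"
      by (simp add: ennreal_mult e0)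
    also have "\<dots> = ennreal ((norm (g x'))\<^sup>2) * (\<integral>\<^sup>+x. ennreal (e x' x) \<partial>\<mu>)"
      by (rule nn_integral_cmult) (simp add: e_def)
    also have "\<dots> \<le> ennreal ((norm (g x'))\<^sup>2) * ennreal C"
      unfolding e_def by (intro mult_left_mono schur) auto
    finally show "(\<integral>\<^sup>+x. ennreal ((norm (g x'))\<^sup>2 * e x' x) \<partial>\<mu>) \<le> ennreal ((norm (g x'))\<^sup>2) * ennreal C" .
  qed
  also have "(\<integral>\<^sup>+x'. ennreal ((norm (g x'))\<^sup>2) * ennreal C \<partial>\<mu>) = ennreal C * (\<integral>\<^sup>+x'. ennreal ((norm (g x'))\<^sup>2) \<partial>\<mu>)"
    by (subst nn_integral_multc) (auto simp: mult.commute)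
  finally have *: "(\<integral>\<^sup>+y. ennreal (gauss_weight y * (norm (H y))\<^sup>2) \<partial>lborel)
      \<le> ennreal (1/2) * (ennreal C * (\<integral>\<^sup>+x'. ennreal ((norm (g x'))\<^sup>2) \<partial>\<mu>))
       + ennreal (1/2) * (ennreal C * (\<integral>\<^sup>+x'. ennreal ((norm (g x'))\<^sup>2) \<partial>\<mu>))"
    by (simp add: add_mono mult_left_mono)
  have half: "ennreal (1/2) * a + ennreal (1/2) * a = a" for a
    by (subst distrib_right[symmetric], subst ennreal_plus[symmetric]) auto
  show ?thesis using * unfolding half H_def .
qed

section \<open>A change of variables inequality for expanding maps\<close>

lemma emeasure_lborel_ball_scale:
  fixes a b :: "'a::euclidean_space"
  assumes "0 < r" "0 \<le> k"
  shows "emeasure lborel (ball a (k * r)) = ennreal (k ^ DIM('a)) * emeasure lborel (ball b r)"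
  using assms by (simp add: emeasure_ball power_mult_distrib ennreal_mult'[symmetric] mult_ac)

text \<open>Averaging over small balls replaces a change of variables: a ball of radius r has a preimage
  of diameter at most 2r/c.\<close>

lemma nn_integral_expanding_le:
  fixes \<Phi> :: "'a::euclidean_space \<Rightarrow> 'a" and u :: "'a \<Rightarrow> real"
  assumes E[measurable]: "E \<in> sets borel" and Ef: "emeasure lborel E < \<infinity>"
    and \<Phi>[measurable]: "\<Phi> \<in> borel_measurable borel"
    and R: "\<And>t. t \<in> E \<Longrightarrow> norm (\<Phi> t) \<le> R"
    and c: "0 < c" and exp: "\<And>s t. s \<in> E \<Longrightarrow> t \<in> E \<Longrightarrow> c * norm (s - t) \<le> norm (\<Phi> s - \<Phi> t)"
    and u: "continuous_on UNIV u" "\<And>y. 0 \<le> u y"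
  shows "(\<integral>\<^sup>+t. ennreal (u (\<Phi> t)) * indicator E t \<partial>lborel)
           \<le> ennreal ((2 / c) ^ DIM('a)) * (\<integral>\<^sup>+y. ennreal (u y) \<partial>lborel)" (is "?X \<le> ?Y")
proof (rule ennreal_le_epsilon)
  fix e :: real assume e: "0 < e"
  have [measurable]: "u \<in> borel_measurable borel"
    by (rule borel_measurable_continuous_onI) (rule u)
  define m where "m = enn2real (emeasure lborel E)"
  have m: "emeasure lborel E = ennreal m" "0 \<le> m"
    using Ef by (auto simp: m_def)
  \<comment> \<open>The averaging error is at most \<open>e'\<close> at each point of
    \<open>E\<close>, so \<open>e' * m \<le> e\<close> in total; the added 1 covers the case of a
    null set.\<close>
  define e' where "e' = e / (m + 1)"
  have e': "0 < e'" "e' * m \<le> e" using e m by (auto simp: e'_def field_simps)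
  \<comment> \<open>The radius \<open>R + 1\<close> leaves room for balls of radius at most 1 about
    points of the image.\<close>
  have "uniformly_continuous_on (cball 0 (R + 1)) u"
    by (intro compact_uniformly_continuous continuous_on_subset[OF u(1)]) auto
  then obtain r0 where r0: "0 < r0"
    "\<And>y z. y \<in> cball 0 (R + 1) \<Longrightarrow> z \<in> cball 0 (R + 1) \<Longrightarrow> dist z y < r0 \<Longrightarrow> dist (u z) (u y) < e'"
    unfolding uniformly_continuous_on_def using e'(1) by meson
  define r where "r = min r0 1"
  have r: "0 < r" "r \<le> r0" "r \<le> 1" using r0 by (auto simp: r_def)
  define V where "V = emeasure lborel (ball (0::'a) r)"
  have V: "V \<noteq> 0" "V \<noteq> \<infinity>"
    using r unit_ball_vol_pos[of "real DIM('a)"] by (auto simp: V_def emeasure_ball simp del: unit_ball_vol_pos)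
  have [measurable]: "ball y s \<in> sets (borel :: 'a measure)" for y s by simp
  have ballV: "emeasure lborel (ball (a::'a) r) = V" for a
    using emeasure_lborel_ball_scale[of r 1 a 0] r by (simp add: V_def)
  have pt: "V * ennreal (u (\<Phi> t)) \<le> (\<integral>\<^sup>+y. ennreal (u y) * indicator (ball (\<Phi> t) r) y \<partial>lborel) + ennreal e' * V"
    if "t \<in> E" for t
  proof -
    have "V * ennreal (u (\<Phi> t)) = (\<integral>\<^sup>+y. ennreal (u (\<Phi> t)) * indicator (ball (\<Phi> t) r) y \<partial>lborel)"
      by (subst nn_integral_cmult_indicator) (auto simp: ballV mult.commute)
    also have "\<dots> \<le> (\<integral>\<^sup>+y. ennreal (u y) * indicator (ball (\<Phi> t) r) y + ennreal e' * indicator (ball (\<Phi> t) r) y \<partial>lborel)"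
    proof (rule nn_integral_mono)
      fix y
      have "u (\<Phi> t) \<le> u y + e'" if y: "y \<in> ball (\<Phi> t) r"
      proof -
        have "norm y \<le> R + 1"
          using R[OF \<open>t \<in> E\<close>] y r norm_triangle_sub[of y "\<Phi> t"] by (auto simp: dist_norm norm_minus_commute)
        then have "dist (u (\<Phi> t)) (u y) < e'"
          using R[OF \<open>t \<in> E\<close>] y r by (intro r0(2)) auto
        then show ?thesis by (simp add: dist_real_def)
      qed
      then show "ennreal (u (\<Phi> t)) * indicator (ball (\<Phi> t) r) y
        \<le> ennreal (u y) * indicator (ball (\<Phi> t) r) y + ennreal e' * indicator (ball (\<Phi> t) r) y"
        using e' u(2) by (auto simp: indicator_def ennreal_plus[symmetric] ennreal_leI simp del: ennreal_plus)
    qed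
    also have "\<dots> = (\<integral>\<^sup>+y. ennreal (u y) * indicator (ball (\<Phi> t) r) y \<partial>lborel) + ennreal e' * V"
      by (subst nn_integral_add) (auto simp: nn_integral_cmult_indicator ballV)
    finally show ?thesis .
  qed
  have meas1: "(\<lambda>(t, y). indicator (ball (\<Phi> t) r) y :: ennreal) \<in> borel_measurable (borel \<Otimes>\<^sub>M borel)"
    unfolding mem_ball indicator_def by measurable
  have m2: "(\<lambda>t. \<integral>\<^sup>+y. indicator E t * (ennreal (u y) * indicator (ball (\<Phi> t) r) y) \<partial>lborel) \<in> borel_measurable lborel"
    unfolding mem_ball indicator_def by measurable
  \<comment> \<open>All points of \<open>E\<close> sent into one ball of radius \<open>r\<close> lie
    within \<open>2 * r / c\<close> of any one of them; the factor in the conclusion is the ratio of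
    the volumes of the two balls.\<close>
  have pre: "(\<integral>\<^sup>+t. indicator E t * indicator (ball (\<Phi> t) r) y \<partial>lborel) \<le> ennreal ((2 / c) ^ DIM('a)) * V" for y
  proof (cases "\<exists>s\<in>E. dist (\<Phi> s) y < r")
    case False
    then have 0: "indicator E t * indicator (ball (\<Phi> t) r) y = (0 :: ennreal)" for t
      by (cases "t \<in> E") auto
    then have "(\<integral>\<^sup>+t. indicator E t * indicator (ball (\<Phi> t) r) y \<partial>lborel) = (\<integral>\<^sup>+t. 0 \<partial>(lborel :: 'a measure))"
      by (intro nn_integral_cong 0)
    then show ?thesis by simp
  next
    case True
    then obtain s where s: "s \<in> E" "dist (\<Phi> s) y < r" by auto
    have "(\<integral>\<^sup>+t. indicator E t * indicator (ball (\<Phi> t) r) y \<partial>lborel) \<le> (\<integral>\<^sup>+t. indicator (ball s (2 / c * r)) t \<partial>lborel)"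
    proof (rule nn_integral_mono)
      fix t
      have "dist s t < 2 / c * r" if "t \<in> E" "dist (\<Phi> t) y < r"
      proof -
        have "c * dist s t \<le> dist (\<Phi> s) (\<Phi> t)" using exp[OF s(1) that(1)] by (simp add: dist_norm)
        also have "\<dots> < 2 * r" using dist_triangle2[of "\<Phi> s" "\<Phi> t" y] s that by simp
        finally show ?thesis using c by (simp add: field_simps)
      qed
      then show "indicator E t * indicator (ball (\<Phi> t) r) y \<le> (indicator (ball s (2 / c * r)) t :: ennreal)"
        by (auto simp: indicator_def)
    qed
    also have "\<dots> = ennreal ((2 / c) ^ DIM('a)) * V"
      using emeasure_lborel_ball_scale[of r "2 / c" s 0] r c by (simp add: V_def)
    finally show ?thesis .
  qed
  have "V * ?X = (\<integral>\<^sup>+t. indicator E t * (V * ennreal (u (\<Phi> t))) \<partial>lborel)"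
    by (subst nn_integral_cmult[symmetric]) (auto simp: mult_ac)
  also have "\<dots> \<le> (\<integral>\<^sup>+t. (\<integral>\<^sup>+y. indicator E t * (ennreal (u y) * indicator (ball (\<Phi> t) r) y) \<partial>lborel) + indicator E t * (ennreal e' * V) \<partial>lborel)"
    using pt meas1 by (intro nn_integral_mono) (auto simp: indicator_def)
  also have "\<dots> = (\<integral>\<^sup>+t. (\<integral>\<^sup>+y. indicator E t * (ennreal (u y) * indicator (ball (\<Phi> t) r) y) \<partial>lborel) \<partial>lborel) + ennreal e' * V * emeasure lborel E"
    by (subst nn_integral_add[OF m2]) (auto simp: nn_integral_cmult_indicator mult.commute[of "indicator E _"])
  also have "(\<integral>\<^sup>+t. (\<integral>\<^sup>+y. indicator E t * (ennreal (u y) * indicator (ball (\<Phi> t) r) y) \<partial>lborel) \<partial>lborel)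
      = (\<integral>\<^sup>+y. (\<integral>\<^sup>+t. ennreal (u y) * (indicator E t * indicator (ball (\<Phi> t) r) y) \<partial>lborel) \<partial>lborel)"
    using meas1 by (subst lborel_pair.Fubini') (auto simp: mult_ac)
  also have "\<dots> = (\<integral>\<^sup>+y. ennreal (u y) * (\<integral>\<^sup>+t. indicator E t * indicator (ball (\<Phi> t) r) y \<partial>lborel) \<partial>lborel)"
    using meas1 by (subst nn_integral_cmult) auto
  also have "\<dots> \<le> (\<integral>\<^sup>+y. ennreal (u y) * (ennreal ((2 / c) ^ DIM('a)) * V) \<partial>lborel)"
    by (intro nn_integral_mono mult_left_mono pre) auto
  also have "\<dots> = V * ?Y"
    by (subst nn_integral_multc) (auto simp: mult_ac)
  also have "ennreal e' * V * emeasure lborel E \<le> V * ennreal e"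
    using e' m by (auto simp: mult_ac ennreal_mult'[symmetric] intro!: mult_left_mono ennreal_leI)
  finally have "V * ?X \<le> V * (?Y + ennreal e)"
    by (simp add: distrib_left add_mono)
  then show "?X \<le> ?Y + ennreal e"
    using V by (simp add: ennreal_mult_le_mult_iff)
qed

text \<open>Pairing the operator's output \<open>S\<close> with its own conjugate over
  \<open>\<mu>\<close> and exchanging the integrals gives the integral over \<open>E\<close> of
  \<open>G\<close> times \<open>H\<close> composed with \<open>\<Phi>\<close>, where
  \<open>H\<close> is a transform of \<open>cnj S\<close>. The expanding map and the Gaussian weight
  bound the second factor in L2 by \<open>S\<close> itself, and half of the result is
  absorbed.\<close>

lemma oscillatory_L2:
  fixes \<mu> :: "(real^'n::finite) measure" and \<Phi> :: "real^'n \<Rightarrow> real^'n" and G :: "real^'n \<Rightarrow> complex"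
  assumes "finite_measure \<mu>" and sets: "sets \<mu> = sets borel"
    and schur: "\<And>x. (\<integral>\<^sup>+y. ennreal (exp (- (norm (x - y))\<^sup>2 / 2)) \<partial>\<mu>) \<le> ennreal C"
    and E[measurable]: "E \<in> sets borel" and Ef: "emeasure lborel E < \<infinity>"
    and \<Phi>[measurable]: "\<Phi> \<in> borel_measurable borel"
    and R: "\<And>t. t \<in> E \<Longrightarrow> norm (\<Phi> t) \<le> R"
    and c: "0 < c" and exp: "\<And>s t. s \<in> E \<Longrightarrow> t \<in> E \<Longrightarrow> c * norm (s - t) \<le> norm (\<Phi> s - \<Phi> t)"
    and w: "0 < w" "\<And>y. norm y \<le> R \<Longrightarrow> w \<le> gauss_weight (y :: real^'n)"
    and G[measurable]: "G \<in> borel_measurable borel" and intG: "integrable lborel G"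
    and C: "0 < C"
  shows "(\<integral>\<^sup>+x. ennreal ((norm (\<integral>t. indicator E t * cis (x \<bullet> \<Phi> t) * G t \<partial>lborel))\<^sup>2) \<partial>\<mu>)
           \<le> ennreal (C * (2 / c) ^ CARD('n) / w) * (\<integral>\<^sup>+t. ennreal ((norm (G t))\<^sup>2) \<partial>lborel)"
proof -
  note [measurable_cong] = sets
  interpret mu: finite_measure "\<mu>" by fact
  interpret PS: pair_sigma_finite "\<mu>" "lborel :: (real^'n) measure" ..
  define D where "D = C * (2 / c) ^ CARD('n) / w"
  have D: "0 < D" using C c w by (simp add: D_def)
  define S where "S x = (\<integral>t. indicator E t * cis (x \<bullet> \<Phi> t) * G t \<partial>lborel)" for x
  define B where "B = (\<integral>t. norm (G t) \<partial>lborel)"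
  have [measurable]: "S \<in> borel_measurable borel"
    unfolding S_def by (rule lborel.borel_measurable_lebesgue_integral) measurable
  have int_S: "integrable lborel (\<lambda>t. indicator E t * cis (x \<bullet> \<Phi> t) * G t)" for x
    by (rule Bochner_Integration.integrable_bound[OF intG])
      (auto simp: norm_mult indicator_def)
  have S_bound: "norm (S x) \<le> B" for x
  proof -
    have "norm (S x) \<le> (\<integral>t. norm (indicator E t * cis (x \<bullet> \<Phi> t) * G t) \<partial>lborel)"
      unfolding S_def by (rule integral_norm_bound)
    also have "\<dots> \<le> B"
      unfolding B_def by (intro integral_mono integrable_norm int_S intG) (auto simp: norm_mult indicator_def)
    finally show ?thesis .
  qed
  have B0: "0 \<le> B" by (simp add: B_def integral_nonneg_AE)
  define H where "H y = (\<integral>x. cis (x \<bullet> y) * cnj (S x) \<partial>\<mu>)" for y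
  have int_H: "integrable \<mu> (\<lambda>x. cis (x \<bullet> y) * cnj (S x))" for y
    by (rule mu.integrable_const_bound[where B=B]) (auto simp: norm_mult S_bound)
  \<comment> \<open>Continuity is required by \<open>nn_integral_expanding_le\<close>, which
    averages over small balls.\<close>
  have H_cont: "continuous_on UNIV H"
  proof (rule continuous_at_imp_continuous_on, rule ballI)
    fix y
    show "isCont H y"
      unfolding continuous_at_sequentially comp_def H_def
    proof (intro allI impI)
      fix X :: "nat \<Rightarrow> real^'n" assume X: "X \<longlonglongrightarrow> y"
      show "(\<lambda>n. \<integral>x. cis (x \<bullet> X n) * cnj (S x) \<partial>\<mu>) \<longlonglongrightarrow> (\<integral>x. cis (x \<bullet> y) * cnj (S x) \<partial>\<mu>)"
      proof (rule integral_dominated_convergence[where w="\<lambda>_. B"])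
        show "AE x in \<mu>. (\<lambda>n. cis (x \<bullet> X n) * cnj (S x)) \<longlonglongrightarrow> cis (x \<bullet> y) * cnj (S x)"
          by (intro AE_I2 tendsto_intros X isCont_tendsto_compose[OF _ tendsto_inner] continuous_intros)
      qed (auto simp: norm_mult S_bound)
    qed
  qed
  have [measurable]: "H \<in> borel_measurable borel"
    by (rule borel_measurable_continuous_onI[OF H_cont])
  define X where "X = (\<integral>\<^sup>+x. ennreal ((norm (S x))\<^sup>2) \<partial>\<mu>)"
  have int_SS: "integrable \<mu> (\<lambda>x. (norm (S x))\<^sup>2)"
    by (rule mu.integrable_const_bound[where B="B\<^sup>2"]) (auto intro!: power_mono S_bound)
  have X_eq: "X = ennreal (\<integral>x. (norm (S x))\<^sup>2 \<partial>\<mu>)"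
    unfolding X_def by (rule nn_integral_eq_integral[OF int_SS]) auto
  \<comment> \<open>On the image of \<open>E\<close> the Gaussian weight is at least
    \<open>w\<close>, so it may be inserted at the cost of \<open>1 / w\<close>; \<open>D\<close>
    collects this, the change of variables and the Schur constant.\<close>
  have HE: "(\<integral>\<^sup>+t. ennreal ((norm (H (\<Phi> t)))\<^sup>2) * indicator E t \<partial>lborel) \<le> ennreal D * X"
  proof -
    have "(\<integral>\<^sup>+t. ennreal ((norm (H (\<Phi> t)))\<^sup>2) * indicator E t \<partial>lborel)
      \<le> (\<integral>\<^sup>+t. ennreal (1 / w * (gauss_weight (\<Phi> t) * (norm (H (\<Phi> t)))\<^sup>2)) * indicator E t \<partial>lborel)"
    proof (intro nn_integral_mono)
      fix t
      have "(norm (H (\<Phi> t)))\<^sup>2 \<le> 1 / w * (gauss_weight (\<Phi> t) * (norm (H (\<Phi> t)))\<^sup>2)" if "t \<in> E"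
        using mult_right_mono[OF w(2)[OF R[OF that]], of "(norm (H (\<Phi> t)))\<^sup>2"] w(1) by (simp add: field_simps)
      then show "ennreal ((norm (H (\<Phi> t)))\<^sup>2) * indicator E t
          \<le> ennreal (1 / w * (gauss_weight (\<Phi> t) * (norm (H (\<Phi> t)))\<^sup>2)) * indicator E t"
        by (auto simp: indicator_def intro!: ennreal_leI)
    qed
    also have "\<dots> \<le> ennreal ((2 / c) ^ DIM(real^'n)) * (\<integral>\<^sup>+y. ennreal (1 / w * (gauss_weight y * (norm (H y))\<^sup>2)) \<partial>lborel)"
      using w(1) by (intro nn_integral_expanding_le[OF E Ef \<Phi> R c exp])
        (auto intro!: continuous_intros continuous_on_gauss_weight H_cont mult_nonneg_nonneg simp: gauss_weight_pos less_imp_le)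
    also have "(\<integral>\<^sup>+y. ennreal (1 / w * (gauss_weight y * (norm (H y))\<^sup>2)) \<partial>lborel)
        = ennreal (1 / w) * (\<integral>\<^sup>+y. ennreal (gauss_weight y * (norm (H y))\<^sup>2) \<partial>lborel)"
      using w(1) by (subst nn_integral_cmult[symmetric]) (auto simp: ennreal_mult'[symmetric])
    also have "(\<integral>\<^sup>+y. ennreal (gauss_weight y * (norm (H y))\<^sup>2) \<partial>lborel) \<le> ennreal C * X"
      using gaussian_weighted_L2[OF assms(1) sets schur, of "\<lambda>x. cnj (S x)" B] S_bound
      by (simp add: H_def X_def)
    finally have "(\<integral>\<^sup>+t. ennreal ((norm (H (\<Phi> t)))\<^sup>2) * indicator E t \<partial>lborel)
        \<le> ennreal ((2 / c) ^ CARD('n)) * (ennreal (1 / w) * (ennreal C * X))"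
      by (simp add: mult_left_mono)
    also have "\<dots> = ennreal D * X"
    proof -
      have 1: "ennreal (1 / w) * (ennreal C * X) = ennreal (1 / w * C) * X"
        using w by (intro ennreal_mult_assoc) simp
      have 2: "ennreal ((2 / c) ^ CARD('n)) * (ennreal (1 / w * C) * X) = ennreal ((2 / c) ^ CARD('n) * (1 / w * C)) * X"
        using c by (intro ennreal_mult_assoc) simp
      have 3: "(2 / c) ^ CARD('n) * (1 / w * C) = D"
        by (simp add: D_def)
      show ?thesis unfolding 1 2 3 ..
    qed
    finally show ?thesis .
  qed
  define k where "k z = indicator E (snd z) * cis (fst z \<bullet> \<Phi> (snd z)) * G (snd z) * cnj (S (fst z))" for z
  have [measurable]: "k \<in> borel_measurable (\<mu> \<Otimes>\<^sub>M lborel)"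
    unfolding k_def by measurable
  have int_k: "integrable (\<mu> \<Otimes>\<^sub>M lborel) k"
  proof (rule PS.Fubini_integrable)
    have "integrable \<mu> (\<lambda>x. (\<integral>t. norm (indicator E t * cis (x \<bullet> \<Phi> t) * G t) \<partial>lborel) * norm (S x))"
    proof (rule mu.integrable_const_bound[where B="B * B"])
      show "AE x in \<mu>. norm ((\<integral>t. norm (indicator E t * cis (x \<bullet> \<Phi> t) * G t) \<partial>lborel) * norm (S x)) \<le> B * B"
      proof (rule AE_I2)
        fix x
        have "(\<integral>t. norm (indicator E t * cis (x \<bullet> \<Phi> t) * G t) \<partial>lborel) \<le> B"
          unfolding B_def by (intro integral_mono integrable_norm int_S intG) (auto simp: norm_mult indicator_def)
        then show "norm ((\<integral>t. norm (indicator E t * cis (x \<bullet> \<Phi> t) * G t) \<partial>lborel) * norm (S x)) \<le> B * B"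
          using S_bound[of x] B0 by (auto simp: abs_mult integral_nonneg_AE intro!: mult_mono)
      qed
      show "(\<lambda>x. (\<integral>t. norm (indicator E t * cis (x \<bullet> \<Phi> t) * G t) \<partial>lborel) * norm (S x)) \<in> borel_measurable \<mu>"
        by (intro borel_measurable_times lborel.borel_measurable_lebesgue_integral) measurable
    qed
    then show "integrable \<mu> (\<lambda>x. \<integral>t. norm (k (x, t)) \<partial>lborel)"
      by (simp add: k_def norm_mult)
    show "AE x in \<mu>. integrable lborel (\<lambda>t. k (x, t))"
      unfolding k_def fst_conv snd_conv by (intro AE_I2 integrable_mult_left int_S)
  qed measurable
  have "complex_of_real (\<integral>x. (norm (S x))\<^sup>2 \<partial>\<mu>) = (\<integral>x. S x * cnj (S x) \<partial>\<mu>)"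
    by (subst integral_complex_of_real[symmetric]) (simp only: complex_norm_square)
  also have "\<dots> = (\<integral>x. (\<integral>t. k (x, t) \<partial>lborel) \<partial>\<mu>)"
    by (simp add: k_def S_def)
  also have "\<dots> = (\<integral>t. (\<integral>x. k (x, t) \<partial>\<mu>) \<partial>lborel)"
    using PS.Fubini_integral[of "\<lambda>x t. k (x, t)"] int_k by simp
  also have "\<dots> = (\<integral>t. indicator E t * G t * H (\<Phi> t) \<partial>lborel)"
  proof (intro Bochner_Integration.integral_cong refl)
    fix t
    have "(\<integral>x. k (x, t) \<partial>\<mu>) = (\<integral>x. (indicator E t * G t) * (cis (x \<bullet> \<Phi> t) * cnj (S x)) \<partial>\<mu>)"
      by (simp add: k_def mult_ac)
    also have "\<dots> = indicator E t * G t * H (\<Phi> t)"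
      unfolding H_def by (rule integral_mult_right_zero)
    finally show "(\<integral>x. k (x, t) \<partial>\<mu>) = indicator E t * G t * H (\<Phi> t)" .
  qed
  finally have SS: "complex_of_real (\<integral>x. (norm (S x))\<^sup>2 \<partial>\<mu>) = (\<integral>t. indicator E t * G t * H (\<Phi> t) \<partial>lborel)" .
  have int_GH: "integrable lborel (\<lambda>t. indicator E t * G t * H (\<Phi> t))"
  proof (rule Bochner_Integration.integrable_bound[of _ "\<lambda>t. (B * measure \<mu> (space \<mu>)) *\<^sub>R G t"])
    show "integrable lborel (\<lambda>t. (B * measure \<mu> (space \<mu>)) *\<^sub>R G t)" using intG by simp
    have "norm (H y) \<le> B * measure \<mu> (space \<mu>)" for y
    proof -
      have "norm (H y) \<le> (\<integral>x. norm (cis (x \<bullet> y) * cnj (S x)) \<partial>\<mu>)"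
        unfolding H_def by (rule integral_norm_bound)
      also have "\<dots> \<le> (\<integral>x. B \<partial>\<mu>)"
        by (intro integral_mono integrable_norm int_H) (auto simp: norm_mult S_bound)
      finally show ?thesis by (simp add: mult.commute)
    qed
    from mult_left_mono[OF this norm_ge_zero]
    show "AE t in lborel. norm (indicator E t * G t * H (\<Phi> t)) \<le> norm ((B * measure \<mu> (space \<mu>)) *\<^sub>R G t)"
      using B0 by (intro AE_I2) (auto simp: norm_mult indicator_def mult.commute)
  qed measurable
  have "X = ennreal (norm (\<integral>t. indicator E t * G t * H (\<Phi> t) \<partial>lborel))"
    unfolding X_eq SS[symmetric] by (simp add: integral_nonneg_AE)
  also have "\<dots> \<le> (\<integral>\<^sup>+t. ennreal (norm (indicator E t * G t * H (\<Phi> t))) \<partial>lborel)"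
    by (rule integral_norm_bound_ennreal[OF int_GH])
  \<comment> \<open>The weights \<open>D / 2\<close> and \<open>1 / (2 * D)\<close> are balanced so
    that \<open>HE\<close> turns the second term into exactly half of \<open>X\<close>.\<close>
  also have "\<dots> \<le> (\<integral>\<^sup>+t. ennreal (D / 2) * ennreal ((norm (G t))\<^sup>2)
      + ennreal (1 / (2 * D)) * (ennreal ((norm (H (\<Phi> t)))\<^sup>2) * indicator E t) \<partial>lborel)"
  proof (rule nn_integral_mono)
    fix t
    have "norm (G t) * norm (H (\<Phi> t)) \<le> D / 2 * (norm (G t))\<^sup>2 + 1 / (2 * D) * (norm (H (\<Phi> t)))\<^sup>2"
    proof -
      have "0 \<le> (D * norm (G t) - norm (H (\<Phi> t)))\<^sup>2 / (2 * D)" using D by simp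
      also have "\<dots> = D / 2 * (norm (G t))\<^sup>2 + 1 / (2 * D) * (norm (H (\<Phi> t)))\<^sup>2 - norm (G t) * norm (H (\<Phi> t))"
        using D by (simp add: field_simps power2_eq_square)
      finally show ?thesis by simp
    qed
    then have "ennreal (norm (G t) * norm (H (\<Phi> t))) \<le> ennreal (D / 2 * (norm (G t))\<^sup>2) + ennreal (1 / (2 * D) * (norm (H (\<Phi> t)))\<^sup>2)"
      using D by (intro ennreal_leI_add) auto
    then show "ennreal (norm (indicator E t * G t * H (\<Phi> t)))
      \<le> ennreal (D / 2) * ennreal ((norm (G t))\<^sup>2) + ennreal (1 / (2 * D)) * (ennreal ((norm (H (\<Phi> t)))\<^sup>2) * indicator E t)"
      using D by (auto simp: indicator_def norm_mult ennreal_mult'[symmetric])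
  qed
  also have "\<dots> = ennreal (D / 2) * (\<integral>\<^sup>+t. ennreal ((norm (G t))\<^sup>2) \<partial>lborel)
      + ennreal (1 / (2 * D)) * (\<integral>\<^sup>+t. ennreal ((norm (H (\<Phi> t)))\<^sup>2) * indicator E t \<partial>lborel)"
    by (subst nn_integral_add, measurable, subst (1 2) nn_integral_cmult, auto)
  also have "\<dots> \<le> ennreal (D / 2) * (\<integral>\<^sup>+t. ennreal ((norm (G t))\<^sup>2) \<partial>lborel) + ennreal (1 / (2 * D)) * (ennreal D * X)"
    by (intro add_left_mono mult_left_mono HE) auto
  also have "ennreal (1 / (2 * D)) * (ennreal D * X) = ennreal (1 / 2) * X"
    using D by (simp add: mult.assoc[symmetric] ennreal_mult'[symmetric])
  finally have fin: "X \<le> ennreal (D / 2) * (\<integral>\<^sup>+t. ennreal ((norm (G t))\<^sup>2) \<partial>lborel) + ennreal (1 / 2) * X" .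
  \<comment> \<open>\<open>X\<close> is finite by \<open>X_eq\<close>, so half of it can be moved to
    the left-hand side.\<close>
  have "X \<le> ennreal D * (\<integral>\<^sup>+t. ennreal ((norm (G t))\<^sup>2) \<partial>lborel)"
  proof (cases "(\<integral>\<^sup>+t. ennreal ((norm (G t))\<^sup>2) \<partial>lborel) = \<infinity>")
    case True then show ?thesis using D by (simp add: ennreal_mult_top)
  next
    case False
    then obtain N where N: "0 \<le> N" "(\<integral>\<^sup>+t. ennreal ((norm (G t))\<^sup>2) \<partial>lborel) = ennreal N"
      by (metis ennreal_cases infinity_ennreal_def)
    define x where "x = (\<integral>x. (norm (S x))\<^sup>2 \<partial>\<mu>)"
    have x: "0 \<le> x" by (simp add: x_def integral_nonneg_AE)
    have "ennreal x \<le> ennreal (D / 2 * N) + ennreal (1 / 2 * x)"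
      using fin N x D unfolding X_eq x_def[symmetric] N(2)
      by (simp only: ennreal_mult'[symmetric])
    from ennreal_leD_add[OF this] have "x \<le> D * N" using x D N by simp
    then show ?thesis using D N by (simp add: X_eq x_def[symmetric] ennreal_mult'[symmetric] ennreal_leI)
  qed
  then show ?thesis by (simp add: X_def S_def D_def)
qed

section \<open>Curves close to the moment curve\<close>

lemma coord_index_less: "i < j \<Longrightarrow> coord_index i < coord_index (j :: 'n::{finite,linorder})"
  unfolding coord_index_def by (rule psubset_card_mono) (auto simp: less_le_not_le intro: order_trans)

lemma inj_coord_index: "inj (coord_index :: 'n::{finite,linorder} \<Rightarrow> nat)"
  by (metis coord_index_less injI less_irrefl linorder_neqE)

lemma coord_index_eq_iff [simp]: "coord_index i = coord_index j \<longleftrightarrow> i = (j :: 'n::{finite,linorder})"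
  by (rule inj_eq[OF inj_coord_index])

lemma coord_index_ge_1: "1 \<le> coord_index (i :: 'n::{finite,linorder})"
  by (auto simp: coord_index_def Suc_le_eq card_gt_0_iff)

lemma coord_index_le: "coord_index (i :: 'n::{finite,linorder}) \<le> CARD('n)"
  unfolding coord_index_def by (rule card_mono) auto

lemma range_coord_index: "range (coord_index :: 'n::{finite,linorder} \<Rightarrow> nat) = {1..CARD('n)}"
proof (rule card_subset_eq)
  show "range (coord_index :: 'n \<Rightarrow> nat) \<subseteq> {1..CARD('n)}"
    using coord_index_ge_1 coord_index_le by fastforce
  show "card (range (coord_index :: 'n \<Rightarrow> nat)) = card {1..CARD('n)}"
    by (simp add: card_image[OF inj_coord_index])
qed simp

lemma sum_coord_index: "(\<Sum>i\<in>UNIV. f (coord_index (i :: 'n::{finite,linorder}))) = (\<Sum>k=1..CARD('n). f k)"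
  using sum.reindex[OF inj_coord_index[where 'n='n], of f] by (simp add: range_coord_index)

text \<open>The closed form of the l-th derivative of \<open>moment_curve\<close>. Without the
  guard, truncated subtraction would leave 1 in the coordinates that have been differentiated
  away.\<close>

definition moment_deriv :: "nat \<Rightarrow> real \<Rightarrow> real ^ 'n::{finite,linorder}" where
  "moment_deriv l t = (\<chi> i. if l \<le> coord_index i then t ^ (coord_index i - l) / fact (coord_index i - l) else 0)"

lemma moment_deriv_0: "moment_deriv 0 = moment_curve"
  by (auto simp: moment_deriv_def moment_curve_def)

lemma moment_deriv_top:
  assumes "CARD('n::{finite,linorder}) < l"
  shows "moment_deriv l t = (0 :: (real, 'n) vec)"
proof -
  have "\<not> l \<le> coord_index i" for i :: 'n using coord_index_le[of i] assms by linarith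
  then show ?thesis by (simp add: moment_deriv_def vec_eq_iff)
qed

lemma moment_deriv_at_0:
  "moment_deriv l 0 $ i = (if coord_index i = l then 1 else 0)"
  by (auto simp: moment_deriv_def power_0_left)

lemma has_vector_derivative_vec:
  fixes f :: "real \<Rightarrow> real ^ 'n"
  assumes "\<And>i. ((\<lambda>t. f t $ i) has_real_derivative f' $ i) (at t within S)"
  shows "(f has_vector_derivative f') (at t within S)"
  unfolding has_vector_derivative_def
  by (subst has_derivative_componentwise_within)
    (use assms in \<open>auto simp: Basis_vec_def inner_axis has_field_derivative_def mult.commute[of _ "f' $ _"]\<close>)

lemma moment_deriv_derivative:
  "(moment_deriv l has_vector_derivative (moment_deriv (Suc l) t :: real ^ 'n::{finite,linorder})) (at t within S)"
proof (rule has_vector_derivative_vec)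
  fix i :: 'n
  show "((\<lambda>t. moment_deriv l t $ i) has_real_derivative moment_deriv (Suc l) t $ i) (at t within S)"
  proof (cases "l < coord_index i")
    case True
    define m where "m = coord_index i - Suc l"
    have m: "coord_index i - l = Suc m" and m': "coord_index i - Suc l = m"
      using True by (auto simp: m_def Suc_diff_Suc)
    have "((\<lambda>t. t ^ Suc m / fact (Suc m)) has_real_derivative real (Suc m) * t ^ m / fact (Suc m)) (at t within S)"
      using DERIV_cdivide[OF DERIV_pow[of "Suc m" t S], of "fact (Suc m)"] by simp
    moreover have "real (Suc m) * t ^ m / fact (Suc m) = t ^ m / fact m"
      unfolding fact_Suc by (simp del: of_nat_Suc)
    ultimately have "((\<lambda>t. t ^ Suc m / fact (Suc m)) has_real_derivative t ^ m / fact m) (at t within S)"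
      by simp
    then show ?thesis using True by (simp add: moment_deriv_def m m' del: power_Suc fact_Suc)
  next
    case False
    then have "(\<lambda>t. moment_deriv l t $ i) = (\<lambda>t. if l = coord_index i then 1 else 0)"
      by (auto simp: moment_deriv_def)
    then show ?thesis using False by (simp add: moment_deriv_def)
  qed
qed

lemma continuous_on_moment_deriv: "continuous_on S (moment_deriv l)"
  unfolding continuous_on_eq_continuous_within
  using moment_deriv_derivative has_vector_derivative_continuous by blast

text \<open>The family g collects the successive derivatives of the curve g 0. Recording them as data makes
  the class visibly closed under rescaling.\<close>

definition near_moment :: "real \<Rightarrow> (nat \<Rightarrow> real \<Rightarrow> real ^ 'n::{finite,linorder}) \<Rightarrow> bool" where
  "near_moment \<epsilon> g \<longleftrightarrow> g 0 \<in> borel_measurable borel \<and>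
     (\<forall>l\<le>CARD('n). \<forall>t\<in>{0..1}. (g l has_vector_derivative g (Suc l) t) (at t within {0..1})) \<and>
     (\<forall>l\<le>CARD('n) + 1. \<forall>t\<in>{0..1}. norm (g l t - moment_deriv l t) \<le> \<epsilon>)"

lemma curves_near_moment_imp_near_moment:
  fixes \<gamma> :: "real \<Rightarrow> real ^ 'n::{finite,linorder}"
  assumes "\<gamma> \<in> curves_near_moment \<epsilon>"
  shows "\<exists>g. near_moment \<epsilon> g \<and> (\<forall>t\<in>{0..1}. g 0 t = \<gamma> t)"
proof -
  let ?I = "{0..1::real}"
  define d where "d = CARD('n)"
  define \<delta> where "\<delta> = (\<lambda>t. \<gamma> t - moment_curve t)"
  have diff: "iter_deriv ?I j \<gamma> differentiable (at t within ?I)" if "j < d + 1" "t \<in> ?I" for j t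
    using assms that by (auto simp: curves_near_moment_def Ck_on_def d_def)
  have cont: "continuous_on ?I (iter_deriv ?I j \<gamma>)" if "j \<le> d + 1" for j
    using assms that by (auto simp: curves_near_moment_def Ck_on_def d_def)
  have norm_le: "Ck_norm (d + 1) ?I \<delta> \<le> \<epsilon>"
    using assms by (auto simp: curves_near_moment_def d_def \<delta>_def)
  have vd: "(iter_deriv ?I j \<gamma> has_vector_derivative iter_deriv ?I (Suc j) \<gamma> t) (at t within ?I)"
    if "j < d + 1" "t \<in> ?I" for j t
    using diff[OF that] by (simp add: vector_derivative_works[symmetric])
  have eq: "\<forall>t\<in>?I. iter_deriv ?I j \<delta> t = iter_deriv ?I j \<gamma> t - moment_deriv j t" if "j \<le> d + 1" for j
    using that
  proof (induction j)
    case 0 then show ?case by (simp add: \<delta>_def moment_deriv_0)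
  next
    case (Suc j)
    show ?case
    proof
      fix t assume t: "t \<in> ?I"
      have "((\<lambda>t. iter_deriv ?I j \<gamma> t - moment_deriv j t) has_vector_derivative
          iter_deriv ?I (Suc j) \<gamma> t - moment_deriv (Suc j) t) (at t within ?I)"
        using Suc.prems t by (intro has_vector_derivative_diff vd moment_deriv_derivative) auto
      then have "(iter_deriv ?I j \<delta> has_vector_derivative
          iter_deriv ?I (Suc j) \<gamma> t - moment_deriv (Suc j) t) (at t within ?I)"
        using Suc t by (intro has_vector_derivative_transform[of t ?I "iter_deriv ?I j \<delta>"]) auto
      then show "iter_deriv ?I (Suc j) \<delta> t = iter_deriv ?I (Suc j) \<gamma> t - moment_deriv (Suc j) t"
        using t by (simp add: vector_derivative_within_closed_interval)
    qed
  qed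
  \<comment> \<open>A supremum of reals bounds its terms only over a bounded set; boundedness comes
    from continuity of the derivatives on the compact interval.\<close>
  have small: "norm (iter_deriv ?I j \<gamma> t - moment_deriv j t) \<le> \<epsilon>" if "j \<le> d + 1" "t \<in> ?I" for j t
  proof -
    have "continuous_on ?I (\<lambda>t. norm (iter_deriv ?I j \<gamma> t - moment_deriv j t))"
      by (intro continuous_intros cont that continuous_on_moment_deriv)
    then have "continuous_on ?I (\<lambda>t. norm (iter_deriv ?I j \<delta> t))"
      using eq[OF that(1)] by (subst continuous_on_cong[OF refl, of _ _ "\<lambda>t. norm (iter_deriv ?I j \<gamma> t - moment_deriv j t)"]) auto
    then have "compact ((\<lambda>t. norm (iter_deriv ?I j \<delta> t)) ` ?I)"
      by (intro compact_continuous_image) auto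
    then have "bdd_above ((\<lambda>t. norm (iter_deriv ?I j \<delta> t)) ` ?I)"
      by (intro bounded_imp_bdd_above compact_imp_bounded)
    then have "norm (iter_deriv ?I j \<delta> t) \<le> (SUP t\<in>?I. norm (iter_deriv ?I j \<delta> t))"
      using that by (intro cSUP_upper) auto
    also have "\<dots> \<le> Ck_norm (d + 1) ?I \<delta>"
      unfolding Ck_norm_def using that by (intro Max_ge) auto
    also note norm_le
    finally show ?thesis using eq that by simp
  qed
  \<comment> \<open>\<open>\<gamma>\<close> is arbitrary outside the interval, so it is cut off by
    the indicator to make \<open>g 0\<close> Borel on the whole line.\<close>
  define g where "g l t = (if l = 0 then indicator ?I t *\<^sub>R \<gamma> t else iter_deriv ?I l \<gamma> t)" for l t
  have g_eq: "g l t = iter_deriv ?I l \<gamma> t" if "t \<in> ?I" for l t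
    using that by (auto simp: g_def)
  have "g 0 \<in> borel_measurable borel"
  proof -
    have "(\<lambda>t. indicator ?I t *\<^sub>R \<gamma> t) \<in> borel_measurable borel"
      using cont[of 0] by (intro borel_measurable_continuous_on_indicator) auto
    then show ?thesis by (simp add: g_def[abs_def])
  qed
  moreover have "(g l has_vector_derivative g (Suc l) t) (at t within ?I)" if "l \<le> d" "t \<in> ?I" for l t
  proof -
    have "(iter_deriv ?I l \<gamma> has_vector_derivative g (Suc l) t) (at t within ?I)"
      using vd[of l t] that by (simp add: g_eq del: iter_deriv.simps)
    then show ?thesis
      using that by (intro has_vector_derivative_transform[of t ?I "g l"]) (auto simp: g_eq)
  qed
  ultimately have "near_moment \<epsilon> g"
    using small by (auto simp: near_moment_def d_def g_eq)
  then show ?thesis by (intro exI[of _ g]) (auto simp: g_def)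
qed

text \<open>By homogeneity it suffices to consider unit vectors, and on the compact product of
  \<open>K\<close> with the unit sphere the positive continuous function \<open>norm (A a x)\<close>
  attains a positive minimum.\<close>

lemma uniform_lower_bound:
  fixes A :: "'a::metric_space \<Rightarrow> real ^ 'n \<Rightarrow> real ^ 'm"
  assumes K: "compact K" and lin: "\<And>a. linear (A a)"
    and cont: "continuous_on (K \<times> UNIV) (\<lambda>z. A (fst z) (snd z))"
    and inj: "\<And>a x. a \<in> K \<Longrightarrow> A a x = 0 \<Longrightarrow> x = 0"
  shows "\<exists>c>0. \<forall>a\<in>K. \<forall>x. c * norm x \<le> norm (A a x)"
proof (cases "K = {}")
  case True then show ?thesis by (intro exI[of _ 1]) auto
next
  case False
  let ?S = "K \<times> sphere (0 :: real ^ 'n) 1"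
  have "compact ?S" by (intro compact_Times K) auto
  moreover have "?S \<noteq> {}" using False by auto
  moreover have "continuous_on ?S (\<lambda>z. norm (A (fst z) (snd z)))"
    by (intro continuous_on_norm continuous_on_subset[OF cont]) auto
  ultimately obtain z where z: "z \<in> ?S" "\<forall>y\<in>?S. norm (A (fst z) (snd z)) \<le> norm (A (fst y) (snd y))"
    using continuous_attains_inf[of ?S "\<lambda>z. norm (A (fst z) (snd z))"] by blast
  define c where "c = norm (A (fst z) (snd z))"
  have "0 < c"
    using z(1) inj[of "fst z" "snd z"] by (auto simp: c_def)
  moreover have "c * norm x \<le> norm (A a x)" if "a \<in> K" for a x
  proof (cases "x = 0")
    case True then show ?thesis by simp
  next
    case False
    have "c \<le> norm (A a (x /\<^sub>R norm x))"
      using bspec[OF z(2), of "(a, x /\<^sub>R norm x)"] that False by (simp add: c_def)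
    also have "\<dots> = norm (A a x) / norm x"
      by (simp add: linear_scale[OF lin] divide_inverse mult.commute)
    finally show ?thesis using False by (simp add: field_simps)
  qed
  ultimately show ?thesis by blast
qed

text \<open>This turns transversality of tangent vectors into a count of roots: the polynomial has
  degree less than the dimension, and up to factorials its coefficients are the coordinates of
  \<open>x\<close>.\<close>

lemma inner_moment_deriv_1_eq_poly:
  fixes x :: "real ^ 'n::{finite,linorder}"
  shows "x \<bullet> moment_deriv 1 t = poly (\<Sum>k\<in>UNIV. monom (x $ k / fact (coord_index k - 1)) (coord_index k - 1)) t"
  using coord_index_ge_1[where 'n='n]
  by (simp add: inner_vec_def moment_deriv_def poly_sum poly_monom)

text \<open>If \<open>x\<close> is orthogonal to the tangents at d distinct points, a polynomial of
  degree less than d has d roots and vanishes. Separation by \<open>h\<close> is a closed condition,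
  so the admissible points form a compact set and the bound becomes uniform, with a constant
  depending on \<open>h\<close>.\<close>

lemma separated_lower_bound:
  assumes h: "0 < h"
  shows "\<exists>c>0. \<forall>s :: real ^ 'n::{finite,linorder}. (\<forall>i. s $ i \<in> {0..1}) \<and> (\<forall>i j. i \<noteq> j \<longrightarrow> h \<le> \<bar>s $ i - s $ j\<bar>)
      \<longrightarrow> (\<forall>x. c * norm x \<le> norm (\<chi> i. x \<bullet> (moment_deriv 1 (s $ i) :: real ^ 'n::{finite,linorder})))"
proof -
  define K where "K = {s :: (real, 'n) vec. (\<forall>i. s $ i \<in> {0..1}) \<and> (\<forall>i j. i \<noteq> j \<longrightarrow> h \<le> \<bar>s $ i - s $ j\<bar>)}"
  define A where "A s x = (\<chi> i. x \<bullet> (moment_deriv 1 (s $ i) :: (real, 'n) vec))" for s x :: "(real, 'n) vec"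
  have "K = cbox 0 1 \<inter> (\<Inter>i. \<Inter>j\<in>-{i}. {s. h \<le> \<bar>s $ i - s $ j\<bar>})"
    by (auto simp: K_def mem_box_cart)
  moreover have "closed {s :: (real, 'n) vec. h \<le> \<bar>s $ i - s $ j\<bar>}" for i j
    by (intro closed_Collect_le continuous_intros)
  ultimately have "compact K"
    by (auto intro!: compact_Int_closed closed_INT)
  moreover have "linear (A s)" for s
    by (rule linearI) (auto simp: A_def vec_eq_iff inner_add_left)
  moreover have "continuous_on (K \<times> UNIV) (\<lambda>z. A (fst z) (snd z))"
    unfolding A_def
    by (intro continuous_on_vec_lambda continuous_intros
        continuous_on_compose2[OF continuous_on_moment_deriv[of UNIV]]) auto
  moreover have "x = 0" if s: "s \<in> K" and x: "A s x = 0" for s x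
  proof -
    define P where "P = (\<Sum>k\<in>UNIV. monom (x $ k / fact (coord_index k - 1)) (coord_index k - 1))"
    have root: "poly P (s $ i) = 0" for i
      using x unfolding P_def inner_moment_deriv_1_eq_poly[symmetric] by (simp add: A_def vec_eq_iff)
    have "inj (\<lambda>i. s $ i)"
      using s h by (force simp: K_def inj_on_def)
    then have card: "card (range (\<lambda>i. s $ i)) = CARD('n)" by (simp add: card_image)
    have "degree P \<le> CARD('n) - 1"
      unfolding P_def
    proof (intro degree_sum_le)
      fix k :: 'n
      show "degree (monom (x $ k / fact (coord_index k - 1)) (coord_index k - 1)) \<le> CARD('n) - 1"
        using coord_index_le[of k] by (intro order_trans[OF degree_monom_le]) simp
    qed simp
    then have "degree P < CARD('n)"
      using zero_less_card_finite[where 'a='n] by linarith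
    have "P = 0"
    proof (rule ccontr)
      assume "P \<noteq> 0"
      then have "card (range (\<lambda>i. s $ i)) \<le> card {t. poly P t = 0}"
        using root by (intro card_mono poly_roots_finite) auto
      also have "\<dots> \<le> degree P" by (rule card_poly_roots_bound[OF \<open>P \<noteq> 0\<close>])
      finally show False using card \<open>degree P < CARD('n)\<close> by simp
    qed
    have "x $ i = 0" for i
    proof -
      have "coord_index k - 1 = coord_index i - 1 \<longleftrightarrow> k = i" for k
        using coord_index_ge_1[of k] coord_index_ge_1[of i] coord_index_eq_iff[of k i] by linarith
      then have "coeff P (coord_index i - 1) = x $ i / fact (coord_index i - 1)"
        by (simp add: P_def coeff_sum)
      then show ?thesis using \<open>P = 0\<close> by simp
    qed
    then show ?thesis by (simp add: vec_eq_iff)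
  qed
  ultimately obtain c where "c > 0" "\<forall>s\<in>K. \<forall>x. c * norm x \<le> norm (A s x)"
    using uniform_lower_bound[of K A] by auto
  then show ?thesis by (auto simp: K_def A_def)
qed

text \<open>The derivatives form a triangular frame with unit diagonal: pairing \<open>x\<close>
  with the derivative belonging to its last nonzero coordinate returns that coordinate. Compactness
  of the interval makes the bound uniform.\<close>

lemma frame_lower_bound:
  "\<exists>c>0. \<forall>t\<in>{0..1}. \<forall>x. c * norm x \<le> norm (\<chi> j::'n::{finite,linorder}. x \<bullet> (moment_deriv (coord_index j) t :: (real, 'n) vec))"
proof (rule uniform_lower_bound)
  show "linear (\<lambda>x. \<chi> j::'n. x \<bullet> (moment_deriv (coord_index j) t :: (real, 'n) vec))" for t
    by (rule linearI) (auto simp: vec_eq_iff inner_add_left)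
  show "continuous_on ({0..1} \<times> UNIV) (\<lambda>z. \<chi> j::'n. snd z \<bullet> (moment_deriv (coord_index j) (fst z) :: (real, 'n) vec))"
    by (intro continuous_on_vec_lambda continuous_intros
        continuous_on_compose2[OF continuous_on_moment_deriv[of UNIV]]) auto
  fix t :: real and x :: "(real, 'n) vec"
  assume x: "(\<chi> j::'n. x \<bullet> (moment_deriv (coord_index j) t :: (real, 'n) vec)) = 0"
  show "x = 0"
  proof (rule ccontr)
    assume "x \<noteq> 0"
    then have ne: "{i. x $ i \<noteq> 0} \<noteq> {}" by (auto simp: vec_eq_iff)
    define m where "m = Max {i. x $ i \<noteq> 0}"
    have m: "x $ m \<noteq> 0"
      using Max_in[OF _ ne] by (simp add: m_def)
    have m2: "x $ i = 0" if "m < i" for i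
    proof (rule ccontr)
      assume "x $ i \<noteq> 0"
      then have "i \<le> m" unfolding m_def by (intro Max_ge) auto
      then show False using that by simp
    qed
    have "x \<bullet> moment_deriv (coord_index m) t = (\<Sum>i\<in>UNIV. if i = m then x $ m else 0)"
      unfolding inner_vec_def
    proof (intro sum.cong refl)
      fix i
      consider "i < m" | "i = m" | "m < i" by fastforce
      then show "x $ i \<bullet> moment_deriv (coord_index m) t $ i = (if i = m then x $ m else 0)"
        using coord_index_less[of i m] by cases (auto simp: moment_deriv_def m2)
    qed
    moreover have "x \<bullet> moment_deriv (coord_index m) t = 0"
      using x by (simp add: vec_eq_iff)
    ultimately show False using m by simp
  qed
qed simp

section \<open>Stability under perturbation, expansion of the phase sum, affine rescaling\<close>

lemma norm_vec_le_card:
  fixes v :: "real ^ 'n"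
  assumes "\<And>i. \<bar>v $ i\<bar> \<le> b"
  shows "norm v \<le> real CARD('n) * b"
proof -
  have "norm v \<le> (\<Sum>i\<in>UNIV. \<bar>v $ i\<bar>)" by (rule norm_le_l1_cart)
  also have "\<dots> \<le> real CARD('n) * b"
    using sum_bounded_above[of UNIV "\<lambda>i. \<bar>v $ i\<bar>" b] assms by simp
  finally show ?thesis .
qed

text \<open>Transfers the two compactness bounds from the moment curve to nearby curves at the price
  of half the constant.\<close>

lemma perturbed_lower_bound:
  fixes a b :: "'m::finite \<Rightarrow> real ^ 'n" and x :: "real ^ 'n"
  assumes "c * norm x \<le> norm (\<chi> i. x \<bullet> a i)" and "\<And>i. norm (b i - a i) \<le> \<epsilon>"
    and "real CARD('m) * \<epsilon> \<le> c / 2"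
  shows "c / 2 * norm x \<le> norm (\<chi> i. x \<bullet> b i)"
proof -
  have "norm (\<chi> i. x \<bullet> (b i - a i)) \<le> real CARD('m) * (norm x * \<epsilon>)"
  proof (rule norm_vec_le_card)
    fix i
    have "\<bar>x \<bullet> (b i - a i)\<bar> \<le> norm x * norm (b i - a i)" by (rule Cauchy_Schwarz_ineq2)
    also have "\<dots> \<le> norm x * \<epsilon>" by (intro mult_left_mono assms) auto
    finally show "\<bar>(\<chi> i. x \<bullet> (b i - a i)) $ i\<bar> \<le> norm x * \<epsilon>" by simp
  qed
  also have "\<dots> \<le> c / 2 * norm x"
    using mult_right_mono[OF assms(3), of "norm x"] by (simp add: mult_ac)
  moreover have "norm (\<chi> i. x \<bullet> a i) \<le> norm (\<chi> i. x \<bullet> b i) + norm (\<chi> i. x \<bullet> (b i - a i))"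
  proof -
    have "(\<chi> i. x \<bullet> a i) = (\<chi> i. x \<bullet> b i) - (\<chi> i. x \<bullet> (b i - a i))"
      by (simp add: vec_eq_iff inner_diff_right)
    then show ?thesis by (metis norm_triangle_ineq4)
  qed
  ultimately show ?thesis using assms(1) by (simp add: algebra_simps)
qed

text \<open>A square matrix and its transpose have the same least singular value. Concretely, solve
  \<open>transpose A *v x = v\<close> and estimate
  \<open>v \<bullet> v = x \<bullet> (A *v v)\<close> by Cauchy-Schwarz.\<close>

lemma transpose_lower_bound:
  fixes A :: "real ^ 'n ^ 'n"
  assumes c: "0 < c" and A: "\<And>x. c * norm x \<le> norm (transpose A *v x)"
  shows "c * norm v \<le> norm (A *v v)"
proof (cases "v = 0")
  case False
  have "inj ((*v) (transpose A))"
    unfolding linear_injective_0[OF matrix_vector_mul_linear]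
    using A c by (metis mult_pos_pos norm_le_zero_iff norm_zero not_le zero_less_norm_iff)
  then have "surj ((*v) (transpose A))"
    by (intro linear_injective_imp_surjective matrix_vector_mul_linear) auto
  then obtain x where x: "transpose A *v x = v" by (metis surjD)
  have "norm v * norm v = v \<bullet> v" by (simp add: power2_norm_eq_inner[symmetric] power2_eq_square)
  also have "\<dots> = x \<bullet> (A *v v)" by (subst x[symmetric]) (simp add: dot_lmul_matrix[symmetric] transpose_matrix_vector)
  also have "\<dots> \<le> norm x * norm (A *v v)" by (rule norm_cauchy_schwarz)
  also have "\<dots> \<le> norm v / c * norm (A *v v)"
    using A[of x] x c by (intro mult_right_mono) (auto simp: field_simps)
  finally have "c * norm v * norm v \<le> norm (A *v v) * norm v"
    using c by (simp add: field_simps)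
  then show ?thesis using False by simp
qed simp

text \<open>The difference of the sums is \<open>A *v (s - t)\<close>, where the columns of
  \<open>A\<close> are difference quotients of the curve. The mean value theorem fails for vectors,
  but after pairing with a fixed \<open>x\<close> each quotient may be replaced by a tangent at some
  point of \<open>J i\<close> that depends on \<open>x\<close>; hence the transpose of
  \<open>A\<close> is bounded below, and so is \<open>A\<close>.\<close>

lemma phase_sum_expanding:
  fixes g :: "nat \<Rightarrow> real \<Rightarrow> real ^ 'n::{finite,linorder}" and J :: "'n \<Rightarrow> real set"
  assumes g: "near_moment \<epsilon> g"
    and c: "0 < c"
    and sep: "\<And>s x. (\<And>i. s $ i \<in> J i) \<Longrightarrow> c * norm x \<le> norm (\<chi> i. x \<bullet> (moment_deriv 1 (s $ i) :: (real, 'n) vec))"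
    and \<epsilon>: "real CARD('n) * \<epsilon> \<le> c / 2"
    and J: "\<And>i. is_interval (J i)" "\<And>i. J i \<subseteq> {0..1}"
    and s: "\<And>i. s $ i \<in> J i" and t: "\<And>i. t $ i \<in> J i"
  shows "c / 2 * norm (s - t) \<le> norm ((\<Sum>i\<in>UNIV. g 0 (s $ i)) - (\<Sum>i\<in>UNIV. g 0 (t $ i)))"
proof -
  have der: "(g 0 has_vector_derivative g 1 \<tau>) (at \<tau> within {0..1})" if "\<tau> \<in> {0..1}" for \<tau>
    using g that by (auto simp: near_moment_def)
  \<comment> \<open>Where the two parameters coincide any value satisfies the identity below; the
    tangent is the one that keeps \<open>mean\<close> true.\<close>
  define a where "a i = (if s $ i = t $ i then g 1 (s $ i) else (g 0 (s $ i) - g 0 (t $ i)) /\<^sub>R (s $ i - t $ i))" for i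
  define A :: "((real, 'n) vec, 'n) vec" where "A = (\<chi> k i. a i $ k)"
  have mean: "\<exists>\<tau>\<in>J i. x \<bullet> a i = x \<bullet> g 1 \<tau>" for x i
  proof -
    have aux: "\<exists>\<tau>\<in>J i. x \<bullet> (g 0 v - g 0 u) = (v - u) * (x \<bullet> g 1 \<tau>)" if uv: "u < v" "u \<in> J i" "v \<in> J i" for u v
    proof -
      have sub: "{u..v} \<subseteq> J i"
        using J(1)[of i] uv(2,3) unfolding is_interval_1 by fastforce
      have "((\<lambda>\<tau>. x \<bullet> g 0 \<tau>) has_derivative (\<lambda>h. h * (x \<bullet> g 1 \<tau>))) (at \<tau> within {u..v})" if "u \<le> \<tau>" "\<tau> \<le> v" for \<tau>
      proof -
        have *: "{u..v} \<subseteq> {0..1}" using sub J(2)[of i] by blast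
        then have "\<tau> \<in> {0..1}" using that by (meson atLeastAtMost_iff subsetD)
        then have "(g 0 has_vector_derivative g 1 \<tau>) (at \<tau> within {u..v})"
          using * der has_vector_derivative_within_subset by blast
        then show ?thesis
          unfolding has_vector_derivative_def by (auto intro!: derivative_eq_intros)
      qed
      from mvt_simple[OF uv(1) this] obtain \<tau> where "\<tau> \<in> {u<..<v}" "x \<bullet> g 0 v - x \<bullet> g 0 u = (v - u) * (x \<bullet> g 1 \<tau>)"
        by auto
      then show ?thesis using sub by (intro bexI[of _ \<tau>]) (auto simp: inner_diff_right)
    qed
    consider "s $ i = t $ i" | "s $ i < t $ i" | "t $ i < s $ i" by linarith
    then show ?thesis
    proof cases
      case 1 then show ?thesis using s[of i] by (auto simp: a_def)
    next
      case 2
      from aux[OF 2 s t] obtain \<tau> where \<tau>: "\<tau> \<in> J i" "x \<bullet> (g 0 (t $ i) - g 0 (s $ i)) = (t $ i - s $ i) * (x \<bullet> g 1 \<tau>)" by auto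
      then have "x \<bullet> (g 0 (s $ i) - g 0 (t $ i)) = (s $ i - t $ i) * (x \<bullet> g 1 \<tau>)"
        unfolding inner_diff_right by (simp add: algebra_simps)
      then have "x \<bullet> a i = x \<bullet> g 1 \<tau>"
        using 2 by (simp add: a_def)
      then show ?thesis using \<tau> by auto
    next
      case 3
      from aux[OF 3 t s] obtain \<tau> where \<tau>: "\<tau> \<in> J i" "x \<bullet> (g 0 (s $ i) - g 0 (t $ i)) = (s $ i - t $ i) * (x \<bullet> g 1 \<tau>)" by auto
      then have "x \<bullet> a i = x \<bullet> g 1 \<tau>"
        using 3 by (simp add: a_def)
      then show ?thesis using \<tau> by auto
    qed
  qed
  have A_lower: "c / 2 * norm x \<le> norm (transpose A *v x)" for x
  proof -
    from mean[of _ x] obtain \<tau> where \<tau>: "\<And>i. \<tau> i \<in> J i" "\<And>i. x \<bullet> a i = x \<bullet> g 1 (\<tau> i)" by metis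
    have "transpose A *v x = (\<chi> i. x \<bullet> a i)"
      by (simp add: vec_eq_iff matrix_vector_mult_def transpose_def A_def inner_vec_def mult.commute)
    then have "transpose A *v x = (\<chi> i. x \<bullet> g 1 (\<tau> i))" by (simp only: \<tau>(2))
    moreover have "c / 2 * norm x \<le> norm (\<chi> i. x \<bullet> g 1 (\<tau> i))"
    proof (rule perturbed_lower_bound)
      show "c * norm x \<le> norm (\<chi> i. x \<bullet> (moment_deriv 1 (\<tau> i) :: (real, 'n) vec))"
        using sep[of "\<chi> i. \<tau> i" x] \<tau>(1) by simp
      show "norm (g 1 (\<tau> i) - moment_deriv 1 (\<tau> i)) \<le> \<epsilon>" for i
        using g \<tau>(1)[of i] J(2)[of i] by (auto simp: near_moment_def)
    qed (rule \<epsilon>)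
    ultimately show ?thesis by simp
  qed
  have "c / 2 * norm (s - t) \<le> norm (A *v (s - t))"
    by (rule transpose_lower_bound[OF _ A_lower]) (use c in simp)
  also have "A *v (s - t) = (\<Sum>i\<in>UNIV. g 0 (s $ i)) - (\<Sum>i\<in>UNIV. g 0 (t $ i))"
  proof -
    have "(s $ i - t $ i) *\<^sub>R a i = g 0 (s $ i) - g 0 (t $ i)" for i
      by (simp add: a_def)
    then have "(s $ i - t $ i) * a i $ k = (g 0 (s $ i) - g 0 (t $ i)) $ k" for i k
      by (metis vector_scaleR_component real_scaleR_def)
    then show ?thesis
      by (simp add: vec_eq_iff matrix_vector_mult_def A_def sum_subtractf[symmetric] mult.commute)
  qed
  finally show ?thesis .
qed

text \<open>In the frame of derivatives at \<open>t0\<close>, with coordinate j dilated by the j-th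
  power of \<open>1 / h\<close>, the piece has the derivatives of the moment curve at 0 through
  order d. Only the derivative of order d + 1 carries an error, and it gains a factor
  \<open>h\<close>. The condition on \<open>h\<close> makes this gain outweigh the change of frame,
  so the same \<open>\<epsilon>\<close> is recovered.\<close>

lemma rescaled_near_moment:
  fixes g :: "nat \<Rightarrow> real \<Rightarrow> real ^ 'n::{finite,linorder}"
  assumes g: "near_moment \<epsilon> g"
    and c: "0 < c" and frame: "\<And>x. c * norm x \<le> norm (\<chi> j::'n. x \<bullet> (moment_deriv (coord_index j) t0 :: (real, 'n) vec))"
    and \<epsilon>: "0 \<le> \<epsilon>" "real CARD('n) * \<epsilon> \<le> c / 2"
    and h: "0 < h" "h \<le> 1" "real CARD('n) * (2 / c) * h \<le> 1"
    and t0: "0 \<le> t0" "t0 + h \<le> 1"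
  shows "\<exists>g'. near_moment \<epsilon> g' \<and> (\<forall>x s. x \<bullet> (g 0 (t0 + h * s) - g 0 t0)
           = (\<chi> j::'n. h ^ coord_index j * (x \<bullet> g (coord_index j) t0)) \<bullet> g' 0 s)"
proof -
  define M :: "((real, 'n) vec, 'n) vec" where "M = (\<chi> k j. g (coord_index j) t0 $ k)"
  have MT: "transpose M *v x = (\<chi> j::'n. x \<bullet> g (coord_index j) t0)" for x
    by (simp add: vec_eq_iff matrix_vector_mult_def transpose_def M_def inner_vec_def mult.commute)
  have M_lower: "c / 2 * norm x \<le> norm (transpose M *v x)" for x
    unfolding MT
  proof (rule perturbed_lower_bound[OF frame _ \<epsilon>(2)])
    show "norm (g (coord_index j) t0 - moment_deriv (coord_index j) t0) \<le> \<epsilon>" for j :: 'n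
      using g coord_index_le[of j] t0 h by (auto simp: near_moment_def)
  qed
  have lower: "c / 2 * norm v \<le> norm (M *v v)" for v
    by (rule transpose_lower_bound[OF _ M_lower]) (use c in simp)
  then have "inj ((*v) M)"
    unfolding linear_injective_0[OF matrix_vector_mul_linear] using c
    by (metis divide_pos_pos mult_pos_pos norm_le_zero_iff norm_zero not_le zero_less_norm_iff zero_less_numeral)
  then have "invertible M" by (simp add: invertible_left_inverse matrix_left_invertible_injective)
  then obtain W where W: "M ** W = mat 1" "W ** M = mat 1"
    by (auto simp: invertible_def)
  have MW: "M *v (W *v w) = w" for w
    by (simp add: matrix_vector_mul_assoc W)
  have W_axis: "W *v g (coord_index j) t0 = axis j 1" for j
  proof -
    have "g (coord_index j) t0 = M *v axis j 1"
      by (simp add: matrix_vector_mul_component vec_eq_iff matrix_vector_mult_basis column_def M_def)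
    then show ?thesis by (simp add: matrix_vector_mul_assoc W)
  qed
  have W_bound: "norm (W *v w) \<le> 2 / c * norm w" for w
    using lower[of "W *v w"] c by (simp add: MW field_simps)
  \<comment> \<open>\<open>W\<close> passes to coordinates in the frame at \<open>t0\<close>;
    division by \<open>h ^ coord_index j\<close> is the dilation, and \<open>h ^ l\<close> is the
    chain-rule factor of the l-th derivative.\<close>
  define D :: "nat \<Rightarrow> (real, 'n) vec \<Rightarrow> (real, 'n) vec" where "D l v = (\<chi> j::'n. h ^ l / h ^ coord_index j * (W *v v) $ j)" for l v
  have D_lin: "linear (D l)" for l
    by (rule linearI) (auto simp: D_def vec_eq_iff matrix_vector_right_distrib algebra_simps matrix_vector_mult_scaleR)
  then have D_bl: "bounded_linear (D l)" for l by (rule linear_conv_bounded_linear[THEN iffD1])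
  define g' where "g' l s = D l (g l (t0 + h * s) - (if l = 0 then g 0 t0 else 0))" for l s
  have dom: "t0 + h * s \<in> {0..1}" if "s \<in> {0..1}" for s
  proof -
    have "h * s \<le> h" "0 \<le> h * s" using that h by (auto intro: mult_left_le)
    then show ?thesis using t0 unfolding atLeastAtMost_iff by linarith
  qed
  have inner: "x \<bullet> (g 0 (t0 + h * s) - g 0 t0)
      = (\<chi> j::'n. h ^ coord_index j * (x \<bullet> g (coord_index j) t0)) \<bullet> g' 0 s" for x s
  proof -
    define w where "w = g 0 (t0 + h * s) - g 0 t0"
    have "(\<chi> j::'n. h ^ coord_index j * (x \<bullet> g (coord_index j) t0)) \<bullet> g' 0 s = (transpose M *v x) \<bullet> (W *v w)"
      unfolding MT g'_def D_def inner_vec_def using h by (simp add: w_def)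
    also have "\<dots> = x \<bullet> (M *v (W *v w))"
      by (simp add: dot_lmul_matrix[symmetric] transpose_matrix_vector)
    finally show ?thesis by (simp add: MW w_def)
  qed
  have deriv: "(g' l has_vector_derivative g' (Suc l) s) (at s within {0..1})"
    if "l \<le> CARD('n)" "s \<in> {0..1}" for l s
  proof -
    have aff: "((\<lambda>s. t0 + h * s) has_vector_derivative h) (at s within {0..1})"
      unfolding has_real_derivative_iff_has_vector_derivative[symmetric]
      by (auto intro!: derivative_eq_intros)
    have "(g l has_vector_derivative g (Suc l) (t0 + h * s)) (at (t0 + h * s) within {0..1})"
      using g that dom by (auto simp: near_moment_def)
    then have "(g l has_vector_derivative g (Suc l) (t0 + h * s)) (at (t0 + h * s) within (\<lambda>s. t0 + h * s) ` {0..1})"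
      by (rule has_vector_derivative_within_subset) (use dom in auto)
    from vector_diff_chain_within[OF aff this]
    have "((\<lambda>s. g l (t0 + h * s) - (if l = 0 then g 0 t0 else 0)) has_vector_derivative
        h *\<^sub>R g (Suc l) (t0 + h * s)) (at s within {0..1})"
      by (auto simp: o_def intro!: derivative_eq_intros)
    from bounded_linear.has_vector_derivative[OF D_bl[of l] this]
    have "(g' l has_vector_derivative D l (h *\<^sub>R g (Suc l) (t0 + h * s))) (at s within {0..1})"
      by (simp add: g'_def[abs_def])
    also have "D l (h *\<^sub>R g (Suc l) (t0 + h * s)) = g' (Suc l) s"
      by (simp add: g'_def D_def vec_eq_iff matrix_vector_mult_scaleR)
    finally show ?thesis .
  qed
  define e where "e l s = g' l s - moment_deriv l s" for l s
  have e_deriv: "(e l has_vector_derivative e (Suc l) s) (at s within {0..1})"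
    if "l \<le> CARD('n)" "s \<in> {0..1}" for l s
    unfolding e_def[abs_def] by (intro has_vector_derivative_diff deriv that moment_deriv_derivative)
  \<comment> \<open>The frame vectors are sent to unit vectors and the powers of \<open>h\<close>
    cancel, which reproduces the derivatives of the moment curve at 0. For order 0 both curves start
    at the origin.\<close>
  have e_0: "e l 0 = 0" if l: "l \<le> CARD('n)" for l
  proof (cases "l = 0")
    case True
    moreover have "coord_index i \<noteq> 0" for i :: 'n using coord_index_ge_1[of i] by linarith
    ultimately show ?thesis
      by (auto simp: e_def g'_def vec_eq_iff moment_deriv_at_0 linear_0[OF D_lin])
  next
    case False
    then have "l \<in> range (coord_index :: 'n \<Rightarrow> nat)" using l by (auto simp: range_coord_index)
    then obtain j :: 'n where j: "l = coord_index j" by auto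
    then show ?thesis
      using False h by (auto simp: e_def g'_def D_def vec_eq_iff moment_deriv_at_0 W_axis axis_def)
  qed
  \<comment> \<open>The derivative of order d + 1 of the moment curve vanishes, so the error is the
    rescaled derivative itself; every coordinate keeps at least one factor \<open>h\<close>, since
    \<open>coord_index j\<close> is at most d.\<close>
  have e_top: "norm (e (CARD('n) + 1) s) \<le> \<epsilon>" if s: "s \<in> {0..1}" for s
  proof -
    define v where "v = g (CARD('n) + 1) (t0 + h * s)"
    have "norm (v - moment_deriv (CARD('n) + 1) (t0 + h * s)) \<le> \<epsilon>"
      using g dom[OF s] unfolding v_def near_moment_def by blast
    then have v: "norm v \<le> \<epsilon>" by (simp add: moment_deriv_top)
    have "norm (e (CARD('n) + 1) s) = norm (D (CARD('n) + 1) v)"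
      by (simp add: e_def g'_def v_def moment_deriv_top)
    also have "\<dots> \<le> real CARD('n) * (h * (2 / c * \<epsilon>))"
    proof (rule norm_vec_le_card)
      fix j :: 'n
      have "h ^ (CARD('n) + 1) = h ^ (CARD('n) + 1 - coord_index j) * h ^ coord_index j"
        using coord_index_le[of j] by (simp add: power_add[symmetric])
      then have "h ^ (CARD('n) + 1) / h ^ coord_index j = h ^ (CARD('n) + 1 - coord_index j)"
        using h by simp
      also have "\<dots> \<le> h ^ 1"
        using h coord_index_le[of j] by (intro power_decreasing) auto
      finally have "h ^ (CARD('n) + 1) / h ^ coord_index j \<le> h" by simp
      moreover have "\<bar>(W *v v) $ j\<bar> \<le> 2 / c * \<epsilon>"
        using component_le_norm_cart[of "W *v v" j] W_bound[of v] mult_left_mono[OF v, of "2 / c"] c by simp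
      ultimately show "\<bar>D (CARD('n) + 1) v $ j\<bar> \<le> h * (2 / c * \<epsilon>)"
        using h unfolding D_def vec_lambda_beta abs_mult by (intro mult_mono) auto
    qed
    also have "\<dots> = (real CARD('n) * (2 / c) * h) * \<epsilon>" by simp
    also have "\<dots> \<le> 1 * \<epsilon>" by (intro mult_right_mono h \<epsilon>)
    finally show ?thesis by simp
  qed
  \<comment> \<open>Descending induction on the order: each error vanishes at 0 and its derivative
    is at most \<open>\<epsilon>\<close> on an interval of length 1.\<close>
  have "\<forall>s\<in>{0..1}. norm (e (CARD('n) + 1 - k) s) \<le> \<epsilon>" for k
  proof (induction k)
    case 0 then show ?case using e_top by simp
  next
    case (Suc k)
    show ?case
    proof (cases "k \<le> CARD('n)")
      case False
      then show ?thesis using Suc by simp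
    next
      case True
      define l where "l = CARD('n) - k"
      have l: "CARD('n) + 1 - Suc k = l" "CARD('n) + 1 - k = Suc l" "l \<le> CARD('n)"
        using True by (auto simp: l_def)
      show ?thesis
        unfolding l(1)
      proof
        fix s :: real assume s: "s \<in> {0..1}"
        have "norm (e l s - e l 0) \<le> \<epsilon> * norm (s - 0)"
        proof (rule differentiable_bound[where S="{0..1}" and f'="\<lambda>t h. h *\<^sub>R e (Suc l) t"])
          show "(e l has_derivative (\<lambda>h. h *\<^sub>R e (Suc l) t)) (at t within {0..1})" if "t \<in> {0..1}" for t
            using e_deriv[OF l(3) that] by (simp add: has_vector_derivative_def)
          show "onorm (\<lambda>h. h *\<^sub>R e (Suc l) t) \<le> \<epsilon>" if "t \<in> {0..1}" for t
            using Suc that unfolding l(2)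
            by (intro onorm_le) (auto simp: mult.commute[of \<epsilon>] intro!: mult_left_mono)
        qed (use s in auto)
        also have "\<dots> \<le> \<epsilon> * 1" using s \<epsilon> by (intro mult_left_mono) auto
        finally show "norm (e l s) \<le> \<epsilon>" by (simp add: e_0[OF l(3)])
      qed
    qed
  qed
  then have e_small: "norm (e l s) \<le> \<epsilon>" if "l \<le> CARD('n) + 1" "s \<in> {0..1}" for l s
    using that by (metis diff_diff_cancel)
  have "g' 0 \<in> borel_measurable borel"
  proof -
    have [measurable]: "g 0 \<in> borel_measurable borel" using g by (simp add: near_moment_def)
    have [measurable]: "D 0 \<in> borel_measurable borel"
      by (intro borel_measurable_continuous_onI linear_continuous_on D_bl)
    show ?thesis unfolding g'_def[abs_def] by measurable
  qed
  then have "near_moment \<epsilon> g'"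
    using deriv e_small by (auto simp: near_moment_def e_def)
  then show ?thesis using inner by blast
qed

section \<open>Rescaled measures\<close>

text \<open>The source of the quadratic term of \<open>\<beta>(\<alpha>)\<close>. Truncated
  subtraction assigns a single cell to every coordinate with index at most \<open>m\<close>.\<close>

lemma card_covering_cells:
  assumes "m \<le> CARD('n::{finite,linorder})"
  shows "real (card (Pi\<^sub>E (UNIV :: 'n set) (\<lambda>k. {..<N ^ (coord_index k - m)})))
    = real N ^ ((CARD('n) - m) * (CARD('n) - m + 1) div 2)"
proof -
  have "(\<Sum>k\<in>(UNIV :: 'n set). coord_index k - m) = (\<Sum>k=1..CARD('n). k - m)"
    by (rule sum_coord_index)
  also have "\<dots> = (\<Sum>k=m+1..CARD('n). k - m)"
    by (rule sum.mono_neutral_right) auto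
  also have "\<dots> = (\<Sum>k=1..CARD('n) - m. k)"
    by (rule sum.reindex_bij_witness[of _ "\<lambda>k. k + m" "\<lambda>k. k - m"]) auto
  also have "\<dots> = (CARD('n) - m) * (CARD('n) - m + 1) div 2"
    using gauss_sum_from_Suc_0[of "CARD('n) - m", where 'a=nat] by simp
  finally show ?thesis
    by (simp add: card_PiE power_sum[symmetric])
qed

text \<open>In the frame \<open>v\<close> the preimage is contained in a box with sides comparable
  to \<open>\<rho>\<close> times the k-th power of N. It is covered by balls of radius comparable to
  \<open>\<rho>\<close> times the m-th power of N: long sides need many balls, the sides with
  \<open>k \<le> m\<close> only one. Any \<open>m\<close> is admissible here; the choice that yields
  \<open>\<beta>(\<alpha>)\<close> is made in \<open>beta_exponent_eq\<close>.\<close>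

lemma rescaled_ball_measure:
  fixes v :: "'n::{finite,linorder} \<Rightarrow> (real, 'n) vec"
  assumes \<mu>: "\<mu> \<in> frostman_measures \<alpha> 1"
    and c: "0 < c" and frame: "\<And>x. c * norm x \<le> norm (\<chi> j. x \<bullet> v j)"
    and N: "1 \<le> N" and m: "m \<le> CARD('n)" and \<alpha>: "0 < \<alpha>" and \<rho>: "0 < \<rho>"
  shows "emeasure \<mu> {x. (\<chi> j. (1 / real N) ^ coord_index j * (x \<bullet> v j)) \<in> ball y \<rho>}
    \<le> ennreal ((3 * real CARD('n) / c) powr \<alpha> *
        real N powr (real m * \<alpha> + (real CARD('n) - real m) * (real CARD('n) - real m + 1) / 2) * \<rho> powr \<alpha>)"
proof -
  define d where "d = real CARD('n)"
  have d: "0 < d" by (simp add: d_def)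
  define I where "I = Pi\<^sub>E (UNIV :: 'n set) (\<lambda>k. {..<N ^ (coord_index k - m)})"
  have finI: "finite I" unfolding I_def by (intro finite_PiE) auto
  define B where "B = {x. (\<chi> j. (1 / real N) ^ coord_index j * (x \<bullet> v j)) \<in> ball y \<rho>}"
  \<comment> \<open>\<open>u\<close> shifts the k-th coordinate so that it is positive on
    \<open>B\<close> and \<open>nat\<close> of the floor loses nothing; \<open>w\<close> is the
    width of a cell when the side is cut into \<open>N ^ (coord_index k - m)\<close> equal
    parts.\<close>
  define u where "u x k = x \<bullet> v k - y $ k * real N ^ coord_index k + \<rho> * real N ^ coord_index k" for x k
  define w where "w k = 2 * \<rho> * real N ^ coord_index k / real N ^ (coord_index k - m)" for k :: 'n
  \<comment> \<open>Two points of one cell satisfy the estimate with 2 in place of 3; the larger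
    factor gives the strict inequality needed for open balls.\<close>
  define r where "r = 3 * d * \<rho> * real N ^ m / c"
  have N0: "0 < real N" using N by simp
  have w0: "0 < w k" for k using \<rho> N0 by (simp add: w_def)
  have w_le: "w k \<le> 2 * \<rho> * real N ^ m" for k
  proof (cases "m \<le> coord_index k")
    case True
    then have "real N ^ coord_index k = real N ^ (coord_index k - m) * real N ^ m"
      by (simp add: power_add[symmetric])
    then show ?thesis using N0 by (simp add: w_def)
  next
    case False
    then show ?thesis using \<rho> N by (auto simp: w_def intro!: mult_left_mono power_increasing)
  qed
  have r0: "0 < r" using d \<rho> N0 c by (simp add: r_def)
  define n where "n x k = nat \<lfloor>u x k / w k\<rfloor>" for x k
  have u_range: "0 < u x k" "u x k < 2 * \<rho> * real N ^ coord_index k" if "x \<in> B" for x k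
  proof -
    have "\<bar>y $ k - (1 / real N) ^ coord_index k * (x \<bullet> v k)\<bar> \<le> norm (y - (\<chi> j. (1 / real N) ^ coord_index j * (x \<bullet> v j)))"
      using component_le_norm_cart[of "y - (\<chi> j. (1 / real N) ^ coord_index j * (x \<bullet> v j))" k] by simp
    also have "\<dots> < \<rho>" using that by (simp add: B_def dist_norm)
    finally have 1: "\<bar>y $ k - (1 / real N) ^ coord_index k * (x \<bullet> v k)\<bar> < \<rho>" .
    have "y $ k * real N ^ coord_index k - x \<bullet> v k = (y $ k - (1 / real N) ^ coord_index k * (x \<bullet> v k)) * real N ^ coord_index k"
      using N0 by (simp add: algebra_simps power_one_over)
    then have "\<bar>y $ k * real N ^ coord_index k - x \<bullet> v k\<bar> < \<rho> * real N ^ coord_index k"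
      using mult_strict_right_mono[OF 1, of "real N ^ coord_index k"] N0 by (simp add: abs_mult)
    then have 2: "y $ k * real N ^ coord_index k - x \<bullet> v k < \<rho> * real N ^ coord_index k"
      "- (\<rho> * real N ^ coord_index k) < y $ k * real N ^ coord_index k - x \<bullet> v k"
      by (simp_all only: abs_less_iff) linarith
    show "0 < u x k" using 2(1) by (simp add: u_def)
    show "u x k < 2 * \<rho> * real N ^ coord_index k"
    proof -
      have "2 * \<rho> * real N ^ coord_index k = \<rho> * real N ^ coord_index k + \<rho> * real N ^ coord_index k" by simp
      then show ?thesis using 2(2) unfolding u_def by linarith
    qed
  qed
  have n_I: "n x \<in> I" if "x \<in> B" for x
  proof -
    have "n x k < N ^ (coord_index k - m)" for k
    proof -
      have "u x k / w k < real N ^ (coord_index k - m)"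
        using u_range[OF that, of k] \<rho> N0 by (simp add: w_def field_simps)
      then have "\<lfloor>u x k / w k\<rfloor> < int (N ^ (coord_index k - m))"
        by (simp add: floor_less_iff)
      then show ?thesis unfolding n_def by (subst nat_less_iff) (use u_range[OF that, of k] w0[of k] in auto)
    qed
    then show ?thesis by (auto simp: I_def)
  qed
  have close: "dist x x' < r" if "x \<in> B" "x' \<in> B" "n x = n x'" for x x'
  proof -
    have "\<bar>(x - x') \<bullet> v k\<bar> \<le> 2 * \<rho> * real N ^ m" for k
    proof -
      have "n x k = n x' k" using that by simp
      then have "\<lfloor>u x k / w k\<rfloor> = \<lfloor>u x' k / w k\<rfloor>"
        using u_range(1)[OF that(1), of k] u_range(1)[OF that(2), of k] w0[of k]
        by (simp add: n_def eq_nat_nat_iff)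
      then have "\<bar>u x k / w k - u x' k / w k\<bar> < 1" by linarith
      then have "\<bar>u x k - u x' k\<bar> < w k"
        using w0[of k] by (simp add: diff_divide_distrib[symmetric] field_simps)
      then show ?thesis using w_le[of k] by (simp add: u_def inner_diff_left)
    qed
    then have "norm (\<chi> k. (x - x') \<bullet> v k) \<le> d * (2 * \<rho> * real N ^ m)"
      unfolding d_def by (intro norm_vec_le_card) simp
    with frame[of "x - x'"] have "c * dist x x' \<le> 2 * d * \<rho> * real N ^ m" by (simp add: dist_norm mult_ac)
    also have "\<dots> < 3 * d * \<rho> * real N ^ m" using d \<rho> N0 by simp
    finally show ?thesis using c by (simp add: r_def field_simps)
  qed
  \<comment> \<open>A point of \<open>B\<close> in the cell serves as centre; for an empty cell the
    centre is arbitrary, which does no harm to a covering.\<close>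
  define p where "p k = (SOME x. x \<in> B \<and> n x = k)" for k
  have p: "p (n x) \<in> B \<and> n (p (n x)) = n x" if "x \<in> B" for x
    unfolding p_def using that by (rule_tac someI[of "\<lambda>z. z \<in> B \<and> n z = n x"]) simp
  have "B \<subseteq> (\<Union>k\<in>I. ball (p k) r)"
  proof
    fix x assume "x \<in> B"
    then show "x \<in> (\<Union>k\<in>I. ball (p k) r)"
      using n_I[of x] p[of x] close[of "p (n x)" x] by auto
  qed
  moreover have sets: "sets \<mu> = sets borel" and fr: "\<And>x. emeasure \<mu> (ball x r) \<le> ennreal (r powr \<alpha>)"
    using \<mu> r0 by (auto simp: frostman_measures_def)
  ultimately have "emeasure \<mu> B \<le> emeasure \<mu> (\<Union>k\<in>I. ball (p k) r)"
    using finI by (intro emeasure_mono) (auto simp: sets)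
  also have "\<dots> \<le> (\<Sum>k\<in>I. emeasure \<mu> (ball (p k) r))"
    using finI by (intro emeasure_subadditive_finite) (auto simp: sets)
  also have "\<dots> \<le> (\<Sum>k\<in>I. ennreal (r powr \<alpha>))"
    by (intro sum_mono fr)
  also have "\<dots> = ennreal (real (card I) * r powr \<alpha>)"
    by (simp add: ennreal_mult' ennreal_of_nat_eq_real_of_nat)
  also have "real (card I) * r powr \<alpha> = (3 * real CARD('n) / c) powr \<alpha> *
        real N powr (real m * \<alpha> + (real CARD('n) - real m) * (real CARD('n) - real m + 1) / 2) * \<rho> powr \<alpha>"
  proof -
    have "r = (3 * d / c) * real N ^ m * \<rho>" by (simp add: r_def)
    then have "r powr \<alpha> = (3 * d / c) powr \<alpha> * real N powr (real m * \<alpha>) * \<rho> powr \<alpha>"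
      using d c N0 \<rho> by (simp only: powr_mult powr_realpow[OF N0, symmetric] powr_powr)
    moreover have "real (card I) = real N powr ((real CARD('n) - real m) * (real CARD('n) - real m + 1) / 2)"
    proof -
      define k where "k = CARD('n) - m"
      have "even (k * (k + 1))" by simp
      then have "real (k * (k + 1) div 2) = real (k * (k + 1)) / real 2"
        by (rule real_of_nat_div)
      then have 1: "real (k * (k + 1) div 2) = real k * (real k + 1) / 2"
        by (simp only: of_nat_mult of_nat_add of_nat_1 of_nat_numeral)
      have 2: "real k = real CARD('n) - real m" using m by (simp add: k_def)
      show ?thesis
        by (simp only: I_def card_covering_cells[OF m] k_def[symmetric] powr_realpow[OF N0, symmetric] 1 2)
    qed
    ultimately show ?thesis by (simp add: powr_add d_def mult_ac)
  qed
  finally show ?thesis by (simp add: B_def)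
qed

text \<open>The image measure divided by \<open>\<kappa>\<close> is again in the class by
  \<open>rescaled_ball_measure\<close>. The condition \<open>1 \<le> \<kappa>\<close> ensures that
  the division does not enlarge the total mass, so the cap \<open>V\<close> survives.\<close>

lemma rescaled_measure:
  fixes v :: "'n::{finite,linorder} \<Rightarrow> (real, 'n) vec"
  assumes \<mu>: "\<mu> \<in> frostman_measures \<alpha> 1" and mass: "emeasure \<mu> UNIV \<le> V"
    and c: "0 < c" and frame: "\<And>x. c * norm x \<le> norm (\<chi> j. x \<bullet> v j)"
    and N: "1 \<le> N" and m: "m \<le> CARD('n)" and \<alpha>: "0 < \<alpha>"
    and \<kappa>: "\<kappa> = (3 * real CARD('n) / c) powr \<alpha> *
        real N powr (real m * \<alpha> + (real CARD('n) - real m) * (real CARD('n) - real m + 1) / 2)" "1 \<le> \<kappa>"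
  shows "\<exists>\<nu>\<in>frostman_measures \<alpha> 1. emeasure \<nu> UNIV \<le> V \<and>
    (\<forall>F\<in>borel_measurable borel. (\<integral>\<^sup>+x. F (\<chi> j. (1 / real N) ^ coord_index j * (x \<bullet> v j)) \<partial>\<mu>)
        = ennreal \<kappa> * (\<integral>\<^sup>+y. F y \<partial>\<nu>))"
proof -
  define L where "L x = (\<chi> j. (1 / real N) ^ coord_index j * (x \<bullet> v j))" for x
  have sets[measurable_cong]: "sets \<mu> = sets borel" using \<mu> by (simp add: frostman_measures_def)
  have [simp]: "space \<mu> = UNIV" using sets_eq_imp_space_eq[OF sets] by simp
  have L[measurable]: "L \<in> borel_measurable borel"
    unfolding L_def by (intro borel_measurable_continuous_onI continuous_on_vec_lambda continuous_intros)
  define \<nu> where "\<nu> = scale_measure (ennreal (1 / \<kappa>)) (distr \<mu> borel L)"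
  have inv: "ennreal (1 / \<kappa>) * ennreal (\<kappa> * b) = ennreal b" for b
    using \<kappa>(2) by (subst ennreal_mult'[symmetric]) auto
  have em: "emeasure \<nu> A = ennreal (1 / \<kappa>) * emeasure \<mu> (L -` A)" if "A \<in> sets borel" for A
    using that by (simp add: \<nu>_def emeasure_distr)
  have "\<nu> \<in> frostman_measures \<alpha> 1"
    unfolding frostman_measures_def
  proof (intro CollectI conjI allI impI)
    show "sets \<nu> = sets borel" by (simp add: \<nu>_def)
    fix y :: "(real, 'n) vec" and \<rho> :: real assume \<rho>: "0 < \<rho>"
    have "emeasure \<nu> (ball y \<rho>) = ennreal (1 / \<kappa>) * emeasure \<mu> {x. L x \<in> ball y \<rho>}"
      by (subst em) (auto simp: vimage_def)
    also have "\<dots> \<le> ennreal (1 / \<kappa>) * ennreal (\<kappa> * \<rho> powr \<alpha>)"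
      using rescaled_ball_measure[OF \<mu> c frame N m \<alpha> \<rho>, of y] unfolding L_def \<kappa>(1)
      by (intro mult_left_mono) auto
    finally show "emeasure \<nu> (ball y \<rho>) \<le> ennreal (1 * \<rho> powr \<alpha>)" by (simp add: inv)
  qed
  moreover have "emeasure \<nu> UNIV \<le> V"
  proof -
    have "emeasure \<nu> UNIV = ennreal (1 / \<kappa>) * emeasure \<mu> UNIV" by (subst em) auto
    also have "\<dots> \<le> 1 * emeasure \<mu> UNIV"
      using \<kappa>(2) by (intro mult_right_mono) (auto simp: ennreal_1[symmetric] simp del: ennreal_1 intro!: ennreal_leI)
    finally show ?thesis using mass by simp
  qed
  moreover have "(\<integral>\<^sup>+x. F (L x) \<partial>\<mu>) = ennreal \<kappa> * (\<integral>\<^sup>+y. F y \<partial>\<nu>)" if [measurable]: "F \<in> borel_measurable borel" for F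
  proof -
    have "(\<integral>\<^sup>+y. F y \<partial>\<nu>) = ennreal (1 / \<kappa>) * (\<integral>\<^sup>+x. F (L x) \<partial>\<mu>)"
      unfolding \<nu>_def by (subst nn_integral_scale_measure) (auto simp: nn_integral_distr)
    moreover have "ennreal \<kappa> * (ennreal (1 / \<kappa>) * z) = z" for z
      using \<kappa>(2) by (simp add: mult.assoc[symmetric] ennreal_mult'[symmetric])
    ultimately show ?thesis by simp
  qed
  ultimately show ?thesis unfolding L_def by blast
qed

section \<open>The multilinear estimate\<close>

text \<open>The frequency is absorbed into \<open>x\<close>, and the interval enters as a cut-off
  over the line, so that pieces and affine substitutions are handled in one integral. It is used
  with half-open intervals, which tile exactly.\<close>

definition osc_int :: "real set \<Rightarrow> (real \<Rightarrow> real ^ 'n) \<Rightarrow> (real \<Rightarrow> complex) \<Rightarrow> real ^ 'n \<Rightarrow> complex" where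
  "osc_int J \<gamma> f x = (LINT t|lborel. indicator J t * (cis (x \<bullet> \<gamma> t) * f t))"

abbreviation Lp_mass :: "real \<Rightarrow> real set \<Rightarrow> (real \<Rightarrow> complex) \<Rightarrow> ennreal" where
  "Lp_mass p S f \<equiv> (\<integral>\<^sup>+t. ennreal (norm (f t) powr p) * indicator S t \<partial>lborel)"

abbreviation osc_mass ::
    "real \<Rightarrow> (real ^ 'n) measure \<Rightarrow> (real \<Rightarrow> real ^ 'n) \<Rightarrow> (real \<Rightarrow> complex) \<Rightarrow> ennreal" where
  "osc_mass q \<mu> \<gamma> f \<equiv> (\<integral>\<^sup>+x. ennreal (norm (osc_int {0..<1} \<gamma> f x) powr q) \<partial>\<mu>)"

text \<open>Replaces Hoelder's inequality on a set of measure at most 1 by the pointwise bound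
  \<open>y powr (r / p) \<le> 1 + y\<close> with \<open>y = norm (f t) powr p / a\<close>; the two
  summands account for the factor 2.\<close>

lemma nn_integral_powr_le:
  fixes f :: "real \<Rightarrow> complex"
  assumes [measurable]: "f \<in> borel_measurable borel" "J \<in> sets borel" and J: "J \<subseteq> {0..<1}"
    and p: "0 < r" "r \<le> p" and a: "0 < a"
    and fa: "Lp_mass p {0..<1} f \<le> ennreal a"
  shows "Lp_mass r J f \<le> ennreal (2 * a powr (r / p))"
proof -
  have pt: "norm (f t) powr r \<le> a powr (r / p) + a powr (r / p) / a * norm (f t) powr p" for t
  proof -
    define y where "y = norm (f t) powr p / a"
    have y: "0 \<le> y" using a by (simp add: y_def)
    have "y powr (r / p) \<le> 1 + y"
    proof (cases "y \<le> 1")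
      case True
      then show ?thesis using y p powr_mono_both[of 0 "r / p" y 1] powr_le1[of "r / p" y] by auto
    next
      case False
      then have "y powr (r / p) \<le> y powr 1" using p by (intro powr_mono) auto
      then show ?thesis using False by simp
    qed
    moreover have "norm (f t) powr r = a powr (r / p) * y powr (r / p)"
      using a p by (simp add: y_def powr_mult[symmetric] powr_powr)
    ultimately show ?thesis
      using mult_left_mono[of "y powr (r / p)" "1 + y" "a powr (r / p)"] by (simp add: y_def algebra_simps)
  qed
  have "Lp_mass r J f
      \<le> (\<integral>\<^sup>+t. ennreal (a powr (r / p)) * indicator {0..<1} t
          + ennreal (a powr (r / p) / a) * (ennreal (norm (f t) powr p) * indicator {0..<1} t) \<partial>lborel)"
  proof (rule nn_integral_mono)
    fix t
    show "ennreal (norm (f t) powr r) * indicator J t \<le> ennreal (a powr (r / p)) * indicator {0..<1} t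
          + ennreal (a powr (r / p) / a) * (ennreal (norm (f t) powr p) * indicator {0..<1} t)"
    proof (cases "t \<in> J")
      case True
      then have t: "t \<in> {0..<1}" using J by auto
      have "ennreal (norm (f t) powr r) \<le> ennreal (a powr (r / p)) + ennreal (a powr (r / p) / a * norm (f t) powr p)"
        using pt a by (intro ennreal_leI_add) auto
      also have "ennreal (a powr (r / p) / a * norm (f t) powr p) = ennreal (a powr (r / p) / a) * ennreal (norm (f t) powr p)"
        using a by (intro ennreal_mult') simp
      finally show ?thesis using t True by simp
    qed simp
  qed
  also have "\<dots> = ennreal (a powr (r / p)) + ennreal (a powr (r / p) / a) * Lp_mass p {0..<1} f"
    by (subst nn_integral_add) (auto simp: nn_integral_cmult_indicator nn_integral_cmult)
  also have "\<dots> \<le> ennreal (a powr (r / p)) + ennreal (a powr (r / p) / a) * ennreal a"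
    by (intro add_left_mono mult_left_mono fa) auto
  also have "\<dots> = ennreal (2 * a powr (r / p))"
    using a by (simp add: ennreal_mult'[symmetric] ennreal_plus[symmetric] del: ennreal_plus)
  finally show ?thesis .
qed

lemma integrable_of_Lp:
  fixes f :: "real \<Rightarrow> complex"
  assumes [measurable]: "f \<in> borel_measurable borel" "J \<in> sets borel" and J: "J \<subseteq> {0..<1}"
    and p: "1 \<le> p" and a: "0 < a"
    and fa: "Lp_mass p {0..<1} f \<le> ennreal a"
  shows "integrable lborel (\<lambda>t. indicator J t * f t)"
    and "(\<integral>\<^sup>+t. ennreal (norm (indicator J t * f t)) \<partial>lborel) \<le> ennreal (2 * a powr (1 / p))"
proof -
  have "(\<integral>\<^sup>+t. ennreal (norm (indicator J t * f t)) \<partial>lborel) = Lp_mass 1 J f"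
    by (intro nn_integral_cong) (auto simp: indicator_def)
  also have "\<dots> \<le> ennreal (2 * a powr (1 / p))"
    using nn_integral_powr_le[OF assms(1-3) _ p a fa] by simp
  finally show *: "(\<integral>\<^sup>+t. ennreal (norm (indicator J t * f t)) \<partial>lborel) \<le> ennreal (2 * a powr (1 / p))" .
  show "integrable lborel (\<lambda>t. indicator J t * f t)"
    by (intro integrableI_bounded le_less_trans[OF *]) auto
qed

lemma borel_measurable_osc_int:
  assumes [measurable]: "f \<in> borel_measurable borel" "J \<in> sets borel" "\<gamma> \<in> borel_measurable borel"
  shows "osc_int J \<gamma> f \<in> borel_measurable borel"
  unfolding osc_int_def by (rule lborel.borel_measurable_lebesgue_integral) measurable

lemma norm_near_moment_le:
  fixes g :: "nat \<Rightarrow> real \<Rightarrow> real ^ 'n::{finite,linorder}"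
  assumes "near_moment \<epsilon> g" "\<epsilon> \<le> 1" "t \<in> {0..1}"
  shows "norm (g 0 t) \<le> real CARD('n) + 1"
proof -
  have "norm (moment_deriv 0 t :: (real, 'n) vec) \<le> real CARD('n) * 1"
  proof (rule norm_vec_le_card)
    fix i :: 'n
    have "t ^ coord_index i \<le> 1" "(1::real) \<le> fact (coord_index i)" using assms(3) by (auto intro!: power_le_one)
    then have "t ^ coord_index i \<le> fact (coord_index i)" by (rule order_trans)
    then have "t ^ coord_index i / fact (coord_index i) \<le> 1" by (simp add: divide_le_eq)
    then show "\<bar>(moment_deriv 0 t :: (real, 'n) vec) $ i\<bar> \<le> 1" using assms(3) by (simp add: moment_deriv_def)
  qed
  moreover have "norm (g 0 t - moment_deriv 0 t) \<le> \<epsilon>" using assms by (auto simp: near_moment_def)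
  ultimately show ?thesis using norm_triangle_sub[of "g 0 t" "moment_deriv 0 t"] assms(2) by simp
qed

lemma prod_mono_ennreal:
  fixes u v :: "'i \<Rightarrow> ennreal"
  assumes "\<And>i. i \<in> I \<Longrightarrow> u i \<le> v i" "finite I"
  shows "prod u I \<le> prod v I"
  using assms(2,1) by (induction I rule: finite_induct) (auto intro!: mult_mono)

text \<open>Fubini turns the product into one d-dimensional integral with phase
  \<open>\<Phi>\<close>, the sum of the curve at the coordinates, and with density the tensor power
  of \<open>f\<close>. \<open>phase_sum_expanding\<close> and the Gaussian potential bound supply
  the L2 endpoint. The constant depends on the transversality constant \<open>c\<close> but not on
  the mass of \<open>\<mu>\<close>.\<close>

lemma multilinear_estimate:
  fixes c s p \<alpha> :: real
  assumes c: "0 < c" and s: "2 \<le> s" and p: "s / (s - 1) \<le> p"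
  shows "\<exists>C>0. \<forall>(\<mu> :: (real ^ 'n::{finite,linorder}) measure) g a b f A \<epsilon>.
    \<mu> \<in> frostman_measures \<alpha> 1 \<longrightarrow> finite_measure \<mu> \<longrightarrow> near_moment \<epsilon> g \<longrightarrow> \<epsilon> \<le> 1 \<longrightarrow> real CARD('n) * \<epsilon> \<le> c / 2 \<longrightarrow>
    (\<forall>i :: 'n. 0 \<le> a i \<and> b i \<le> 1) \<longrightarrow>
    (\<forall>\<sigma> x. (\<forall>i. \<sigma> $ i \<in> {a i..b i}) \<longrightarrow> c * norm x \<le> norm (\<chi> i. x \<bullet> (moment_deriv 1 (\<sigma> $ i) :: (real, 'n) vec))) \<longrightarrow>
    f \<in> borel_measurable borel \<longrightarrow> 0 < A \<longrightarrow>
    Lp_mass p {0..<1} f \<le> ennreal A \<longrightarrow>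
    (\<integral>\<^sup>+x. ennreal (norm (\<Prod>i\<in>UNIV. osc_int {a i..<b i} (g 0) f x) powr s) \<partial>\<mu>)
      \<le> ennreal (C * A powr (real CARD('n) * s / p))"
proof -
  define d where "d = CARD('n)"
  \<comment> \<open>\<open>\<Phi>\<close> is a sum of d points of a curve of norm at most d +
    1.\<close>
  define R where "R = real d * (real d + 1)"
  have R0: "0 \<le> R" by (simp add: R_def)
  have "\<exists>w>0. \<forall>y :: (real, 'n) vec. norm y \<le> R \<longrightarrow> w \<le> gauss_weight y"
  proof -
    have "\<exists>z\<in>cball (0 :: (real, 'n) vec) R. \<forall>y\<in>cball (0 :: (real, 'n) vec) R. gauss_weight z \<le> gauss_weight y"
      by (rule continuous_attains_inf) (use R0 in \<open>auto intro!: continuous_on_gauss_weight\<close>)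
    then obtain z :: "(real, 'n) vec" where "\<forall>y\<in>cball (0 :: (real, 'n) vec) R. gauss_weight z \<le> gauss_weight y" by blast
    then show ?thesis by (intro exI[of _ "gauss_weight z"]) (auto simp: gauss_weight_pos)
  qed
  then obtain w where w: "0 < w" "\<And>y :: (real, 'n) vec. norm y \<le> R \<Longrightarrow> w \<le> gauss_weight y" by auto
  \<comment> \<open>\<open>c / 2\<close> and not \<open>c\<close>: half of the expansion is given up
    to the perturbation of the moment curve.\<close>
  define C2 where "C2 = frostman_gaussian_const \<alpha> * (2 / (c / 2)) ^ d / w"
  have C2: "0 < C2" using c w frostman_gaussian_const_pos by (simp add: C2_def)
  have ic: "0 < interpolation_const s" using s by (simp add: interpolation_const_def)
  define r where "r = s / (s - 1)"
  have r: "1 < r" "r \<le> p" "0 < r" using s p by (auto simp: r_def field_simps)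
  define C where "C = C2 * interpolation_const s * (2 ^ d) powr (s - 1)"
  have C: "0 < C" using C2 ic by (simp add: C_def)
  show ?thesis
  proof (intro exI[of _ C] conjI C allI impI)
    fix \<mu> :: "(real, 'n) vec measure" and g :: "nat \<Rightarrow> real \<Rightarrow> (real, 'n) vec"
      and a b :: "'n \<Rightarrow> real" and f :: "real \<Rightarrow> complex" and A \<epsilon> :: real
    assume \<mu>: "\<mu> \<in> frostman_measures \<alpha> 1" and fin: "finite_measure \<mu>" and g: "near_moment \<epsilon> g"
      and \<epsilon>: "\<epsilon> \<le> 1" "real CARD('n) * \<epsilon> \<le> c / 2"
      and ab: "\<forall>i :: 'n. 0 \<le> a i \<and> b i \<le> 1"
      and sep: "\<forall>\<sigma> x. (\<forall>i. \<sigma> $ i \<in> {a i..b i}) \<longrightarrow> c * norm x \<le> norm (\<chi> i. x \<bullet> (moment_deriv 1 (\<sigma> $ i) :: (real, 'n) vec))"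
      and f[measurable]: "f \<in> borel_measurable borel" and A: "0 < A"
      and fA: "Lp_mass p {0..<1} f \<le> ennreal A"
    have sets[measurable_cong]: "sets \<mu> = sets borel" using \<mu> by (simp add: frostman_measures_def)
    have [measurable]: "g 0 \<in> borel_measurable borel" using g by (simp add: near_moment_def)
    define \<Phi> where "\<Phi> t = (\<Sum>i\<in>UNIV. g 0 (t $ i))" for t :: "(real, 'n) vec"
    have [measurable]: "\<Phi> \<in> borel_measurable borel" unfolding \<Phi>_def by measurable
    define E where "E = {t :: (real, 'n) vec. \<forall>i. t $ i \<in> {a i..b i}}"
    have E_cbox: "E = cbox (\<chi> i. a i) (\<chi> i. b i)" by (auto simp: E_def mem_box_cart)
    have E[measurable]: "E \<in> sets borel" and Efin: "emeasure lborel E < \<infinity>"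
      by (auto simp: E_cbox emeasure_lborel_cbox_eq)
    have E01: "t $ i \<in> {0..1}" if "t \<in> E" for t i
      using that ab[rule_format, of i] by (auto simp: E_def dest!: spec[of _ i])
    define J where "J i = {a i..<b i}" for i
    have J: "J i \<in> sets borel" "J i \<subseteq> {0..<1}" for i
      using ab by (auto simp: J_def less_le_trans)
    note [measurable] = J(1)
    define G where "G t = (\<Prod>i\<in>UNIV. indicator (J i) (t $ i) * f (t $ i))" for t :: "(real, 'n) vec"
    define K where "K x t = indicator E t * cis (x \<bullet> \<Phi> t)" for x t
    have intJ: "integrable lborel (\<lambda>t. indicator (J i) t * f t)" for i
      by (rule integrable_of_Lp[OF f J(1) J(2) _ A fA]) (use r in simp)
    have G_int: "integrable lborel G" unfolding G_def by (rule lborel_vec_prod(1)) (rule intJ)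
    have G_meas[measurable]: "G \<in> borel_measurable borel" using borel_measurable_integrable[OF G_int] by simp
    have prod_eq: "(\<Prod>i\<in>UNIV. osc_int {a i..<b i} (g 0) f x) = (\<integral>t. K x t * G t \<partial>lborel)" for x
    proof -
      have int: "integrable lborel (\<lambda>t. indicator (J i) t * (cis (x \<bullet> g 0 t) * f t))" for i
        by (rule Bochner_Integration.integrable_bound[OF intJ[of i]]) (auto simp: norm_mult indicator_def)
      have "(\<Prod>i\<in>UNIV. osc_int {a i..<b i} (g 0) f x) = (\<integral>t. (\<Prod>i\<in>UNIV. indicator (J i) (t $ i) * (cis (x \<bullet> g 0 (t $ i)) * f (t $ i))) \<partial>(lborel :: (real, 'n) vec measure))"
        unfolding osc_int_def J_def[symmetric] by (rule lborel_vec_prod(2)[symmetric]) (rule int)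
      also have "\<dots> = (\<integral>t. K x t * G t \<partial>lborel)"
      proof (intro Bochner_Integration.integral_cong refl)
        fix t :: "(real, 'n) vec"
        have "(\<Prod>i\<in>UNIV. cis (x \<bullet> g 0 (t $ i))) = cis (x \<bullet> \<Phi> t)"
          by (simp add: \<Phi>_def inner_sum_right cis_sum)
        then have 1: "(\<Prod>i\<in>UNIV. indicator (J i) (t $ i) * (cis (x \<bullet> g 0 (t $ i)) * f (t $ i))) = cis (x \<bullet> \<Phi> t) * G t"
          by (simp add: G_def prod.distrib mult_ac)
        \<comment> \<open>The tensor product lives on the half-open box, so multiplying the kernel
          by the indicator of the closed box \<open>E\<close> changes nothing and confines the phase
          to the region where it expands.\<close>
        have 2: "G t = 0" if "t \<notin> E"
        proof -
          from that obtain i where "t $ i \<notin> {a i..b i}" by (auto simp: E_def)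
          then have "indicator (J i) (t $ i) * f (t $ i) = 0" by (auto simp: J_def)
          then show ?thesis unfolding G_def by (intro prod_zero) auto
        qed
        show "(\<Prod>i\<in>UNIV. indicator (J i) (t $ i) * (cis (x \<bullet> g 0 (t $ i)) * f (t $ i))) = K x t * G t"
          unfolding 1 K_def using 2 by (cases "t \<in> E") auto
      qed
      finally show ?thesis .
    qed
    have Gr: "(\<integral>\<^sup>+t. ennreal (norm (G t) powr r) \<partial>lborel) \<le> ennreal ((2 * A powr (r / p)) ^ d)"
    proof -
      have "(\<integral>\<^sup>+t. ennreal (norm (G t) powr r) \<partial>lborel)
        = (\<integral>\<^sup>+t. (\<Prod>i\<in>UNIV. ennreal (norm (f (t $ i)) powr r) * indicator (J i) (t $ i)) \<partial>(lborel :: (real, 'n) vec measure))"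
      proof (rule nn_integral_cong)
        fix t :: "(real, 'n) vec"
        have "norm (G t) powr r = (\<Prod>i\<in>UNIV. norm (indicator (J i) (t $ i) * f (t $ i)) powr r)"
          by (simp add: G_def prod_norm[symmetric] prod_powr_distrib)
        then have "ennreal (norm (G t) powr r) = (\<Prod>i\<in>UNIV. ennreal (norm (indicator (J i) (t $ i) * f (t $ i)) powr r))"
          by (simp add: prod_ennreal)
        also have "\<dots> = (\<Prod>i\<in>UNIV. ennreal (norm (f (t $ i)) powr r) * indicator (J i) (t $ i))"
          by (intro prod.cong refl) (auto simp: indicator_def)
        finally show "ennreal (norm (G t) powr r) = \<dots>" .
      qed
      also have "\<dots> = (\<Prod>i\<in>UNIV. \<integral>\<^sup>+t. ennreal (norm (f t) powr r) * indicator (J i) t \<partial>lborel)"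
        by (rule nn_integral_lborel_vec_prod) measurable
      also have "\<dots> \<le> (\<Prod>i\<in>(UNIV :: 'n set). ennreal (2 * A powr (r / p)))"
        by (intro prod_mono_ennreal nn_integral_powr_le[OF f J(1) J(2) r(3,2) A fA]) auto
      also have "\<dots> = ennreal ((2 * A powr (r / p)) ^ d)"
        using A by (simp add: d_def ennreal_power)
      finally show ?thesis .
    qed
    have L2: "(\<integral>\<^sup>+x. ennreal ((norm (\<integral>t. K x t * H t \<partial>lborel))\<^sup>2) \<partial>\<mu>) \<le> ennreal C2 * (\<integral>\<^sup>+t. ennreal ((norm (H t))\<^sup>2) \<partial>lborel)"
      if "H \<in> borel_measurable lborel" "integrable lborel H" for H
      unfolding K_def C2_def d_def
    proof (rule oscillatory_L2[OF fin sets frostman_gaussian[OF \<mu>] E Efin])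
      show "norm (\<Phi> t) \<le> R" if "t \<in> E" for t
      proof -
        have "norm (\<Phi> t) \<le> (\<Sum>i\<in>(UNIV :: 'n set). real CARD('n) + 1)"
          unfolding \<Phi>_def by (intro sum_norm_le norm_near_moment_le[OF g \<epsilon>(1)] E01 that)
        then show ?thesis by (simp add: R_def d_def)
      qed
      show "c / 2 * norm (s - t) \<le> norm (\<Phi> s - \<Phi> t)" if "s \<in> E" "t \<in> E" for s t
        unfolding \<Phi>_def using sep that ab
        by (intro phase_sum_expanding[OF g c _ \<epsilon>(2), where J="\<lambda>i. {a i..b i}"]) (auto simp: E_def is_interval_cc)
    qed (use that c w frostman_gaussian_const_pos in auto)
    have "(\<integral>\<^sup>+x. ennreal (norm (\<integral>t. K x t * G t \<partial>lborel) powr s) \<partial>\<mu>)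
      \<le> ennreal (C2 * interpolation_const s * ((2 * A powr (r / p)) ^ d) powr (s - 1))"
    proof (rule interpolation_L2_Linf[OF _ _ _ _ _ L2 s _ G_int])
      show "sigma_finite_measure \<mu>" using fin by (rule finite_measure.axioms)
      show "(\<lambda>(x, t). K x t) \<in> borel_measurable (\<mu> \<Otimes>\<^sub>M lborel)" unfolding K_def by measurable
      show "norm (K x t) \<le> 1" for x t by (auto simp: K_def norm_mult indicator_def)
    qed (use C2 A Gr in \<open>auto simp: r_def lborel.sigma_finite_measure_axioms\<close>)
    also have "C2 * interpolation_const s * ((2 * A powr (r / p)) ^ d) powr (s - 1) = C * A powr (real CARD('n) * s / p)"
    proof -
      have e: "r / p * real d * (s - 1) = real d * s / p" 
      proof -
        have "r * (s - 1) = s" using s by (simp add: r_def)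
        moreover have "r / p * real d * (s - 1) = real d * (r * (s - 1)) / p" by simp
        ultimately show ?thesis by simp
      qed
      have "((2 * A powr (r / p)) ^ d) powr (s - 1) = (2 ^ d * A powr (r / p * real d)) powr (s - 1)"
        using A by (simp add: power_mult_distrib powr_realpow[symmetric] powr_powr)
      also have "\<dots> = (2 ^ d) powr (s - 1) * A powr (r / p * real d * (s - 1))"
        by (simp only: powr_mult powr_powr)
      finally show ?thesis unfolding e by (simp add: C_def d_def mult_ac)
    qed
    finally show "(\<integral>\<^sup>+x. ennreal (norm (\<Prod>i\<in>UNIV. osc_int {a i..<b i} (g 0) f x) powr s) \<partial>\<mu>)
      \<le> ennreal (C * A powr (real CARD('n) * s / p))"
      by (simp add: prod_eq)
  qed
qed

section \<open>Reduction to separated and to short intervals\<close>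

text \<open>Broad-narrow dichotomy: either few pieces are significant, or choosing indices of one parity
  yields d pairwise separated significant pieces.\<close>

lemma broad_narrow:
  fixes z :: "nat \<Rightarrow> complex" and N :: nat
  assumes N: "0 < N"
  shows "(\<exists>k<N. norm (\<Sum>k<N. z k) \<le> 4 * real CARD('n::finite) * norm (z k))
    \<or> (\<exists>\<sigma>\<in>{\<sigma> :: 'n \<Rightarrow> nat. (\<forall>i. \<sigma> i < N) \<and> (\<forall>i j. i \<noteq> j \<longrightarrow> 2 \<le> \<bar>int (\<sigma> i) - int (\<sigma> j)\<bar>)}.
        \<forall>i. norm (\<Sum>k<N. z k) \<le> 2 * real N * norm (z (\<sigma> i)))"
proof -
  define S where "S = norm (\<Sum>k<N. z k)"
  define d where "d = CARD('n)"
  have d: "0 < d" by (simp add: d_def)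
  \<comment> \<open>The remaining indices contribute at most \<open>S / 2\<close> altogether, so the
    significant ones carry the other half; this is where \<open>4 * d = 2 * (2 * d)\<close> comes
    from.\<close>
  define T where "T = {k. k < N \<and> S \<le> 2 * real N * norm (z k)}"
  have finT: "finite T" by (simp add: T_def)
  show ?thesis
  \<comment> \<open>With at least \<open>2 * d\<close> significant indices, one parity class
    contains d of them, and distinct indices of equal parity differ by at least 2.\<close>
  proof (cases "card T < 2 * d")
    case True
    have ne: "(\<lambda>k. norm (z k)) ` {..<N} \<noteq> {}" using N by auto
    have "Max ((\<lambda>k. norm (z k)) ` {..<N}) \<in> (\<lambda>k. norm (z k)) ` {..<N}"
      by (rule Max_in[OF _ ne]) simp
    then obtain k0 where k0: "k0 < N" "norm (z k0) = Max ((\<lambda>k. norm (z k)) ` {..<N})" by auto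
    have k0_max: "norm (z k) \<le> norm (z k0)" if "k < N" for k
      unfolding k0(2) using that by (intro Max_ge) auto
    have "S \<le> (\<Sum>k<N. norm (z k))" unfolding S_def by (rule norm_sum)
    also have "\<dots> = (\<Sum>k\<in>T. norm (z k)) + (\<Sum>k\<in>{..<N} - T. norm (z k))"
      by (subst add.commute, rule sum.subset_diff) (auto simp: T_def)
    also have "(\<Sum>k\<in>T. norm (z k)) \<le> real (card T) * norm (z k0)"
      using sum_bounded_above[of T "\<lambda>k. norm (z k)" "norm (z k0)"] k0_max by (auto simp: T_def)
    also have "real (card T) * norm (z k0) \<le> (2 * real d) * norm (z k0)"
      using True by (intro mult_right_mono) auto
    also have "(\<Sum>k\<in>{..<N} - T. norm (z k)) \<le> real (card ({..<N} - T)) * (S / (2 * real N))"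
      using N by (intro sum_bounded_above) (auto simp: T_def field_simps)
    also have "real (card ({..<N} - T)) * (S / (2 * real N)) \<le> real N * (S / (2 * real N))"
      using card_mono[of "{..<N}" "{..<N} - T"] N by (intro mult_right_mono) (auto simp: S_def)
    also have "real N * (S / (2 * real N)) = S / 2" using N by simp
    finally have "S \<le> 4 * real d * norm (z k0)" by simp
    then show ?thesis using k0(1) by (auto simp: S_def d_def)
  next
    case False
    have "card T = card {k\<in>T. even k} + card {k\<in>T. odd k}"
      using finT by (subst card_Un_disjoint[symmetric]) (auto intro!: arg_cong[where f=card])
    then have "d \<le> card {k\<in>T. even k} \<or> d \<le> card {k\<in>T. odd k}" using False by linarith
    then obtain b where b: "d \<le> card {k\<in>T. even k = b}"
    proof
      assume "d \<le> card {k\<in>T. even k}" then show ?thesis using that[of True] by simp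
    next
      assume "d \<le> card {k\<in>T. odd k}" then show ?thesis using that[of False] by simp
    qed
    have "card (UNIV :: 'n set) \<le> card {k\<in>T. even k = b}" using b by (simp add: d_def)
    then obtain \<sigma> :: "'n \<Rightarrow> nat" where \<sigma>: "\<sigma> ` UNIV \<subseteq> {k\<in>T. even k = b}" "inj_on \<sigma> UNIV"
      using card_le_inj[of "UNIV :: 'n set" "{k\<in>T. even k = b}"] finT by auto
    have "2 \<le> \<bar>int (\<sigma> i) - int (\<sigma> j)\<bar>" if "i \<noteq> j" for i j
    proof -
      have "\<sigma> i \<noteq> \<sigma> j" using \<sigma>(2) that by (auto simp: inj_on_def)
      moreover have "even (\<sigma> i) = even (\<sigma> j)" using \<sigma>(1) by blast
      ultimately show ?thesis by presburger
    qed
    moreover have "\<sigma> i < N" "S \<le> 2 * real N * norm (z (\<sigma> i))" for i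
      using \<sigma>(1) by (auto simp: T_def)
    ultimately show ?thesis unfolding S_def by blast
  qed
qed

lemma finite_separated: "finite {\<sigma> :: 'n::finite \<Rightarrow> nat. (\<forall>i. \<sigma> i < N) \<and> P \<sigma>}"
proof -
  have "finite (Pi\<^sub>E (UNIV :: 'n set) (\<lambda>_. {..<N}))" by (intro finite_PiE) auto
  then show ?thesis by (rule finite_subset[rotated]) (auto simp: PiE_def)
qed

text \<open>Which alternative holds depends on the point of evaluation; summing over all
  alternatives gives a single bound that can be integrated. In the broad case the d inequalities are
  multiplied first, so the product appears with exponent \<open>s = q / d\<close>.\<close>

lemma broad_narrow_powr:
  fixes z :: "nat \<Rightarrow> complex" and N :: nat
  assumes N: "0 < N" and s: "0 < s"
  shows "norm (\<Sum>k<N. z k) powr (real CARD('n::finite) * s)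
    \<le> (4 * real CARD('n)) powr (real CARD('n) * s) * (\<Sum>k<N. norm (z k) powr (real CARD('n) * s))
    + (2 * real N) powr (real CARD('n) * s) *
      (\<Sum>\<sigma>\<in>{\<sigma> :: 'n \<Rightarrow> nat. (\<forall>i. \<sigma> i < N) \<and> (\<forall>i j. i \<noteq> j \<longrightarrow> 2 \<le> \<bar>int (\<sigma> i) - int (\<sigma> j)\<bar>)}.
        norm (\<Prod>i\<in>UNIV. z (\<sigma> i)) powr s)"
    (is "?L \<le> ?A * ?S1 + ?B * (\<Sum>\<sigma>\<in>?Sep. ?P \<sigma>)")
proof -
  define q where "q = real CARD('n) * s"
  have q: "0 < q" using s by (simp add: q_def)
  have S1: "0 \<le> ?S1" and S2: "0 \<le> (\<Sum>\<sigma>\<in>?Sep. ?P \<sigma>)" by (auto intro!: sum_nonneg)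
  from broad_narrow[OF N, of z, where 'n='n] show ?thesis
  proof
    assume "\<exists>k<N. norm (\<Sum>k<N. z k) \<le> 4 * real CARD('n) * norm (z k)"
    then obtain k where k: "k < N" "norm (\<Sum>k<N. z k) \<le> 4 * real CARD('n) * norm (z k)" by auto
    have "?L \<le> (4 * real CARD('n) * norm (z k)) powr q"
      unfolding q_def[symmetric] using k(2) q by (intro powr_mono2) auto
    also have "\<dots> = ?A * norm (z k) powr q" by (simp add: powr_mult q_def)
    also have "\<dots> \<le> ?A * ?S1"
      unfolding q_def[symmetric] using k(1) by (intro mult_left_mono member_le_sum) auto
    finally show ?thesis using S2 by (simp add: add_increasing2)
  next
    assume "\<exists>\<sigma>\<in>?Sep. \<forall>i. norm (\<Sum>k<N. z k) \<le> 2 * real N * norm (z (\<sigma> i))"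
    then obtain \<sigma> where \<sigma>: "\<sigma> \<in> ?Sep" "\<And>i. norm (\<Sum>k<N. z k) \<le> 2 * real N * norm (z (\<sigma> i))" by auto
    have "norm (\<Sum>k<N. z k) ^ CARD('n) = (\<Prod>i\<in>(UNIV :: 'n set). norm (\<Sum>k<N. z k))" by simp
    also have "\<dots> \<le> (\<Prod>i\<in>UNIV. 2 * real N * norm (z (\<sigma> i)))"
      by (intro prod_mono conjI \<sigma>(2)) auto
    also have "\<dots> = (2 * real N) ^ CARD('n) * norm (\<Prod>i\<in>UNIV. z (\<sigma> i))"
      by (simp add: prod.distrib prod_norm)
    finally have "(norm (\<Sum>k<N. z k) ^ CARD('n)) powr s \<le> ((2 * real N) ^ CARD('n) * norm (\<Prod>i\<in>UNIV. z (\<sigma> i))) powr s"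
      using s by (intro powr_mono2) auto
    moreover have "(x ^ CARD('n)) powr s = x powr q" if "0 \<le> x" for x :: real
    proof (cases "x = 0")
      case False
      then show ?thesis using that by (simp add: powr_realpow[symmetric] powr_powr q_def)
    qed (simp add: zero_power)
    ultimately have "?L \<le> ?B * ?P \<sigma>"
      unfolding q_def[symmetric] by (simp add: powr_mult)
    also have "\<dots> \<le> ?B * (\<Sum>\<sigma>\<in>?Sep. ?P \<sigma>)"
      using \<sigma>(1) by (intro mult_left_mono member_le_sum) (auto simp: finite_separated)
    finally show ?thesis using S1 by (simp add: add_increasing)
  qed
qed

section \<open>Splitting and affine rescaling of the oscillatory integral\<close>

lemma osc_int_split:
  fixes N :: nat
  assumes f: "f \<in> borel_measurable borel" and [measurable]: "\<gamma> \<in> borel_measurable borel"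
    and int: "integrable lborel (\<lambda>t. indicator {0..<1} t * f t)" and N: "0 < N"
  shows "osc_int {0..<1} \<gamma> f x = (\<Sum>k<N. osc_int {real k / real N..<(real k + 1) / real N} \<gamma> f x)"
proof -
  note [measurable] = f
  let ?J = "\<lambda>k. {real k / real N..<(real k + 1) / real N}"
  have sub: "?J k \<subseteq> {0..<1}" if "k < N" for k
    using that N by (auto simp: field_simps) 
  have part: "indicator {0..<1} t = (\<Sum>k<N. indicator (?J k) t :: complex)" for t
  proof (cases "t \<in> {0..<1}")
    case True
    define k where "k = nat \<lfloor>t * real N\<rfloor>"
    have k: "real k \<le> t * real N" "t * real N < real k + 1"
      unfolding k_def using True N by (auto simp: le_floor_iff)
    have "t * real N < real N" using True N by simp
    then have kN: "k < N" using k(1) by (metis le_less_trans of_nat_less_iff)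
    have "t \<in> ?J j \<longleftrightarrow> j = k" for j
    proof
      assume "t \<in> ?J j"
      then have "real j \<le> t * real N" "t * real N < real j + 1" using N by (auto simp: field_simps)
      then show "j = k" using k by linarith
    qed (use k N in \<open>auto simp: field_simps\<close>)
    then have "(\<Sum>j<N. indicator (?J j) t :: complex) = (\<Sum>j<N. if j = k then 1 else 0)"
      by (intro sum.cong refl) (simp add: indicator_def)
    then show ?thesis using True kN by simp
  next
    case False
    then have "t \<notin> ?J k" if "k < N" for k using sub[OF that] by blast
    then have "(\<Sum>k<N. indicator (?J k) t :: complex) = 0" by (intro sum.neutral) (simp add: indicator_def)
    then show ?thesis using False by simp
  qed
  have intk: "integrable lborel (\<lambda>t. indicator (?J k) t * (cis (x \<bullet> \<gamma> t) * f t))" if "k < N" for k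
  proof (rule Bochner_Integration.integrable_bound[OF int])
    show "AE t in lborel. norm (indicator (?J k) t * (cis (x \<bullet> \<gamma> t) * f t)) \<le> norm (indicator {0..<1} t * f t)"
    proof (rule AE_I2)
      fix t
      show "norm (indicator (?J k) t * (cis (x \<bullet> \<gamma> t) * f t)) \<le> norm (indicator {0..<1} t * f t)"
      proof (cases "t \<in> ?J k")
        case True
        then have "t \<in> {0..<1}" using sub[OF that] by blast
        then show ?thesis using True by (simp add: norm_mult)
      qed simp
    qed
  qed measurable
  have "osc_int {0..<1} \<gamma> f x = (LINT t|lborel. (\<Sum>k<N. indicator (?J k) t * (cis (x \<bullet> \<gamma> t) * f t)))"
    unfolding osc_int_def part by (simp only: sum_distrib_right)
  also have "\<dots> = (\<Sum>k<N. osc_int (?J k) \<gamma> f x)"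
    unfolding osc_int_def by (rule Bochner_Integration.integral_sum) (use intk in auto)
  finally show ?thesis .
qed

text \<open>Moving the base point of the curve to the origin only costs the unimodular factor
  \<open>cis (x \<bullet> \<gamma> t0)\<close>, which the norm discards.\<close>

lemma osc_int_rescale:
  fixes f :: "real \<Rightarrow> complex" and \<gamma> \<gamma>' :: "real \<Rightarrow> real ^ 'n"
  assumes N: "0 < N"
    and phase: "\<And>s. x \<bullet> (\<gamma> (t0 + 1 / real N * s) - \<gamma> t0) = y \<bullet> \<gamma>' s"
  shows "norm (osc_int {t0..<t0 + 1 / real N} \<gamma> f x) = 1 / real N * norm (osc_int {0..<1} \<gamma>' (\<lambda>s. f (t0 + 1 / real N * s)) y)"
proof -
  define F where "F t = indicator {t0..<t0 + 1 / real N} t * (cis (x \<bullet> \<gamma> t) * f t)" for t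
  have "osc_int {t0..<t0 + 1 / real N} \<gamma> f x = \<bar>1 / real N\<bar> *\<^sub>R (LINT s|lborel. F (t0 + 1 / real N * s))"
    unfolding osc_int_def F_def[symmetric] using N by (intro lborel_integral_real_affine) simp
  also have "(LINT s|lborel. F (t0 + 1 / real N * s)) = (LINT s|lborel. cis (x \<bullet> \<gamma> t0) * (indicator {0..<1} s * (cis (y \<bullet> \<gamma>' s) * f (t0 + 1 / real N * s))))"
  proof (intro Bochner_Integration.integral_cong refl)
    fix s
    have "x \<bullet> \<gamma> (t0 + 1 / real N * s) = x \<bullet> \<gamma> t0 + y \<bullet> \<gamma>' s"
      using phase[of s] by (simp add: inner_diff_right)
    then have "cis (x \<bullet> \<gamma> (t0 + 1 / real N * s)) = cis (x \<bullet> \<gamma> t0) * cis (y \<bullet> \<gamma>' s)"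
      by (simp add: cis_mult)
    moreover have "t0 + 1 / real N * s \<in> {t0..<t0 + 1 / real N} \<longleftrightarrow> s \<in> {0..<1}"
      using N by (auto simp: field_simps)
    ultimately show "F (t0 + 1 / real N * s) = cis (x \<bullet> \<gamma> t0) * (indicator {0..<1} s * (cis (y \<bullet> \<gamma>' s) * f (t0 + 1 / real N * s)))"
      by (simp add: F_def indicator_def)
  qed
  also have "\<dots> = cis (x \<bullet> \<gamma> t0) * osc_int {0..<1} \<gamma>' (\<lambda>s. f (t0 + 1 / real N * s)) y"
    unfolding osc_int_def by (rule integral_mult_right_zero)
  finally show ?thesis by (simp add: norm_mult)
qed

lemma nn_integral_rescale:
  fixes F :: "real \<Rightarrow> ennreal"
  assumes N: "0 < N" and [measurable]: "F \<in> borel_measurable borel"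
  shows "(\<integral>\<^sup>+s. F (t0 + 1 / real N * s) * indicator {0..<1} s \<partial>lborel)
    = ennreal (real N) * (\<integral>\<^sup>+t. F t * indicator {t0..<t0 + 1 / real N} t \<partial>lborel)"
proof -
  have "(\<integral>\<^sup>+t. F t * indicator {t0..<t0 + 1 / real N} t \<partial>lborel)
    = ennreal \<bar>1 / real N\<bar> * (\<integral>\<^sup>+s. F (t0 + 1 / real N * s) * indicator {t0..<t0 + 1 / real N} (t0 + 1 / real N * s) \<partial>lborel)"
    using N by (intro nn_integral_real_affine) auto
  also have "(\<integral>\<^sup>+s. F (t0 + 1 / real N * s) * indicator {t0..<t0 + 1 / real N} (t0 + 1 / real N * s) \<partial>lborel)
    = (\<integral>\<^sup>+s. F (t0 + 1 / real N * s) * indicator {0..<1} s \<partial>lborel)"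
  proof (rule nn_integral_cong)
    fix s
    have "t0 + 1 / real N * s \<in> {t0..<t0 + 1 / real N} \<longleftrightarrow> s \<in> {0..<1}"
      using N by (auto simp: field_simps)
    then show "F (t0 + 1 / real N * s) * indicator {t0..<t0 + 1 / real N} (t0 + 1 / real N * s)
      = F (t0 + 1 / real N * s) * indicator {0..<1} s" by (simp add: indicator_def)
  qed
  finally show ?thesis
    using N by (simp add: mult.assoc[symmetric] ennreal_mult'[symmetric])
qed

text \<open>The estimate at frequency 1 in q-th powers, as a property of the constant
  \<open>A\<close>. It is quantified over all curves and measures of the class so that it can be
  applied to rescaled ones. \<open>V\<close> caps the mass, and the first argument only fixes the
  dimension through its type.\<close>

definition osc_bound :: "'n::{finite,linorder} itself \<Rightarrow> real \<Rightarrow> real \<Rightarrow> real \<Rightarrow> real \<Rightarrow> ennreal \<Rightarrow> real \<Rightarrow> bool" where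
  "osc_bound n \<epsilon> \<alpha> p q V A \<longleftrightarrow>
    (\<forall>(g :: nat \<Rightarrow> real \<Rightarrow> (real, 'n) vec) \<mu> f a.
      near_moment \<epsilon> g \<longrightarrow> \<mu> \<in> frostman_measures \<alpha> 1 \<longrightarrow> emeasure \<mu> UNIV \<le> V \<longrightarrow>
      f \<in> borel_measurable borel \<longrightarrow> 0 < a \<longrightarrow>
      Lp_mass p {0..<1} f \<le> ennreal a \<longrightarrow>
      osc_mass q \<mu> (g 0) f \<le> ennreal (A * a powr (q / p)))"

text \<open>Extends the bound to \<open>a = 0\<close> by a limit, as is needed for pieces on which
  the function vanishes.\<close>

lemma osc_boundD:
  fixes g :: "nat \<Rightarrow> real \<Rightarrow> (real, 'n::{finite,linorder}) vec"
  assumes "osc_bound TYPE('n) \<epsilon> \<alpha> p q V A" and "near_moment \<epsilon> g" and "\<mu> \<in> frostman_measures \<alpha> 1"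
    and "emeasure \<mu> UNIV \<le> V" and "f \<in> borel_measurable borel" and A: "0 \<le> A" and pq: "0 < p" "0 < q"
    and a: "0 \<le> a" and fa: "Lp_mass p {0..<1} f \<le> ennreal a"
  shows "osc_mass q \<mu> (g 0) f \<le> ennreal (A * a powr (q / p))"
proof -
  have pos: "osc_mass q \<mu> (g 0) f \<le> ennreal (A * b powr (q / p))"
    if "0 < b" "a \<le> b" for b
    using assms that order_trans[OF fa ennreal_leI[OF that(2)]] unfolding osc_bound_def by blast
  show ?thesis
  proof (cases "a = 0")
    case False
    then show ?thesis using a by (intro pos) auto
  next
    case True
    show ?thesis
    proof (rule ennreal_le_epsilon)
      fix e :: real assume e: "0 < e"
      \<comment> \<open>Makes \<open>A * b powr (q / p)\<close> equal to
        \<open>A * e / (A + 1)\<close>, which is below \<open>e\<close>; the added 1 covers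
        \<open>A = 0\<close>.\<close>
      define b where "b = (e / (A + 1)) powr (p / q)"
      have b: "0 < b" using e A by (simp add: b_def)
      have "A * b powr (q / p) = A * (e / (A + 1))"
        using pq e A by (simp add: b_def powr_powr)
      also have "\<dots> \<le> e" using A e by (simp add: field_simps)
      finally have "ennreal (A * b powr (q / p)) \<le> ennreal e" by (rule ennreal_leI)
      then show "osc_mass q \<mu> (g 0) f \<le> ennreal (A * a powr (q / p)) + ennreal e"
        using pos[OF b] b True by (meson add_increasing order_trans less_imp_le zero_le)
    qed
  qed
qed

lemma osc_bound_initial:
  assumes p: "1 \<le> p" and q: "0 < q"
  shows "osc_bound TYPE('n::{finite,linorder}) \<epsilon> \<alpha> p q (ennreal V) (2 powr q * V)"
  unfolding osc_bound_def
proof (intro allI impI)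
  fix g :: "nat \<Rightarrow> real \<Rightarrow> (real, 'n) vec" and \<mu> :: "(real, 'n) vec measure" and f :: "real \<Rightarrow> complex" and a :: real
  assume g: "near_moment \<epsilon> g" and \<mu>: "\<mu> \<in> frostman_measures \<alpha> 1" and V: "emeasure \<mu> UNIV \<le> ennreal V"
    and f: "f \<in> borel_measurable borel" and a: "0 < a"
    and fa: "Lp_mass p {0..<1} f \<le> ennreal a"
  have "sets \<mu> = sets borel" using \<mu> by (simp add: frostman_measures_def)
  then have sp: "space \<mu> = UNIV" using sets_eq_imp_space_eq[of \<mu> borel] by simp
  note U = integrable_of_Lp[OF f _ order_refl p a fa, simplified]
  have g0[measurable]: "g 0 \<in> borel_measurable borel" using g by (simp add: near_moment_def)
  have bound: "norm (osc_int {0..<1} (g 0) f x) \<le> 2 * a powr (1 / p)" for x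
  proof -
    note f[measurable]
    have int: "integrable lborel (\<lambda>t. indicator {0..<1} t * (cis (x \<bullet> g 0 t) * f t))"
      by (rule Bochner_Integration.integrable_bound[OF U(1)]) (auto simp: norm_mult)
    have "ennreal (norm (osc_int {0..<1} (g 0) f x)) \<le> (\<integral>\<^sup>+t. ennreal (norm (indicator {0..<1} t * (cis (x \<bullet> g 0 t) * f t))) \<partial>lborel)"
      unfolding osc_int_def by (rule integral_norm_bound_ennreal[OF int])
    also have "\<dots> = (\<integral>\<^sup>+t. ennreal (norm (indicator {0..<1} t * f t)) \<partial>lborel)"
      by (simp add: norm_mult)
    also have "\<dots> \<le> ennreal (2 * a powr (1 / p))" by (rule U(2))
    finally show ?thesis using a by (simp add: ennreal_le_iff)
  qed
  have "osc_mass q \<mu> (g 0) f \<le> (\<integral>\<^sup>+x. ennreal ((2 * a powr (1 / p)) powr q) \<partial>\<mu>)"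
    using q by (intro nn_integral_mono ennreal_leI powr_mono2 bound) auto
  also have "\<dots> = ennreal (2 powr q * a powr (q / p)) * emeasure \<mu> UNIV"
    by (simp add: sp powr_mult powr_powr)
  also have "\<dots> \<le> ennreal (2 powr q * a powr (q / p)) * ennreal V"
    by (intro mult_left_mono V) auto
  also have "\<dots> = ennreal (2 powr q * V * a powr (q / p))"
    by (subst ennreal_mult'[symmetric]) (auto simp: mult_ac)
  finally show "osc_mass q \<mu> (g 0) f \<le> ennreal (2 powr q * V * a powr (q / p))" .
qed

text \<open>Used with \<open>e = q / p\<close> and the masses of the pieces: this is the place where
  \<open>p \<le> q\<close> lets the narrow pieces be added up without a loss in their
  number.\<close>

lemma sum_powr_le:
  fixes u :: "'i \<Rightarrow> real"
  assumes "finite K" and u: "\<And>k. k \<in> K \<Longrightarrow> 0 \<le> u k" and "sum u K \<le> a" and "1 \<le> e" and "0 < a"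
  shows "(\<Sum>k\<in>K. u k powr e) \<le> a powr e"
proof -
  have "(\<Sum>k\<in>K. u k powr e) \<le> (\<Sum>k\<in>K. u k * a powr (e - 1))"
  proof (rule sum_mono)
    fix k assume k: "k \<in> K"
    have "u k \<le> sum u K" using assms(1) k u by (intro member_le_sum) auto
    then have "u k powr (e - 1) \<le> a powr (e - 1)"
      using assms u[OF k] by (intro powr_mono2) auto
    moreover have "u k powr e = u k * u k powr (e - 1)"
      using u[OF k] assms(4) powr_add[of "u k" 1 "e - 1"] by (cases "u k = 0") auto
    ultimately show "u k powr e \<le> u k * a powr (e - 1)"
      using u[OF k] by (simp add: mult_left_mono)
  qed
  also have "\<dots> = sum u K * a powr (e - 1)" by (simp add: sum_distrib_right)
  also have "\<dots> \<le> a * a powr (e - 1)" using assms by (intro mult_right_mono) auto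
  also have "\<dots> = a powr e" using assms(5) powr_add[of a 1 "e - 1"] by simp
  finally show ?thesis .
qed

text \<open>Three effects of the rescaling are combined: \<open>\<kappa>\<close> from the measure,
  the power \<open>- q\<close> of N from the substitution in the integral, and the power
  \<open>q / p\<close> from the enlarged mass of the rescaled function.\<close>

lemma narrow_piece_estimate:
  fixes g :: "nat \<Rightarrow> real \<Rightarrow> (real, 'n::{finite,linorder}) vec"
  assumes bd: "osc_bound TYPE('n) \<epsilon> \<alpha> p q V A" and A: "0 \<le> A" and pq: "0 < p" "0 < q"
    and g: "near_moment \<epsilon> g" and \<mu>: "\<mu> \<in> frostman_measures \<alpha> 1" and mass: "emeasure \<mu> UNIV \<le> V"
    and f[measurable]: "f \<in> borel_measurable borel"
    and c: "0 < c"
    and frame: "\<And>t x. t \<in> {0..1} \<Longrightarrow> c * norm x \<le> norm (\<chi> j::'n. x \<bullet> (moment_deriv (coord_index j) t :: (real, 'n) vec))"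
    and \<epsilon>: "0 \<le> \<epsilon>" "real CARD('n) * \<epsilon> \<le> c / 2"
    and N: "0 < N" "real CARD('n) * (2 / c) * (1 / real N) \<le> 1"
    and m: "m \<le> CARD('n)" and \<alpha>: "0 < \<alpha>"
    and \<kappa>: "\<kappa> = (3 * real CARD('n) / (c / 2)) powr \<alpha> *
        real N powr (real m * \<alpha> + (real CARD('n) - real m) * (real CARD('n) - real m + 1) / 2)" "1 \<le> \<kappa>"
    and t0: "0 \<le> t0" "t0 + 1 / real N \<le> 1"
    and a: "0 \<le> a" and fa: "Lp_mass p {t0..<t0 + 1 / real N} f \<le> ennreal a"
  shows "(\<integral>\<^sup>+x. ennreal (norm (osc_int {t0..<t0 + 1 / real N} (g 0) f x) powr q) \<partial>\<mu>)
    \<le> ennreal (\<kappa> * real N powr (q / p - q) * A * a powr (q / p))"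
proof -
  define h where "h = 1 / real N"
  have h: "0 < h" "h \<le> 1" using N by (auto simp: h_def)
  have "t0 + h \<le> 1" using t0 by (simp add: h_def)
  then have t01: "t0 \<in> {0..1}" using t0(1) h(1) unfolding atLeastAtMost_iff by linarith
  obtain g' where g': "near_moment \<epsilon> g'"
    and phase: "\<And>x s. x \<bullet> (g 0 (t0 + h * s) - g 0 t0) = (\<chi> j::'n. h ^ coord_index j * (x \<bullet> g (coord_index j) t0)) \<bullet> g' 0 s"
    using rescaled_near_moment[OF g c frame[OF t01] \<epsilon> h _ t0(1)] N(2) t0(2) unfolding h_def by blast
  have frame': "c / 2 * norm x \<le> norm (\<chi> j::'n. x \<bullet> g (coord_index j) t0)" for x
  proof (rule perturbed_lower_bound[OF frame[OF t01] _ \<epsilon>(2)])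
    show "norm (g (coord_index j) t0 - moment_deriv (coord_index j) t0) \<le> \<epsilon>" for j :: 'n
      using g coord_index_le[of j] t01 by (auto simp: near_moment_def)
  qed
  define f' where "f' s = f (t0 + h * s)" for s
  have f'[measurable]: "f' \<in> borel_measurable borel" unfolding f'_def by measurable
  have g'0[measurable]: "g' 0 \<in> borel_measurable borel" using g' by (simp add: near_moment_def)
  define F where "F y = ennreal ((h * norm (osc_int {0..<1} (g' 0) f' y)) powr q)" for y
  have [measurable]: "osc_int {0..<1} (g' 0) f' \<in> borel_measurable borel"
    by (rule borel_measurable_osc_int) auto
  have F[measurable]: "F \<in> borel_measurable borel" unfolding F_def by measurable
  have c2: "0 < c / 2" using c by simp
  have N1: "1 \<le> N" using N by simp
  obtain \<nu> :: "(real, 'n) vec measure" where \<nu>: "\<nu> \<in> frostman_measures \<alpha> 1" "emeasure \<nu> UNIV \<le> V"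
    and int\<nu>: "\<And>F. F \<in> borel_measurable borel \<Longrightarrow> (\<integral>\<^sup>+x. F (\<chi> j::'n. h ^ coord_index j * (x \<bullet> g (coord_index j) t0)) \<partial>\<mu>) = ennreal \<kappa> * (\<integral>\<^sup>+y. F y \<partial>\<nu>)"
    using rescaled_measure[OF \<mu> mass c2 frame' N1 m \<alpha> \<kappa>] unfolding h_def by blast
  have [measurable_cong]: "sets \<nu> = sets borel" using \<nu> by (simp add: frostman_measures_def)
  have fa': "Lp_mass p {0..<1} f' \<le> ennreal (real N * a)"
  proof -
    have "Lp_mass p {0..<1} f'
      = ennreal (real N) * Lp_mass p {t0..<t0 + 1 / real N} f"
      using nn_integral_rescale[OF N(1), of "\<lambda>t. ennreal (norm (f t) powr p)" t0] by (simp add: f'_def h_def)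
    also have "\<dots> \<le> ennreal (real N) * ennreal a" by (intro mult_left_mono fa) auto
    finally show ?thesis by (simp add: ennreal_mult')
  qed
  have "(\<integral>\<^sup>+x. ennreal (norm (osc_int {t0..<t0 + 1 / real N} (g 0) f x) powr q) \<partial>\<mu>)
    = (\<integral>\<^sup>+x. F (\<chi> j::'n. h ^ coord_index j * (x \<bullet> g (coord_index j) t0)) \<partial>\<mu>)"
  proof (rule nn_integral_cong)
    fix x
    have "norm (osc_int {t0..<t0 + 1 / real N} (g 0) f x)
      = h * norm (osc_int {0..<1} (g' 0) f' (\<chi> j::'n. h ^ coord_index j * (x \<bullet> g (coord_index j) t0)))"
      unfolding f'_def[abs_def] h_def by (rule osc_int_rescale[OF N(1)]) (rule phase[unfolded h_def])
    then show "ennreal (norm (osc_int {t0..<t0 + 1 / real N} (g 0) f x) powr q)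
      = F (\<chi> j::'n. h ^ coord_index j * (x \<bullet> g (coord_index j) t0))" by (simp add: F_def)
  qed
  also have "\<dots> = ennreal \<kappa> * (\<integral>\<^sup>+y. F y \<partial>\<nu>)" by (rule int\<nu>[OF F])
  also have "(\<integral>\<^sup>+y. F y \<partial>\<nu>) = ennreal (h powr q) * (\<integral>\<^sup>+y. ennreal (norm (osc_int {0..<1} (g' 0) f' y) powr q) \<partial>\<nu>)"
    unfolding F_def powr_mult by (subst nn_integral_cmult[symmetric]) (auto simp: ennreal_mult')
  also have "(\<integral>\<^sup>+y. ennreal (norm (osc_int {0..<1} (g' 0) f' y) powr q) \<partial>\<nu>) \<le> ennreal (A * (real N * a) powr (q / p))"
    by (rule osc_boundD[OF bd g' \<nu> f' A pq _ fa']) (use a in simp)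
  finally have "(\<integral>\<^sup>+x. ennreal (norm (osc_int {t0..<t0 + 1 / real N} (g 0) f x) powr q) \<partial>\<mu>)
    \<le> ennreal \<kappa> * (ennreal (h powr q) * ennreal (A * (real N * a) powr (q / p)))"
    by (simp add: mult_left_mono)
  also have "\<dots> = ennreal (\<kappa> * (h powr q * (A * (real N * a) powr (q / p))))"
    using \<kappa>(2) by (simp add: ennreal_mult')
  also have "\<kappa> * (h powr q * (A * (real N * a) powr (q / p))) = \<kappa> * real N powr (q / p - q) * A * a powr (q / p)"
  proof -
    have "h powr q = real N powr - q"
      using N by (simp add: h_def powr_divide powr_minus_divide)
    then show ?thesis by (simp add: powr_mult powr_diff powr_minus divide_inverse mult_ac)
  qed
  finally show ?thesis .
qed

text \<open>The order of choice matters: the frame constant \<open>c\<close> first, then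
  \<open>N\<close> depending on it, then the transversality constant \<open>c2\<close> for gaps
  \<open>1 / N\<close>, and \<open>\<epsilon>\<^sub>0\<close> last. All of them, and
  \<open>B\<close>, are fixed before \<open>V\<close> and \<open>A\<close> appear, so the step can
  be iterated with one \<open>B\<close>.\<close>

lemma osc_bound_step:
  fixes \<alpha> p s :: real and m :: nat
  defines "d \<equiv> CARD('n::{finite,linorder})"
  assumes \<alpha>: "0 < \<alpha>" and m: "m \<le> d" and p: "1 < p" "s / (s - 1) \<le> p" and s: "2 \<le> s"
    and q: "q = real d * s" "p \<le> q"
    and \<beta>: "\<beta> = real m * \<alpha> + (real d - real m) * (real d - real m + 1) / 2" "\<beta> / q + 1 / p < 1"
  shows "\<exists>\<epsilon>\<^sub>0>0. \<exists>B\<ge>0. \<forall>\<epsilon> V A. 0 \<le> \<epsilon> \<longrightarrow> \<epsilon> \<le> \<epsilon>\<^sub>0 \<longrightarrow> 0 \<le> A \<longrightarrow>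
    osc_bound TYPE('n) \<epsilon> \<alpha> p q (ennreal V) A \<longrightarrow> osc_bound TYPE('n) \<epsilon> \<alpha> p q (ennreal V) (A / 2 + B)"
proof -
  have d: "1 \<le> real d" unfolding d_def using zero_less_card_finite[where 'a='n] by linarith
  have q0: "0 < q" using p q(2) by simp
  have \<beta>0: "0 \<le> \<beta>" using \<alpha> m by (auto simp: \<beta>(1) intro!: add_nonneg_nonneg mult_nonneg_nonneg)
  obtain c0 where c0: "0 < c0"
    "\<forall>t\<in>{0..1}. \<forall>x. c0 * norm x \<le> norm (\<chi> j::'n. x \<bullet> (moment_deriv (coord_index j) t :: (real, 'n) vec))"
    using frame_lower_bound by blast
  \<comment> \<open>Capped at 1 so that \<open>K\<close>, and with it \<open>\<kappa>\<close>, is at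
    least 1, as \<open>rescaled_measure\<close> demands.\<close>
  define c where "c = min c0 1"
  have c: "0 < c" "c \<le> 1" using c0(1) by (auto simp: c_def)
  have frame: "c * norm x \<le> norm (\<chi> j::'n. x \<bullet> (moment_deriv (coord_index j) t :: (real, 'n) vec))" if "t \<in> {0..1}" for t x
  proof -
    have "c * norm x \<le> c0 * norm x" by (intro mult_right_mono) (auto simp: c_def)
    also have "\<dots> \<le> norm (\<chi> j::'n. x \<bullet> (moment_deriv (coord_index j) t :: (real, 'n) vec))"
      using c0(2) that by blast
    finally show ?thesis .
  qed
  define K where "K = (3 * real d / (c / 2)) powr \<alpha>"
  have K: "1 \<le> K" unfolding K_def using c d \<alpha> by (intro ge_one_powr_ge_zero) (auto simp: field_simps)
  \<comment> \<open>The power of N gained by one rescaling; its positivity is the condition on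
    \<open>\<beta>\<close>.\<close>
  define \<delta> where "\<delta> = q - \<beta> - q / p"
  have \<delta>: "0 < \<delta>"
  proof -
    have "q * (\<beta> / q + 1 / p) < q * 1" using \<beta>(2) q0 by (intro mult_strict_left_mono)
    then show ?thesis using q0 by (simp add: \<delta>_def algebra_simps)
  qed
  \<comment> \<open>Normalised so that the total factor of the narrow part is
    \<open>D * real N powr - \<delta> / 2\<close>.\<close>
  define D where "D = 2 * (4 * real d) powr q * K"
  have D: "0 < D" using d K by (simp add: D_def)
  \<comment> \<open>One lower bound makes the narrow factor at most 1/2; the other is the smallness
    of \<open>h = 1 / N\<close> required by \<open>rescaled_near_moment\<close>.\<close>
  define N where "N = nat \<lceil>max (max 1 (D powr (1 / \<delta>))) (real d * (2 / c))\<rceil>"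
  have N_ge: "1 \<le> real N" "D powr (1 / \<delta>) \<le> real N" "real d * (2 / c) \<le> real N"
    unfolding N_def by linarith+
  have N: "0 < N" "real d * (2 / c) * (1 / real N) \<le> 1"
  proof -
    show "0 < N" using N_ge(1) by simp
    then show "real d * (2 / c) * (1 / real N) \<le> 1"
      using mult_right_mono[OF N_ge(3), of "1 / real N"] by simp
  qed
  have N_pow: "D * real N powr - \<delta> \<le> 1"
  proof -
    have "D = (D powr (1 / \<delta>)) powr \<delta>" using D \<delta> by (simp add: powr_powr)
    also have "\<dots> \<le> real N powr \<delta>" using N_ge \<delta> by (intro powr_mono2) auto
    finally show ?thesis using N by (simp add: powr_minus divide_simps)
  qed
  define \<kappa> where "\<kappa> = K * real N powr \<beta>"
  have \<kappa>: "1 \<le> \<kappa>"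
    unfolding \<kappa>_def using mult_mono[of 1 K 1 "real N powr \<beta>"] K N_ge \<beta>0 by (simp add: ge_one_powr_ge_zero)
  have small: "(4 * real d) powr q * (\<kappa> * real N powr (q / p - q)) \<le> 1 / 2"
  proof -
    have "real N powr \<beta> * real N powr (q / p - q) = real N powr - \<delta>"
      by (simp add: powr_add[symmetric] \<delta>_def algebra_simps)
    then have "(4 * real d) powr q * (\<kappa> * real N powr (q / p - q)) = (D * real N powr - \<delta>) / 2"
      by (simp add: \<kappa>_def D_def)
    then show ?thesis using N_pow by simp
  qed
  obtain c2 where c2: "0 < c2" "\<forall>\<sigma> :: (real, 'n) vec. (\<forall>i. \<sigma> $ i \<in> {0..1}) \<and> (\<forall>i j. i \<noteq> j \<longrightarrow> 1 / real N \<le> \<bar>\<sigma> $ i - \<sigma> $ j\<bar>)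
      \<longrightarrow> (\<forall>x. c2 * norm x \<le> norm (\<chi> i. x \<bullet> (moment_deriv 1 (\<sigma> $ i) :: (real, 'n) vec)))"
    using separated_lower_bound[of "1 / real N"] N(1) by auto
  obtain Cm where Cm: "0 < Cm" and multi: "\<And>(\<mu> :: (real, 'n) vec measure) g a b f A \<epsilon>.
    \<mu> \<in> frostman_measures \<alpha> 1 \<Longrightarrow> finite_measure \<mu> \<Longrightarrow> near_moment \<epsilon> g \<Longrightarrow> \<epsilon> \<le> 1 \<Longrightarrow> real CARD('n) * \<epsilon> \<le> c2 / 2 \<Longrightarrow>
    (\<forall>i :: 'n. 0 \<le> a i \<and> b i \<le> 1) \<Longrightarrow>
    (\<forall>\<sigma> x. (\<forall>i. \<sigma> $ i \<in> {a i..b i}) \<longrightarrow> c2 * norm x \<le> norm (\<chi> i. x \<bullet> (moment_deriv 1 (\<sigma> $ i) :: (real, 'n) vec))) \<Longrightarrow>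
    f \<in> borel_measurable borel \<Longrightarrow> 0 < A \<Longrightarrow>
    Lp_mass p {0..<1} f \<le> ennreal A \<Longrightarrow>
    (\<integral>\<^sup>+x. ennreal (norm (\<Prod>i\<in>UNIV. osc_int {a i..<b i} (g 0) f x) powr s) \<partial>\<mu>)
      \<le> ennreal (Cm * A powr (real CARD('n) * s / p))"
    using multilinear_estimate[where 'n='n and \<alpha>=\<alpha>, OF c2(1) s p(2)] by blast
  define \<epsilon>\<^sub>0 where "\<epsilon>\<^sub>0 = min 1 (min (c / (2 * real d)) (c2 / (2 * real d)))"
  have \<epsilon>\<^sub>0: "0 < \<epsilon>\<^sub>0" using c c2 d by (simp add: \<epsilon>\<^sub>0_def)
  define Sep where "Sep = {\<sigma> :: 'n \<Rightarrow> nat. (\<forall>i. \<sigma> i < N) \<and> (\<forall>i j. i \<noteq> j \<longrightarrow> 2 \<le> \<bar>int (\<sigma> i) - int (\<sigma> j)\<bar>)}"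
  have finSep: "finite Sep" unfolding Sep_def by (rule finite_separated)
  define B where "B = (2 * real N) powr q * (real (card Sep) * Cm)"
  have B: "0 \<le> B" using Cm by (simp add: B_def)
  show ?thesis
  proof (rule exI[of _ \<epsilon>\<^sub>0], rule conjI[OF \<epsilon>\<^sub>0], rule exI[of _ B], rule conjI[OF B], intro allI impI)
    fix \<epsilon> V A assume \<epsilon>: "0 \<le> \<epsilon>" "\<epsilon> \<le> \<epsilon>\<^sub>0" and A: "0 \<le> A"
      and bd: "osc_bound TYPE('n) \<epsilon> \<alpha> p q (ennreal V) A"
    have \<epsilon>1: "\<epsilon> \<le> 1" "real d * \<epsilon> \<le> c / 2" "real d * \<epsilon> \<le> c2 / 2"
      using \<epsilon> d by (auto simp: \<epsilon>\<^sub>0_def field_simps)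
    show "osc_bound TYPE('n) \<epsilon> \<alpha> p q (ennreal V) (A / 2 + B)"
      unfolding osc_bound_def
    proof (intro allI impI)
      fix g :: "nat \<Rightarrow> real \<Rightarrow> (real, 'n) vec" and \<mu> :: "(real, 'n) vec measure" and f :: "real \<Rightarrow> complex" and a :: real
      assume g: "near_moment \<epsilon> g" and \<mu>: "\<mu> \<in> frostman_measures \<alpha> 1" and V: "emeasure \<mu> UNIV \<le> ennreal V"
        and f[measurable]: "f \<in> borel_measurable borel" and a: "0 < a"
        and fa: "Lp_mass p {0..<1} f \<le> ennreal a"
      have sets[measurable_cong]: "sets \<mu> = sets borel" using \<mu> by (simp add: frostman_measures_def)
      have sp: "space \<mu> = UNIV" using sets_eq_imp_space_eq[OF sets] by simp
      have fin: "finite_measure \<mu>"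
        by (rule finite_measureI) (use V in \<open>auto simp: sp top_unique\<close>)
      have [measurable]: "g 0 \<in> borel_measurable borel" using g by (simp add: near_moment_def)
      define J where "J k = {real k / real N..<(real k + 1) / real N}" for k
      have J_alt: "J k = {real k / real N..<real k / real N + 1 / real N}" for k by (simp add: J_def add_divide_distrib)
      have J_meas[measurable]: "J k \<in> sets borel" for k by (simp add: J_def)
      have J_sub: "J k \<subseteq> {0..<1}" if "k < N" for k
      proof -
        have "real k + 1 \<le> real N" using that by linarith
        then have "0 \<le> real k / real N" "(real k + 1) / real N \<le> 1" by auto
        then show ?thesis unfolding J_def by auto
      qed
      define z where "z x k = osc_int (J k) (g 0) f x" for x k
      have z_meas[measurable]: "(\<lambda>x. z x k) \<in> borel_measurable borel" for k
        unfolding z_def using borel_measurable_osc_int[of f "J k" "g 0"] by simp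
      have split: "osc_int {0..<1} (g 0) f x = (\<Sum>k<N. z x k)" for x
        unfolding z_def J_def
        by (rule osc_int_split[OF f _ _ N(1)]) (use p integrable_of_Lp(1)[OF f _ order_refl _ a fa] in auto)
      define \<theta> where "\<theta> k = enn2real (Lp_mass p (J k) f)" for k
      have sumJ: "(\<Sum>k<N. Lp_mass p (J k) f) \<le> ennreal a"
      proof -
        have "(\<Sum>k<N. indicator (J k) t :: ennreal) \<le> indicator {0..<1} t" for t
        proof -
          have disj: "disjoint_family_on J {..<N}"
            unfolding disjoint_family_on_def J_def using N(1) by (auto simp: field_simps) 
          then have "(\<Sum>k<N. indicator (J k) t :: ennreal) = indicator (\<Union>k<N. J k) t"
            by (subst indicator_UN_disjoint) auto
          also have "\<dots> \<le> indicator {0..<1} t"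
            by (rule indicator_leI) (use UN_least[of "{..<N}" J "{0..<1}"] J_sub in blast)
          finally show ?thesis .
        qed
        then have "(\<integral>\<^sup>+t. (\<Sum>k<N. ennreal (norm (f t) powr p) * indicator (J k) t) \<partial>lborel)
          \<le> Lp_mass p {0..<1} f"
          by (intro nn_integral_mono) (simp add: sum_distrib_left[symmetric] mult_left_mono)
        then show ?thesis using fa by (subst nn_integral_sum[symmetric]) (auto intro: order_trans)
      qed
      have J_fin: "Lp_mass p (J k) f = ennreal (\<theta> k)" if "k < N" for k
      proof -
        have "Lp_mass p (J k) f
          \<le> (\<Sum>k<N. Lp_mass p (J k) f)"
          using that by (intro member_le_sum) auto
        from order_trans[OF this sumJ]
        have "Lp_mass p (J k) f < top"
          using ennreal_less_top le_less_trans by blast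
        then show ?thesis by (simp add: \<theta>_def)
      qed
      have \<theta>0: "0 \<le> \<theta> k" for k by (simp add: \<theta>_def)
      have \<theta>_sum: "(\<Sum>k<N. \<theta> k) \<le> a"
      proof -
        have "ennreal (\<Sum>k<N. \<theta> k) = (\<Sum>k<N. ennreal (\<theta> k))"
          by (rule sum_ennreal[symmetric]) (rule \<theta>0)
        also have "\<dots> = (\<Sum>k<N. Lp_mass p (J k) f)"
          by (intro sum.cong refl) (simp add: J_fin)
        also note sumJ
        finally have "ennreal (\<Sum>k<N. \<theta> k) \<le> ennreal a" .
        then show ?thesis using a by (simp add: ennreal_le_iff)
      qed
      have narrow: "(\<integral>\<^sup>+x. ennreal (norm (z x k) powr q) \<partial>\<mu>) \<le> ennreal (\<kappa> * real N powr (q / p - q) * A * \<theta> k powr (q / p))"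
        if k: "k < N" for k
        unfolding z_def J_alt
      proof (rule narrow_piece_estimate[OF bd A _ q0 g \<mu> V f c(1) frame \<epsilon>(1)])
        show "real CARD('n) * \<epsilon> \<le> c / 2" using \<epsilon>1 by (simp add: d_def)
        show "real CARD('n) * (2 / c) * (1 / real N) \<le> 1" using N by (simp add: d_def)
        show "\<kappa> = (3 * real CARD('n) / (c / 2)) powr \<alpha> *
          real N powr (real m * \<alpha> + (real CARD('n) - real m) * (real CARD('n) - real m + 1) / 2)"
          by (simp add: \<kappa>_def K_def \<beta>(1) d_def)
        show "real k / real N + 1 / real N \<le> 1" using k N(1) by (simp add: field_simps)
        show "Lp_mass p {real k / real N..<real k / real N + 1 / real N} f \<le> ennreal (\<theta> k)"
          using J_fin[OF k] by (simp add: J_alt)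
      qed (use p N m \<alpha> \<kappa> \<theta>0 in \<open>auto simp: d_def\<close>)
      have broad: "(\<integral>\<^sup>+x. ennreal (norm (\<Prod>i\<in>UNIV. z x (\<sigma> i)) powr s) \<partial>\<mu>) \<le> ennreal (Cm * a powr (q / p))"
        if \<sigma>: "\<sigma> \<in> Sep" for \<sigma>
        unfolding z_def J_def q(1) d_def
      proof (rule multi[OF \<mu> fin g \<epsilon>1(1) _ _ _ f a fa])
        show "real CARD('n) * \<epsilon> \<le> c2 / 2" using \<epsilon>1 by (simp add: d_def)
        show range: "\<forall>i. 0 \<le> real (\<sigma> i) / real N \<and> (real (\<sigma> i) + 1) / real N \<le> 1"
        proof
          fix i
          have "\<sigma> i < N" using \<sigma> by (simp add: Sep_def)
          then have "real (\<sigma> i) + 1 \<le> real N" by linarith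
          then show "0 \<le> real (\<sigma> i) / real N \<and> (real (\<sigma> i) + 1) / real N \<le> 1" by auto
        qed
        show "\<forall>\<tau> x. (\<forall>i. \<tau> $ i \<in> {real (\<sigma> i) / real N..(real (\<sigma> i) + 1) / real N}) \<longrightarrow>
          c2 * norm x \<le> norm (\<chi> i. x \<bullet> (moment_deriv 1 (\<tau> $ i) :: (real, 'n) vec))"
        proof (intro allI impI)
          fix \<tau> x :: "(real, 'n) vec"
          assume \<tau>: "\<forall>i. \<tau> $ i \<in> {real (\<sigma> i) / real N..(real (\<sigma> i) + 1) / real N}"
          have 1: "\<tau> $ i \<in> {0..1}" for i
            using \<tau>[rule_format, of i] range[rule_format, of i] unfolding atLeastAtMost_iff by linarith
          \<comment> \<open>Skipping one index leaves a whole piece of length \<open>1 / N\<close>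
            between the two closed intervals.\<close>
          have lt: "1 / real N \<le> \<tau> $ j - \<tau> $ i" if "\<sigma> i + 2 \<le> \<sigma> j" for i j
          proof -
            have "(real (\<sigma> i) + 1) / real N + 1 / real N \<le> real (\<sigma> j) / real N"
              using that N(1) by (simp add: add_divide_distrib[symmetric] divide_right_mono)
            then show ?thesis using \<tau>[rule_format, of i] \<tau>[rule_format, of j] unfolding atLeastAtMost_iff by linarith
          qed
          have 2: "1 / real N \<le> \<bar>\<tau> $ i - \<tau> $ j\<bar>" if "i \<noteq> j" for i j
          proof -
            have "2 \<le> \<bar>int (\<sigma> i) - int (\<sigma> j)\<bar>" using \<sigma> that by (auto simp: Sep_def)
            then have "\<sigma> i + 2 \<le> \<sigma> j \<or> \<sigma> j + 2 \<le> \<sigma> i" by linarith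
            then show ?thesis using lt[of i j] lt[of j i] by linarith
          qed
          show "c2 * norm x \<le> norm (\<chi> i. x \<bullet> (moment_deriv 1 (\<tau> $ i) :: (real, 'n) vec))"
            using c2(2) 1 2 by blast
        qed
      qed
      have pt: "ennreal (norm (osc_int {0..<1} (g 0) f x) powr q)
        \<le> ennreal ((4 * real d) powr q) * (\<Sum>k<N. ennreal (norm (z x k) powr q))
          + ennreal ((2 * real N) powr q) * (\<Sum>\<sigma>\<in>Sep. ennreal (norm (\<Prod>i\<in>UNIV. z x (\<sigma> i)) powr s))" for x
      proof -
        have "norm (osc_int {0..<1} (g 0) f x) powr q \<le> (4 * real d) powr q * (\<Sum>k<N. norm (z x k) powr q)
          + (2 * real N) powr q * (\<Sum>\<sigma>\<in>Sep. norm (\<Prod>i\<in>UNIV. z x (\<sigma> i)) powr s)"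
          using broad_narrow_powr[OF N(1), of s "z x", where 'n='n] s unfolding split Sep_def q(1) d_def by simp
        then have "ennreal (norm (osc_int {0..<1} (g 0) f x) powr q) \<le> ennreal ((4 * real d) powr q * (\<Sum>k<N. norm (z x k) powr q))
          + ennreal ((2 * real N) powr q * (\<Sum>\<sigma>\<in>Sep. norm (\<Prod>i\<in>UNIV. z x (\<sigma> i)) powr s))"
          by (rule ennreal_leI_add) (auto intro!: mult_nonneg_nonneg sum_nonneg)
        then show ?thesis by (simp add: ennreal_mult' sum_ennreal)
      qed
      have "osc_mass q \<mu> (g 0) f
        \<le> (\<integral>\<^sup>+x. ennreal ((4 * real d) powr q) * (\<Sum>k<N. ennreal (norm (z x k) powr q))
          + ennreal ((2 * real N) powr q) * (\<Sum>\<sigma>\<in>Sep. ennreal (norm (\<Prod>i\<in>UNIV. z x (\<sigma> i)) powr s)) \<partial>\<mu>)"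
        by (intro nn_integral_mono pt)
      also have "\<dots> = ennreal ((4 * real d) powr q) * (\<Sum>k<N. \<integral>\<^sup>+x. ennreal (norm (z x k) powr q) \<partial>\<mu>)
          + ennreal ((2 * real N) powr q) * (\<Sum>\<sigma>\<in>Sep. \<integral>\<^sup>+x. ennreal (norm (\<Prod>i\<in>UNIV. z x (\<sigma> i)) powr s) \<partial>\<mu>)"
        by (subst nn_integral_add, measurable, subst (1 2) nn_integral_cmult, measurable, subst (1 2) nn_integral_sum, measurable)
      also have "\<dots> \<le> ennreal ((4 * real d) powr q) * (\<Sum>k<N. ennreal (\<kappa> * real N powr (q / p - q) * A * \<theta> k powr (q / p)))
          + ennreal ((2 * real N) powr q) * (\<Sum>\<sigma>\<in>Sep. ennreal (Cm * a powr (q / p)))"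
        by (intro add_mono mult_left_mono sum_mono narrow broad) auto
      also have "\<dots> = ennreal ((4 * real d) powr q * (\<Sum>k<N. \<kappa> * real N powr (q / p - q) * A * \<theta> k powr (q / p))
          + (2 * real N) powr q * (\<Sum>\<sigma>\<in>Sep. Cm * a powr (q / p)))"
      proof -
        have 1: "(\<Sum>k<N. ennreal (\<kappa> * real N powr (q / p - q) * A * \<theta> k powr (q / p)))
          = ennreal (\<Sum>k<N. \<kappa> * real N powr (q / p - q) * A * \<theta> k powr (q / p))"
          using \<kappa> A by (intro sum_ennreal) auto
        have 2: "(\<Sum>\<sigma>\<in>Sep. ennreal (Cm * a powr (q / p))) = ennreal (\<Sum>\<sigma>\<in>Sep. Cm * a powr (q / p))"
          using Cm by (intro sum_ennreal) auto
        have n1: "0 \<le> (4 * real d) powr q * (\<Sum>k<N. \<kappa> * real N powr (q / p - q) * A * \<theta> k powr (q / p))"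
          using \<kappa> A by (auto intro!: mult_nonneg_nonneg sum_nonneg)
        have n2: "0 \<le> (2 * real N) powr q * (\<Sum>\<sigma>\<in>Sep. Cm * a powr (q / p))"
          using Cm by (auto intro!: mult_nonneg_nonneg sum_nonneg)
        show ?thesis
          unfolding 1 2 ennreal_plus[OF n1 n2] by (simp only: ennreal_mult'[OF powr_ge_zero])
      qed
      also have "\<dots> \<le> ennreal ((A / 2 + B) * a powr (q / p))"
      proof (rule ennreal_leI)
        have "(\<Sum>k<N. \<theta> k powr (q / p)) \<le> a powr (q / p)"
          using p q by (intro sum_powr_le \<theta>0 \<theta>_sum a) auto
        then have "((4 * real d) powr q * (\<kappa> * real N powr (q / p - q))) * (A * (\<Sum>k<N. \<theta> k powr (q / p))) \<le> 1 / 2 * (A * a powr (q / p))"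
          using A \<kappa> by (intro mult_mono small) (auto intro!: mult_nonneg_nonneg sum_nonneg)
        moreover have e: "(\<Sum>k<N. \<kappa> * real N powr (q / p - q) * A * \<theta> k powr (q / p))
          = \<kappa> * real N powr (q / p - q) * A * (\<Sum>k<N. \<theta> k powr (q / p))"
          by (simp only: sum_distrib_left)
        ultimately show "(4 * real d) powr q * (\<Sum>k<N. \<kappa> * real N powr (q / p - q) * A * \<theta> k powr (q / p))
          + (2 * real N) powr q * (\<Sum>\<sigma>\<in>Sep. Cm * a powr (q / p)) \<le> (A / 2 + B) * a powr (q / p)"
          unfolding e by (simp add: B_def algebra_simps)
      qed
      finally show "osc_mass q \<mu> (g 0) f \<le> ennreal ((A / 2 + B) * a powr (q / p))" .
    qed
  qed
qed

section \<open>Removal of the normalisations\<close>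

text \<open>\<open>2 * B\<close> is the fixed point of the map sending \<open>A\<close> to
  \<open>A / 2 + B\<close>, and the distance to it halves at each step. The limit is taken for fixed
  data, so the finite starting constant disappears from the result.\<close>

lemma osc_bound_iterate:
  fixes B A\<^sub>0 :: real
  assumes step: "\<And>A. 0 \<le> A \<Longrightarrow> osc_bound TYPE('n::{finite,linorder}) \<epsilon> \<alpha> p q V A \<Longrightarrow> osc_bound TYPE('n) \<epsilon> \<alpha> p q V (A / 2 + B)"
    and A\<^sub>0: "0 \<le> A\<^sub>0" "osc_bound TYPE('n) \<epsilon> \<alpha> p q V A\<^sub>0" and B: "0 \<le> B"
  shows "osc_bound TYPE('n) \<epsilon> \<alpha> p q V (2 * B)"
proof -
  have iter: "osc_bound TYPE('n) \<epsilon> \<alpha> p q V (A\<^sub>0 * (1/2) ^ k + 2 * B)" for k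
  proof (induction k)
    case 0
    show ?case
      unfolding osc_bound_def
    proof (intro allI impI)
      fix g :: "nat \<Rightarrow> real \<Rightarrow> (real, 'n) vec" and \<mu> :: "(real, 'n) vec measure" and f :: "real \<Rightarrow> complex" and a :: real
      assume "near_moment \<epsilon> g" "\<mu> \<in> frostman_measures \<alpha> 1" "emeasure \<mu> UNIV \<le> V" "f \<in> borel_measurable borel"
        "0 < a" "Lp_mass p {0..<1} f \<le> ennreal a"
      then have "osc_mass q \<mu> (g 0) f \<le> ennreal (A\<^sub>0 * a powr (q / p))"
        using A\<^sub>0(2) unfolding osc_bound_def by blast
      also have "\<dots> \<le> ennreal ((A\<^sub>0 * (1/2) ^ 0 + 2 * B) * a powr (q / p))"
        using B by (intro ennreal_leI mult_right_mono) auto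
      finally show "osc_mass q \<mu> (g 0) f
        \<le> ennreal ((A\<^sub>0 * (1/2) ^ 0 + 2 * B) * a powr (q / p))" .
    qed
  next
    case (Suc k)
    have "0 \<le> A\<^sub>0 * (1/2) ^ k + 2 * B" using A\<^sub>0 B by simp
    from step[OF this Suc] show ?case by (simp add: field_simps)
  qed
  show ?thesis
    unfolding osc_bound_def
  proof (intro allI impI)
    fix g :: "nat \<Rightarrow> real \<Rightarrow> (real, 'n) vec" and \<mu> :: "(real, 'n) vec measure" and f :: "real \<Rightarrow> complex" and a :: real
    assume "near_moment \<epsilon> g" "\<mu> \<in> frostman_measures \<alpha> 1" "emeasure \<mu> UNIV \<le> V" "f \<in> borel_measurable borel"
      "0 < a" "Lp_mass p {0..<1} f \<le> ennreal a"
    then have "osc_mass q \<mu> (g 0) f \<le> ennreal ((A\<^sub>0 * (1/2) ^ k + 2 * B) * a powr (q / p))" for k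
      using iter[of k] unfolding osc_bound_def by blast
    moreover have "(\<lambda>k. ennreal ((A\<^sub>0 * (1/2) ^ k + 2 * B) * a powr (q / p))) \<longlonglongrightarrow> ennreal ((A\<^sub>0 * 0 + 2 * B) * a powr (q / p))"
      by (intro tendsto_ennrealI tendsto_intros LIMSEQ_power_zero) auto
    ultimately show "osc_mass q \<mu> (g 0) f \<le> ennreal (2 * B * a powr (q / p))"
      by (auto intro: LIMSEQ_le_const)
  qed
qed

text \<open>The starting constant from \<open>osc_bound_initial\<close> grows with \<open>V\<close>,
  but the iteration forgets it; hence one \<open>B\<close> serves all caps on the mass.\<close>

lemma osc_bound_finite_mass:
  fixes \<alpha> p s :: real and m :: nat
  defines "d \<equiv> CARD('n::{finite,linorder})"
  assumes \<alpha>: "0 < \<alpha>" and m: "m \<le> d" and p: "1 < p" "s / (s - 1) \<le> p" and s: "2 \<le> s"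
    and q: "q = real d * s" "p \<le> q"
    and \<beta>: "\<beta> = real m * \<alpha> + (real d - real m) * (real d - real m + 1) / 2" "\<beta> / q + 1 / p < 1"
  shows "\<exists>\<epsilon>\<^sub>0>0. \<exists>B\<ge>0. \<forall>\<epsilon> V. 0 \<le> \<epsilon> \<longrightarrow> \<epsilon> \<le> \<epsilon>\<^sub>0 \<longrightarrow> 0 \<le> V \<longrightarrow> osc_bound TYPE('n) \<epsilon> \<alpha> p q (ennreal V) B"
proof -
  obtain \<epsilon>\<^sub>0 B where *: "0 < \<epsilon>\<^sub>0" "0 \<le> B" "\<And>\<epsilon> V A. 0 \<le> \<epsilon> \<Longrightarrow> \<epsilon> \<le> \<epsilon>\<^sub>0 \<Longrightarrow> 0 \<le> A \<Longrightarrow>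
    osc_bound TYPE('n) \<epsilon> \<alpha> p q (ennreal V) A \<Longrightarrow> osc_bound TYPE('n) \<epsilon> \<alpha> p q (ennreal V) (A / 2 + B)"
    using osc_bound_step[where 'n='n, OF \<alpha> m[unfolded d_def] p s q(1)[unfolded d_def] q(2) \<beta>(1)[unfolded d_def] \<beta>(2)] by blast
  have "osc_bound TYPE('n) \<epsilon> \<alpha> p q (ennreal V) (2 * B)" if "0 \<le> \<epsilon>" "\<epsilon> \<le> \<epsilon>\<^sub>0" "0 \<le> V" for \<epsilon> V
    using p q that *
    by (intro osc_bound_iterate[where A\<^sub>0="2 powr q * V"] osc_bound_initial) auto
  then show ?thesis using *(1,2) by (intro exI[of _ \<epsilon>\<^sub>0] conjI exI[of _ "2 * B"]) auto
qed

text \<open>Restricting the measure to a ball about the origin keeps it in the class and makes its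
  mass finite. As the bound does not see that mass, monotone convergence over growing balls
  finishes.\<close>

lemma osc_bound_any_mass:
  assumes bd: "\<And>V. 0 \<le> V \<Longrightarrow> osc_bound TYPE('n::{finite,linorder}) \<epsilon> \<alpha> p q (ennreal V) B"
  shows "osc_bound TYPE('n) \<epsilon> \<alpha> p q \<infinity> B"
  unfolding osc_bound_def
proof (intro allI impI)
  fix g :: "nat \<Rightarrow> real \<Rightarrow> (real, 'n) vec" and \<mu> :: "(real, 'n) vec measure" and f :: "real \<Rightarrow> complex" and a :: real
  assume g: "near_moment \<epsilon> g" and \<mu>: "\<mu> \<in> frostman_measures \<alpha> 1" and f[measurable]: "f \<in> borel_measurable borel"
    and a: "0 < a" "Lp_mass p {0..<1} f \<le> ennreal a"
  have sets[measurable_cong]: "sets \<mu> = sets borel"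
    and fr: "\<And>x \<rho>. 0 < \<rho> \<Longrightarrow> emeasure \<mu> (ball x \<rho>) \<le> ennreal (\<rho> powr \<alpha>)"
    using \<mu> by (auto simp: frostman_measures_def)
  have [measurable]: "g 0 \<in> borel_measurable borel" using g by (simp add: near_moment_def)
  have [measurable]: "ball y r \<in> sets (borel :: (real, 'n) vec measure)" "ball y r \<in> sets \<mu>" for y r
    by (simp_all add: sets)
  define F where "F x = ennreal (norm (osc_int {0..<1} (g 0) f x) powr q)" for x
  have [measurable]: "osc_int {0..<1} (g 0) f \<in> borel_measurable borel"
    by (rule borel_measurable_osc_int) auto
  have [measurable]: "F \<in> borel_measurable borel" unfolding F_def by measurable
  have trunc: "(\<integral>\<^sup>+x. F x * indicator (ball 0 (real k + 1)) x \<partial>\<mu>) \<le> ennreal (B * a powr (q / p))" for k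
  proof -
    define \<nu> where "\<nu> = density \<mu> (indicator (ball 0 (real k + 1)))"
    have em: "emeasure \<nu> A = emeasure \<mu> (ball 0 (real k + 1) \<inter> A)" if "A \<in> sets borel" for A
      unfolding \<nu>_def using that by (subst emeasure_density) (auto simp: sets indicator_inter_arith[symmetric])
    have "\<nu> \<in> frostman_measures \<alpha> 1"
      unfolding frostman_measures_def
    proof (intro CollectI conjI allI impI)
      show "sets \<nu> = sets borel" by (simp add: \<nu>_def sets)
      fix x :: "(real, 'n) vec" and \<rho> :: real assume "0 < \<rho>"
      have "emeasure \<nu> (ball x \<rho>) \<le> emeasure \<mu> (ball x \<rho>)"
        by (subst em) (auto intro!: emeasure_mono simp: sets)
      then show "emeasure \<nu> (ball x \<rho>) \<le> ennreal (1 * \<rho> powr \<alpha>)"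
        using fr[OF \<open>0 < \<rho>\<close>, of x] by simp
    qed
    moreover have "emeasure \<nu> UNIV \<le> ennreal ((real k + 1) powr \<alpha>)"
      using fr[of "real k + 1" 0] by (subst em) auto
    ultimately have "(\<integral>\<^sup>+x. F x \<partial>\<nu>) \<le> ennreal (B * a powr (q / p))"
      using bd[of "(real k + 1) powr \<alpha>"] g f a unfolding osc_bound_def F_def by auto
    then show ?thesis
      unfolding \<nu>_def by (subst (asm) nn_integral_density) (auto simp: mult.commute)
  qed
  have "(\<integral>\<^sup>+x. F x \<partial>\<mu>) = (\<integral>\<^sup>+x. (SUP k. F x * indicator (ball 0 (real k + 1)) x) \<partial>\<mu>)"
  proof (rule nn_integral_cong)
    fix x
    have "F x \<le> (SUP k. F x * indicator (ball 0 (real k + 1)) x)"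
    proof -
      obtain k :: nat where "norm x \<le> real k" using real_arch_simple by blast
      then have "F x = F x * indicator (ball 0 (real k + 1)) x" by simp
      also have "\<dots> \<le> (SUP k. F x * indicator (ball 0 (real k + 1)) x)" by (rule SUP_upper) simp
      finally show ?thesis .
    qed
    moreover have "(SUP k. F x * indicator (ball 0 (real k + 1)) x) \<le> F x"
      by (rule SUP_least) (auto simp: indicator_def)
    ultimately show "F x = (SUP k. F x * indicator (ball 0 (real k + 1)) x)" by (rule antisym)
  qed
  also have "\<dots> = (SUP k. \<integral>\<^sup>+x. F x * indicator (ball 0 (real k + 1)) x \<partial>\<mu>)"
  proof (rule nn_integral_monotone_convergence_SUP)
    show "incseq (\<lambda>k x. F x * indicator (ball 0 (real k + 1)) x)"
      by (auto simp: incseq_def le_fun_def indicator_def)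
  qed measurable
  also have "\<dots> \<le> ennreal (B * a powr (q / p))" by (rule SUP_least) (rule trunc)
  finally show "osc_mass q \<mu> (g 0) f \<le> ennreal (B * a powr (q / p))"
    by (simp add: F_def)
qed

text \<open>A ball of radius \<open>\<rho>\<close> pulls back to one of radius
  \<open>\<rho> / lam\<close>, so the image measure times \<open>lam powr \<alpha>\<close> satisfies
  the same ball condition. The compensating factor is the entire decay in the frequency.\<close>

lemma dilated_frostman:
  fixes \<mu> :: "(real ^ 'n) measure"
  assumes \<mu>: "\<mu> \<in> frostman_measures \<alpha> 1" and lam: "0 < lam"
  shows "\<exists>\<nu>\<in>frostman_measures \<alpha> 1. \<forall>F\<in>borel_measurable borel.
    (\<integral>\<^sup>+x. F (lam *\<^sub>R x) \<partial>\<mu>) = ennreal (lam powr - \<alpha>) * (\<integral>\<^sup>+y. F y \<partial>\<nu>)"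
proof -
  have sets[measurable_cong]: "sets \<mu> = sets borel" using \<mu> by (simp add: frostman_measures_def)
  have [simp]: "space \<mu> = UNIV" using sets_eq_imp_space_eq[OF sets] by simp
  define \<nu> where "\<nu> = scale_measure (ennreal (lam powr \<alpha>)) (distr \<mu> borel (\<lambda>x. lam *\<^sub>R x))"
  have "\<nu> \<in> frostman_measures \<alpha> 1"
    unfolding frostman_measures_def
  proof (intro CollectI conjI allI impI)
    show "sets \<nu> = sets borel" by (simp add: \<nu>_def)
    fix y :: "real ^ 'n" and \<rho> :: real assume \<rho>: "0 < \<rho>"
    have "(\<lambda>x. lam *\<^sub>R x) -` ball y \<rho> = ball (y /\<^sub>R lam) (\<rho> / lam)"
    proof (rule set_eqI)
      fix x
      have "dist y (lam *\<^sub>R x) = lam * dist (y /\<^sub>R lam) x"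
      proof -
        have "y - lam *\<^sub>R x = lam *\<^sub>R (y /\<^sub>R lam - x)" using lam by (simp add: scaleR_diff_right)
        then show ?thesis using lam by (simp add: dist_norm)
      qed
      then show "x \<in> (\<lambda>x. lam *\<^sub>R x) -` ball y \<rho> \<longleftrightarrow> x \<in> ball (y /\<^sub>R lam) (\<rho> / lam)"
        using lam by (simp add: field_simps)
    qed
    then have "emeasure \<nu> (ball y \<rho>) = ennreal (lam powr \<alpha>) * emeasure \<mu> (ball (y /\<^sub>R lam) (\<rho> / lam))"
      unfolding \<nu>_def by (simp add: emeasure_distr)
    also have "\<dots> \<le> ennreal (lam powr \<alpha>) * ennreal (1 * (\<rho> / lam) powr \<alpha>)"
      using \<mu> \<rho> lam by (intro mult_left_mono) (auto simp: frostman_measures_def)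
    also have "\<dots> = ennreal (1 * \<rho> powr \<alpha>)"
      using lam \<rho> by (simp add: ennreal_mult'[symmetric] powr_divide)
    finally show "emeasure \<nu> (ball y \<rho>) \<le> ennreal (1 * \<rho> powr \<alpha>)" .
  qed
  moreover have "(\<integral>\<^sup>+x. F (lam *\<^sub>R x) \<partial>\<mu>) = ennreal (lam powr - \<alpha>) * (\<integral>\<^sup>+y. F y \<partial>\<nu>)"
    if [measurable]: "F \<in> borel_measurable borel" for F
  proof -
    have "(\<integral>\<^sup>+y. F y \<partial>\<nu>) = ennreal (lam powr \<alpha>) * (\<integral>\<^sup>+x. F (lam *\<^sub>R x) \<partial>\<mu>)"
      unfolding \<nu>_def by (subst nn_integral_scale_measure) (auto simp: nn_integral_distr)
    moreover have "ennreal (lam powr - \<alpha>) * (ennreal (lam powr \<alpha>) * z) = z" for z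
      using lam by (subst ennreal_mult_assoc) (auto simp: powr_add[symmetric])
    ultimately show ?thesis by simp
  qed
  ultimately show ?thesis by blast
qed

text \<open>The functions of the theorem are only Lebesgue measurable, while the product integrals
  and substitutions above are set up for Borel functions. Real and imaginary parts are modified
  separately.\<close>

lemma borel_representative:
  fixes f :: "real \<Rightarrow> complex"
  assumes "f \<in> borel_measurable (lebesgue_on {0..1})"
  shows "\<exists>f'\<in>borel_measurable borel. AE t in lborel. t \<in> {0..1} \<longrightarrow> f t = f' t"
proof -
  have "(\<lambda>t. indicator {0..1} t *\<^sub>R f t) \<in> borel_measurable lebesgue"
    using assms by (subst (asm) borel_measurable_restrict_space_iff) auto
  then have "(\<lambda>t. Re (indicator {0..1} t *\<^sub>R f t)) \<in> borel_measurable lebesgue"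
    "(\<lambda>t. Im (indicator {0..1} t *\<^sub>R f t)) \<in> borel_measurable lebesgue" by measurable
  from this[THEN completion_ex_borel_measurable_real]
  obtain u v where uv: "u \<in> borel_measurable lborel" "v \<in> borel_measurable lborel"
    "AE t in lborel. Re (indicator {0..1} t *\<^sub>R f t) = u t" "AE t in lborel. Im (indicator {0..1} t *\<^sub>R f t) = v t"
    by blast
  have [measurable]: "u \<in> borel_measurable borel" "v \<in> borel_measurable borel" using uv by auto
  have "(\<lambda>t. Complex (u t) (v t)) \<in> borel_measurable borel"
    unfolding Complex_eq by measurable
  moreover have "AE t in lborel. t \<in> {0..1} \<longrightarrow> f t = Complex (u t) (v t)"
    using uv(3,4) by eventually_elim (auto simp: complex_eq_iff)
  ultimately show ?thesis by (intro bexI[of _ "\<lambda>t. Complex (u t) (v t)"])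
qed

lemma lebesgue_on_nn_integral_eq:
  fixes f f' :: "real \<Rightarrow> complex"
  assumes f: "f \<in> borel_measurable (lebesgue_on {0..1})" and f'[measurable]: "f' \<in> borel_measurable borel"
    and eq: "AE t in lborel. t \<in> {0..1} \<longrightarrow> f t = f' t"
  shows "(\<integral>\<^sup>+t. ennreal (norm (f t) powr p) \<partial>(lebesgue_on {0..1})) = Lp_mass p {0..1} f'"
proof -
  have "(\<integral>\<^sup>+t. ennreal (norm (f t) powr p) \<partial>(lebesgue_on {0..1})) = (\<integral>\<^sup>+t. ennreal (norm (f t) powr p) * indicator {0..1} t \<partial>lebesgue)"
    by (rule nn_integral_restrict_space) auto
  also have "\<dots> = (\<integral>\<^sup>+t. ennreal (norm (f' t) powr p) * indicator {0..1} t \<partial>lebesgue)"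
    by (rule nn_integral_cong_AE) (use AE_completion[OF eq] in \<open>eventually_elim, auto simp: indicator_def\<close>)
  also have "\<dots> = Lp_mass p {0..1} f'"
    by (rule nn_integral_completion)
  finally show ?thesis .
qed

text \<open>The frequency moves into the point, the end point 1 is a null set, and the completed and
  the Borel measure integrate Borel functions alike.\<close>

lemma osc_op_eq_osc_int:
  fixes f f' :: "real \<Rightarrow> complex" and \<gamma> \<gamma>' :: "real \<Rightarrow> real ^ 'n"
  assumes f: "f \<in> borel_measurable (lebesgue_on {0..1})" and f'[measurable]: "f' \<in> borel_measurable borel"
    and eq: "AE t in lborel. t \<in> {0..1} \<longrightarrow> f t = f' t"
    and \<gamma>'[measurable]: "\<gamma>' \<in> borel_measurable borel" and \<gamma>: "\<And>t. t \<in> {0..1} \<Longrightarrow> \<gamma>' t = \<gamma> t"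
  shows "osc_op lam \<gamma> f x = osc_int {0..<1} \<gamma>' f' (lam *\<^sub>R x)"
proof -
  have [measurable]: "(\<lambda>t. cis ((lam *\<^sub>R x) \<bullet> \<gamma>' t)) \<in> borel_measurable lebesgue"
    by (rule measurable_completion) measurable
  have f1[measurable]: "(\<lambda>t. indicator {0..1} t *\<^sub>R f t) \<in> borel_measurable lebesgue"
    using f by (subst (asm) borel_measurable_restrict_space_iff) auto
  have "osc_op lam \<gamma> f x = (LINT t|lebesgue_on {0..1}. cis ((lam *\<^sub>R x) \<bullet> \<gamma>' t) * f t)"
    unfolding osc_op_def by (intro Bochner_Integration.integral_cong refl) (auto simp: cis_conv_exp \<gamma>)
  also have "\<dots> = (LINT t|lebesgue. indicator {0..1} t *\<^sub>R (cis ((lam *\<^sub>R x) \<bullet> \<gamma>' t) * f t))"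
    by (rule integral_restrict_space) auto
  also have "\<dots> = (LINT t|lebesgue. cis ((lam *\<^sub>R x) \<bullet> \<gamma>' t) * (indicator {0..1} t *\<^sub>R f t))"
    by (simp add: mult_ac)
  also have "\<dots> = (LINT t|lebesgue. indicator {0..<1} t * (cis ((lam *\<^sub>R x) \<bullet> \<gamma>' t) * f' t))"
  proof (rule integral_cong_AE)
    show "(\<lambda>t. indicator {0..<1} t * (cis ((lam *\<^sub>R x) \<bullet> \<gamma>' t) * f' t)) \<in> borel_measurable lebesgue"
      by (rule measurable_completion) measurable
    have "AE t in lborel. t \<noteq> (1::real)" by (rule AE_lborel_singleton)
    with eq have "AE t in lborel. cis ((lam *\<^sub>R x) \<bullet> \<gamma>' t) * (indicator {0..1} t *\<^sub>R f t) = indicator {0..<1} t * (cis ((lam *\<^sub>R x) \<bullet> \<gamma>' t) * f' t)"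
      by eventually_elim (auto simp: indicator_def)
    then show "AE t in lebesgue. cis ((lam *\<^sub>R x) \<bullet> \<gamma>' t) * (indicator {0..1} t *\<^sub>R f t) = indicator {0..<1} t * (cis ((lam *\<^sub>R x) \<bullet> \<gamma>' t) * f' t)"
      by (rule AE_completion)
  qed measurable
  also have "\<dots> = osc_int {0..<1} \<gamma>' f' (lam *\<^sub>R x)"
    unfolding osc_int_def by (rule integral_completion) measurable
  finally show ?thesis .
qed

text \<open>Inclusion of Lebesgue spaces on the unit interval. The factor 2 of
  \<open>nn_integral_powr_le\<close> is absorbed into \<open>2 * M\<close> because
  \<open>r \<ge> 1\<close>; mass zero is treated apart since that lemma needs a positive
  bound.\<close>

lemma Lp_norm_controls_lower_exponent:
  fixes f f' :: "real \<Rightarrow> complex" and p :: ennreal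
  assumes f: "f \<in> borel_measurable (lebesgue_on {0..1})" and f'[measurable]: "f' \<in> borel_measurable borel"
    and eq: "AE t in lborel. t \<in> {0..1} \<longrightarrow> f t = f' t"
    and r: "1 \<le> r" "ennreal r \<le> p" and M: "0 \<le> M" "Lp_norm p (lebesgue_on {0..1}) f = ennreal M"
  shows "Lp_mass r {0..<1} f' \<le> ennreal ((2 * M) powr r)"
proof (cases "p = \<infinity>")
  case True
  have "AE t in lebesgue_on {0..1}. ennreal (norm (f t)) \<le> ennreal M"
    using M(2) True esssup_AE[of "\<lambda>t. ennreal (norm (f t))" "lebesgue_on {0..1}"] by (simp add: Lp_norm_def)
  then have "AE t in lebesgue. t \<in> {0..1} \<longrightarrow> ennreal (norm (f t)) \<le> ennreal M"
    by (subst (asm) AE_restrict_space_iff) auto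
  then have "AE t in lborel. t \<in> {0..1} \<longrightarrow> ennreal (norm (f t)) \<le> ennreal M"
    by (simp add: AE_completion_iff)
  with eq have "AE t in lborel. ennreal (norm (f' t) powr r) * indicator {0..<1} t \<le> ennreal ((2 * M) powr r) * indicator {0..<1} t"
  proof eventually_elim
    fix t assume "t \<in> {0..1} \<longrightarrow> f t = f' t" "t \<in> {0..1} \<longrightarrow> ennreal (norm (f t)) \<le> ennreal M"
    then show "ennreal (norm (f' t) powr r) * indicator {0..<1} t \<le> ennreal ((2 * M) powr r) * indicator {0..<1} t"
      using M(1) r by (auto simp: indicator_def ennreal_le_iff intro!: ennreal_leI powr_mono2)
  qed
  then have "Lp_mass r {0..<1} f' \<le> (\<integral>\<^sup>+t. ennreal ((2 * M) powr r) * indicator {0..<1::real} t \<partial>lborel)"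
    by (rule nn_integral_mono_AE)
  then show ?thesis by (simp add: nn_integral_cmult_indicator)
next
  case False
  then obtain p' where p': "p = ennreal p'" "0 \<le> p'" by (metis ennreal_cases infinity_ennreal_def)
  have rp: "r \<le> p'" using r p' by (simp add: ennreal_le_iff)
  define J where "J = Lp_mass p' {0..1} f'"
  have Lp: "Lp_norm p (lebesgue_on {0..1}) f = (if J = \<infinity> then \<infinity> else ennreal (enn2real J powr (1 / p')))"
    unfolding Lp_norm_def using p' lebesgue_on_nn_integral_eq[OF f f' eq, of p'] by (simp add: J_def Let_def)
  then have "J \<noteq> \<infinity>" using M by auto
  then obtain a where a: "J = ennreal a" "0 \<le> a" by (metis ennreal_cases infinity_ennreal_def)
  have Ma: "M = a powr (1 / p')"
    using Lp M a by (simp add: ennreal_inj)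
  have le: "Lp_mass p' {0..<1} f' \<le> ennreal a"
    unfolding a(1)[symmetric] J_def by (intro nn_integral_mono) (auto simp: indicator_def)
  show ?thesis
  proof (cases "a = 0")
    case True
    then have "Lp_mass p' {0..<1} f' = 0" using le by simp
    then have "AE t in lborel. ennreal (norm (f' t) powr p') * indicator {0..<1} t = 0"
      by (subst (asm) nn_integral_0_iff_AE) auto
    then have "AE t in lborel. ennreal (norm (f' t) powr r) * indicator {0..<1} t = 0"
      by eventually_elim (auto simp: indicator_def)
    then have "Lp_mass r {0..<1} f' = (\<integral>\<^sup>+t. 0 \<partial>(lborel :: real measure))"
      by (rule nn_integral_cong_AE)
    then show ?thesis by simp
  next
    case False
    have "Lp_mass r {0..<1} f' \<le> ennreal (2 * a powr (r / p'))"
      by (rule nn_integral_powr_le[OF f' _ order_refl _ rp _ le]) (use r False a in auto)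
    also have "\<dots> \<le> ennreal ((2 * M) powr r)"
    proof (rule ennreal_leI)
      have "2 * a powr (r / p') \<le> 2 powr r * a powr (r / p')"
        using powr_mono[of 1 r 2] r by (intro mult_right_mono) auto
      then show "2 * a powr (r / p') \<le> (2 * M) powr r"
        by (simp add: Ma powr_mult powr_powr)
    qed
    finally show ?thesis .
  qed
qed

text \<open>\<open>m\<close> is \<open>j + 1\<close>. Raising \<open>m\<close> by one changes the
  expression by \<open>\<alpha> - (d - m)\<close>, which increases with \<open>m\<close> and changes
  sign there, so \<open>\<beta>(\<alpha>)\<close> is the minimum over \<open>m\<close> and hence the
  best exponent that \<open>rescaled_ball_measure\<close> can give.\<close>

lemma beta_exponent_eq:
  assumes "0 < \<alpha>" "\<alpha> \<le> real d"
  shows "\<exists>m\<le>d. beta_exponent d \<alpha> = real m * \<alpha> + (real d - real m) * (real d - real m + 1) / 2"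
proof -
  let ?P = "\<lambda>j. j < d \<and> real d - real j - 1 < \<alpha> \<and> \<alpha> \<le> real d - real j"
  define k where "k = nat \<lfloor>real d - \<alpha>\<rfloor>"
  have k: "real k \<le> real d - \<alpha>" "real d - \<alpha> < real k + 1"
    unfolding k_def using assms by linarith+
  have Pk: "?P k" using k assms by auto
  have "j = k" if "?P j" for j using that k by linarith
  with Pk have the: "(THE j. ?P j) = k" by (rule the_equality[of ?P])
  show ?thesis
    unfolding beta_exponent_def Let_def the using Pk
    by (intro exI[of _ "k + 1"]) (auto simp: algebra_simps)
qed

theorem mainTheorem4:
  fixes d :: nat and \<alpha> :: real and p q :: ennreal
  assumes "d = CARD('n::{finite,linorder})" and "2 \<le> d"
    and "0 < \<alpha>" and "\<alpha> \<le> real d"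
    and "1 \<le> p" and "1 \<le> q"
    and "of_nat d / q \<le> 1 - 1 / p"
    and "2 * of_nat d \<le> q"
    and "ennreal (beta_exponent d \<alpha>) / q + 1 / p < 1"
    and "ennreal (beta_exponent d \<alpha> + 1) < q"
  shows "\<exists>\<epsilon>\<^sub>0>0. \<forall>\<epsilon>. 0 < \<epsilon> \<and> \<epsilon> \<le> \<epsilon>\<^sub>0 \<longrightarrow>
    (\<exists>C>0. \<forall>\<gamma> \<in> (curves_near_moment \<epsilon> :: (real \<Rightarrow> real ^ ('n::{finite,linorder})) set).
       \<forall>\<mu> \<in> frostman_measures \<alpha> 1. \<forall>lam\<ge>1. \<forall>f \<in> Lp_space p (lebesgue_on {0..1}).
         Lp_norm q \<mu> (osc_op lam \<gamma> f)
           \<le> ennreal (C * lam powr (- enn2real (ennreal \<alpha> / q))) * Lp_norm p (lebesgue_on {0..1}) f)"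
proof (cases "q = \<infinity>")
  case True
  \<comment> \<open>For infinite \<open>q\<close> the quotient \<open>ennreal \<alpha> / q\<close>
    is 0, so no decay is claimed and the L1 norm of the function suffices.\<close>
  show ?thesis
  proof (rule exI[of _ 1], intro conjI allI impI exI[of _ 2] ballI)
    fix \<epsilon> :: real and \<gamma> :: "real \<Rightarrow> (real, 'n) vec" and \<mu> :: "(real, 'n) vec measure" and lam :: real and f :: "real \<Rightarrow> complex"
    assume \<gamma>: "\<gamma> \<in> curves_near_moment \<epsilon>" and \<mu>: "\<mu> \<in> frostman_measures \<alpha> 1" and lam: "1 \<le> lam"
      and f: "f \<in> Lp_space p (lebesgue_on {0..1})"
    obtain g where g: "near_moment \<epsilon> g" "\<And>t. t \<in> {0..1} \<Longrightarrow> g 0 t = \<gamma> t"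
      using curves_near_moment_imp_near_moment[OF \<gamma>] by auto
    have g0[measurable]: "g 0 \<in> borel_measurable borel" using g(1) by (simp add: near_moment_def)
    have fm: "f \<in> borel_measurable (lebesgue_on {0..1})" using f by (simp add: Lp_space_def)
    obtain f' where f'[measurable]: "f' \<in> borel_measurable borel" and eq: "AE t in lborel. t \<in> {0..1} \<longrightarrow> f t = f' t"
      using borel_representative[OF fm] by blast
    obtain M where M: "0 \<le> M" "Lp_norm p (lebesgue_on {0..1}) f = ennreal M"
      using f by (auto simp: Lp_space_def less_top_ennreal)
    have L1: "Lp_mass 1 {0..<1} f' \<le> ennreal ((2 * M) powr 1)"
      by (rule Lp_norm_controls_lower_exponent[OF fm f' eq _ _ M]) (use assms(5) in auto)
    have T: "osc_op lam \<gamma> f x = osc_int {0..<1} (g 0) f' (lam *\<^sub>R x)" for x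
      by (rule osc_op_eq_osc_int[OF fm f' eq g0 g(2)])
    have L1': "(\<integral>\<^sup>+t. ennreal (norm (indicator {0..<1} t * f' t)) \<partial>lborel) \<le> ennreal (2 * M)"
    proof -
      have "(\<integral>\<^sup>+t. ennreal (norm (indicator {0..<1} t * f' t)) \<partial>lborel) = Lp_mass 1 {0..<1} f'"
        by (intro nn_integral_cong) (auto simp: indicator_def)
      then show ?thesis using L1 M by simp
    qed
    have int: "integrable lborel (\<lambda>t. indicator {0..<1} t * f' t)"
      by (intro integrableI_bounded le_less_trans[OF L1']) auto
    have bound: "ennreal (norm (osc_int {0..<1} (g 0) f' y)) \<le> ennreal (2 * M)" for y
    proof -
      have "integrable lborel (\<lambda>t. indicator {0..<1} t * (cis (y \<bullet> g 0 t) * f' t))"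
        by (rule Bochner_Integration.integrable_bound[OF int]) (auto simp: norm_mult)
      then have "ennreal (norm (osc_int {0..<1} (g 0) f' y)) \<le> (\<integral>\<^sup>+t. ennreal (norm (indicator {0..<1} t * (cis (y \<bullet> g 0 t) * f' t))) \<partial>lborel)"
        unfolding osc_int_def by (rule integral_norm_bound_ennreal)
      also have "\<dots> \<le> ennreal (2 * M)" using L1' by (simp add: norm_mult)
      finally show ?thesis .
    qed
    have sets[measurable_cong]: "sets \<mu> = sets borel" using \<mu> by (simp add: frostman_measures_def)
    have [measurable]: "osc_int {0..<1} (g 0) f' \<in> borel_measurable borel"
      by (rule borel_measurable_osc_int) auto
    have "Lp_norm q \<mu> (osc_op lam \<gamma> f) = esssup \<mu> (\<lambda>x. ennreal (norm (osc_int {0..<1} (g 0) f' (lam *\<^sub>R x))))"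
      using True by (simp add: Lp_norm_def T)
    also have "\<dots> \<le> ennreal (2 * M)"
      by (rule esssup_I) (auto simp: bound)
    also have "\<dots> = ennreal (2 * lam powr (- enn2real (ennreal \<alpha> / q))) * Lp_norm p (lebesgue_on {0..1}) f"
      using True lam M by (simp add: ennreal_mult')
    finally show "Lp_norm q \<mu> (osc_op lam \<gamma> f) \<le> ennreal (2 * lam powr (- enn2real (ennreal \<alpha> / q))) * Lp_norm p (lebesgue_on {0..1}) f" .
  qed auto
next
  case False
  define \<beta> where "\<beta> = beta_exponent d \<alpha>"
  obtain m where m: "m \<le> d" "\<beta> = real m * \<alpha> + (real d - real m) * (real d - real m + 1) / 2"
    using beta_exponent_eq[OF assms(3,4)] by (auto simp: \<beta>_def)
  have \<beta>0: "0 \<le> \<beta>" using assms(3) m by (auto intro!: add_nonneg_nonneg mult_nonneg_nonneg)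
  obtain q' where q': "q = ennreal q'" "0 \<le> q'" using False by (metis ennreal_cases infinity_ennreal_def)
  have q2d: "2 * real d \<le> q'"
  proof -
    have "ennreal (2 * real d) = 2 * of_nat d"
      by (simp add: ennreal_mult' ennreal_of_nat_eq_real_of_nat)
    then have "ennreal (2 * real d) \<le> ennreal q'" using assms(8) q' by simp
    then show ?thesis using q' by (simp add: ennreal_le_iff)
  qed
  have q1: "\<beta> + 1 < q'"
    using assms(10) \<beta>0 unfolding q'(1) \<beta>_def[symmetric] by (subst (asm) ennreal_less_iff) auto
  have d2: "2 \<le> real d" using assms(2) by simp
  have qpos: "0 < q'" using q2d d2 by linarith
  define s where "s = q' / real d"
  have s: "2 \<le> s" "q' = real d * s" using q2d d2 by (auto simp: s_def field_simps)
  \<comment> \<open>The working exponent \<open>r\<close> is \<open>p\<close> if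
    \<open>p \<le> q\<close> and \<open>q\<close> otherwise. In the second case the first inequality
    is \<open>d + 1 \<le> q'\<close> and the last one is \<open>\<beta> + 1 < q'\<close>.\<close>
  have "\<exists>r. 1 < r \<and> r \<le> q' \<and> ennreal r \<le> p \<and> real d / q' + 1 / r \<le> 1 \<and> \<beta> / q' + 1 / r < 1"
  proof (cases "p \<le> q")
    case True
    then obtain p' where p': "p = ennreal p'" "0 \<le> p'" using q' by (metis ennreal_cases ennreal_less_top le_less_trans less_irrefl)
    have p1: "1 \<le> p'" using assms(5) p' by (simp add: ennreal_1[symmetric] ennreal_le_iff del: ennreal_1)
    have inv: "1 / p = ennreal (1 / p')" using p1 p' divide_ennreal[of 1 p'] by simp
    have dq: "of_nat d / q = ennreal (real d / q')"
      using qpos q' divide_ennreal[of "real d" q'] by (simp add: ennreal_of_nat_eq_real_of_nat)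
    have "1 - 1 / p = ennreal (1 - 1 / p')"
      unfolding inv using p1 by (subst ennreal_minus[symmetric]) auto
    then have 1: "real d / q' \<le> 1 - 1 / p'"
      using assms(7) dq p1 by (simp add: ennreal_le_iff)
    have "0 < real d / q'" using d2 qpos by simp
    then have "1 / p' < 1" using 1 by linarith
    then have "1 < p'" using p1 by (simp add: field_simps)
    moreover have "\<beta> / q' + 1 / p' < 1"
    proof -
      have "ennreal \<beta> / q = ennreal (\<beta> / q')" using qpos q' \<beta>0 divide_ennreal[of \<beta> q'] by simp
      then have "ennreal (\<beta> / q' + 1 / p') < ennreal 1"
        using assms(9) inv \<beta>0 p1 qpos by (simp add: \<beta>_def[symmetric])
      then show ?thesis using \<beta>0 p1 qpos by (subst (asm) ennreal_less_iff) auto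
    qed
    moreover have "p' \<le> q'" using True p' q' by (simp add: ennreal_le_iff)
    ultimately show ?thesis using 1 p' by (intro exI[of _ p']) auto
  next
    case False
    have "real d / q' + 1 / q' \<le> 1" using q2d d2 qpos by (simp add: add_divide_distrib[symmetric])
    moreover have "\<beta> / q' + 1 / q' < 1" using q1 qpos by (simp add: add_divide_distrib[symmetric])
    ultimately show ?thesis using False q' q2d d2 by (intro exI[of _ q']) auto
  qed
  then obtain r where r: "1 < r" "r \<le> q'" "ennreal r \<le> p" "real d / q' + 1 / r \<le> 1" "\<beta> / q' + 1 / r < 1" by blast
  \<comment> \<open>Since \<open>d / q' = 1 / s\<close>, the inequality
    \<open>d / q' + 1 / r \<le> 1\<close> says that \<open>r\<close> is at least the conjugate
    exponent of \<open>s\<close>.\<close>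
  have sr: "s / (s - 1) \<le> r"
  proof -
    have "real d / q' = 1 / s" using s d2 by simp
    then have "1 / s + 1 / r \<le> 1" using r by simp
    then have "(1 / s + 1 / r) * (s * r) \<le> 1 * (s * r)" using s r by (intro mult_right_mono) auto
    moreover have "(1 / s + 1 / r) * (s * r) = r + s"
      using s(1) r(1) by (simp add: distrib_right)
    ultimately have "r + s \<le> s * r" by simp
    then show ?thesis using s(1) by (simp add: field_simps)
  qed
  obtain \<epsilon>\<^sub>0 B where \<epsilon>\<^sub>0: "0 < \<epsilon>\<^sub>0" and B: "0 \<le> B"
    and bd: "\<And>\<epsilon> V. 0 \<le> \<epsilon> \<Longrightarrow> \<epsilon> \<le> \<epsilon>\<^sub>0 \<Longrightarrow> 0 \<le> V \<Longrightarrow> osc_bound TYPE('n) \<epsilon> \<alpha> r q' (ennreal V) B"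
    using osc_bound_finite_mass[where 'n='n and \<alpha>=\<alpha> and p=r and s=s and m=m and q=q' and \<beta>=\<beta>]
      assms(3) m r s sr unfolding assms(1) by blast
  define C where "C = 2 * B powr (1 / q') + 1"
  show ?thesis
  proof (rule exI[of _ \<epsilon>\<^sub>0], rule conjI[OF \<epsilon>\<^sub>0], intro allI impI, rule exI[of _ C], intro conjI ballI allI impI)
    show "0 < C" by (simp add: C_def add_nonneg_pos)
    fix \<epsilon> :: real and \<gamma> :: "real \<Rightarrow> (real, 'n) vec" and \<mu> :: "(real, 'n) vec measure" and lam :: real and f :: "real \<Rightarrow> complex"
    assume \<epsilon>: "0 < \<epsilon> \<and> \<epsilon> \<le> \<epsilon>\<^sub>0"
      and \<gamma>: "\<gamma> \<in> curves_near_moment \<epsilon>" and \<mu>: "\<mu> \<in> frostman_measures \<alpha> 1" and lam: "1 \<le> lam"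
      and f: "f \<in> Lp_space p (lebesgue_on {0..1})"
    have bd_inf: "osc_bound TYPE('n) \<epsilon> \<alpha> r q' \<infinity> B"
      by (rule osc_bound_any_mass) (use bd \<epsilon> in auto)
    obtain g where g: "near_moment \<epsilon> g" "\<And>t. t \<in> {0..1} \<Longrightarrow> g 0 t = \<gamma> t"
      using curves_near_moment_imp_near_moment[OF \<gamma>] by auto
    have g0[measurable]: "g 0 \<in> borel_measurable borel" using g(1) by (simp add: near_moment_def)
    have fm: "f \<in> borel_measurable (lebesgue_on {0..1})" using f by (simp add: Lp_space_def)
    obtain f' where f'[measurable]: "f' \<in> borel_measurable borel" and eq: "AE t in lborel. t \<in> {0..1} \<longrightarrow> f t = f' t"
      using borel_representative[OF fm] by blast
    obtain M where M: "0 \<le> M" "Lp_norm p (lebesgue_on {0..1}) f = ennreal M"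
      using f by (auto simp: Lp_space_def less_top_ennreal)
    have Lr: "Lp_mass r {0..<1} f' \<le> ennreal ((2 * M) powr r)"
      by (rule Lp_norm_controls_lower_exponent[OF fm f' eq _ r(3) M]) (use r in auto)
    have T: "osc_op lam \<gamma> f x = osc_int {0..<1} (g 0) f' (lam *\<^sub>R x)" for x
      by (rule osc_op_eq_osc_int[OF fm f' eq g0 g(2)])
    have [measurable]: "osc_int {0..<1} (g 0) f' \<in> borel_measurable borel"
      by (rule borel_measurable_osc_int) auto
    have lam0: "0 < lam" using lam by simp
    obtain \<nu> :: "(real, 'n) vec measure" where \<nu>: "\<nu> \<in> frostman_measures \<alpha> 1"
      and int\<nu>: "\<And>F. F \<in> borel_measurable borel \<Longrightarrow> (\<integral>\<^sup>+x. F (lam *\<^sub>R x) \<partial>\<mu>) = ennreal (lam powr - \<alpha>) * (\<integral>\<^sup>+y. F y \<partial>\<nu>)"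
      using dilated_frostman[OF \<mu> lam0] by blast
    define J where "J = (\<integral>\<^sup>+x. ennreal (norm (osc_op lam \<gamma> f x) powr q') \<partial>\<mu>)"
    have "J = ennreal (lam powr - \<alpha>) * (\<integral>\<^sup>+y. ennreal (norm (osc_int {0..<1} (g 0) f' y) powr q') \<partial>\<nu>)"
      unfolding J_def T by (rule int\<nu>) measurable
    also have "(\<integral>\<^sup>+y. ennreal (norm (osc_int {0..<1} (g 0) f' y) powr q') \<partial>\<nu>) \<le> ennreal (B * ((2 * M) powr r) powr (q' / r))"
      by (rule osc_boundD[OF bd_inf g(1) \<nu> _ f' B _ qpos _ Lr]) (use r in auto)
    finally have "J \<le> ennreal (lam powr - \<alpha>) * ennreal (B * ((2 * M) powr r) powr (q' / r))"
      by (simp add: mult_left_mono)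
    also have "\<dots> = ennreal (lam powr - \<alpha> * (B * (2 * M) powr q'))"
      using r by (simp add: ennreal_mult'[symmetric] powr_powr)
    finally have J: "J \<le> ennreal (lam powr - \<alpha> * (B * (2 * M) powr q'))" .
    then have Jfin: "J \<noteq> \<infinity>" using ennreal_less_top le_less_trans by (metis infinity_ennreal_def less_irrefl)
    have "enn2real J \<le> lam powr - \<alpha> * (B * (2 * M) powr q')"
      using J B by (intro enn2real_leI) auto
    then have "enn2real J powr (1 / q') \<le> (lam powr - \<alpha> * (B * (2 * M) powr q')) powr (1 / q')"
      using qpos by (intro powr_mono2) auto
    also have "\<dots> = lam powr (- (\<alpha> / q')) * (B powr (1 / q') * (2 * M))"
      using qpos M by (simp add: powr_mult powr_powr)
    also have "\<dots> \<le> C * lam powr (- (\<alpha> / q')) * M"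
      using M by (simp add: C_def algebra_simps)
    finally have fin: "enn2real J powr (1 / q') \<le> C * lam powr (- (\<alpha> / q')) * M" .
    have aq: "enn2real (ennreal \<alpha> / q) = \<alpha> / q'"
      using q' qpos assms(3) by (simp add: divide_ennreal)
    have "Lp_norm q \<mu> (osc_op lam \<gamma> f) = ennreal (enn2real J powr (1 / q'))"
      unfolding Lp_norm_def using False q' Jfin by (simp add: Let_def J_def)
    also have "\<dots> \<le> ennreal (C * lam powr (- (\<alpha> / q')) * M)" by (rule ennreal_leI[OF fin])
    also have "\<dots> = ennreal (C * lam powr (- enn2real (ennreal \<alpha> / q))) * Lp_norm p (lebesgue_on {0..1}) f"
      unfolding aq M(2) using M(1) by (simp add: ennreal_mult'')
    finally show "Lp_norm q \<mu> (osc_op lam \<gamma> f) \<le> ennreal (C * lam powr (- enn2real (ennreal \<alpha> / q))) * Lp_norm p (lebesgue_on {0..1}) f" .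
  qed
qed

end
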